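(* For any integers $s,t,k\ge 1$, $\mathrm{ex}(n,K_{s,t}^{k-1})=O(n^{1+\frac{s}{sk+1}})$ as $n\to\infty$ (with implied constant depending on $s,t,k$). In particular, for any bipartite graph $H$ and any integer $k\ge 1$, there exists $\delta>0$ such that $\mathrm{ex}(n,H^{k-1})=O(n^{1+1/k-\delta})$.
   Context: For a graph $H$, $\mathrm{ex}(n,H)$ is the maximum number of edges in an $n$-vertex graph containing no copy of $H$ as a subgraph. For an integer $m\ge 0$, $H^m$ denotes the $m$-subdivision of $H$, i.e. the graph obtained by replacing the edges of $H$ by internally disjoint paths of length $m+1$; in particular $H^0=H$. So $K_{s,t}^{k-1}$ is obtained from the complete bipartite graph $K_{s,t}$ by replacing its edges by internally disjoint paths of length $k$. *)

theory Defs
  imports Complex_Main "HOL-Library.Landau_Symbols"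
begin

record 'a ugraph =
  verts :: "'a set"
  edges :: "'a set set"

definition finite_simple_graph :: "'a ugraph \<Rightarrow> bool" where
  "finite_simple_graph G \<longleftrightarrow>
     finite (verts G) \<and> (\<forall>e\<in>edges G. e \<subseteq> verts G \<and> card e = 2)"

text \<open>A copy is a not necessarily induced subgraph isomorphic to \<open>H\<close>.\<close>

definition contains_copy :: "'b ugraph \<Rightarrow> 'a ugraph \<Rightarrow> bool" where
  "contains_copy G H \<longleftrightarrow>
     (\<exists>f. inj_on f (verts H) \<and> f ` verts H \<subseteq> verts G \<and> (\<forall>e\<in>edges H. f ` e \<in> edges G))"

definition free_edge_counts :: "nat \<Rightarrow> 'a ugraph \<Rightarrow> nat set" where
  "free_edge_counts n H =
     {card (edges G) | G :: nat ugraph.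
        finite_simple_graph G \<and> card (verts G) = n \<and> \<not> contains_copy G H}"

text \<open>
  The Turan number \<open>ex(n, H)\<close>. Taking the vertices to be natural numbers is no
  restriction, as every finite graph is isomorphic to such a graph. The supremum is a maximum
  whenever some \<open>n\<close>-vertex graph contains no copy of \<open>H\<close>; there is none only if \<open>H\<close> has
  no edges and at most \<open>n\<close> vertices, and then the value is 0 by convention.
\<close>

definition extremal_number :: "nat \<Rightarrow> 'a ugraph \<Rightarrow> nat" where
  "extremal_number n H = Sup (free_edge_counts n H)"

definition complete_bipartite :: "nat \<Rightarrow> nat \<Rightarrow> (nat + nat) ugraph" where
  "complete_bipartite s t =
     \<lparr> verts = Inl ` {..<s} \<union> Inr ` {..<t},
       edges = {{Inl i, Inr j} | i j. i < s \<and> j < t} \<rparr>"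

definition bipartite :: "'a ugraph \<Rightarrow> bool" where
  "bipartite H \<longleftrightarrow>
     (\<exists>A B. A \<union> B = verts H \<and> A \<inter> B = {} \<and> (\<forall>e\<in>edges H. \<exists>a\<in>A. \<exists>b\<in>B. e = {a, b}))"

text \<open>
  Edges carry no orientation, so the subdivision vertex of the edge \<open>{u, v}\<close> at distance \<open>i\<close>
  from \<open>u\<close> along the path of length \<open>m + 1\<close> replacing that edge is named by the unordered pair
  \<open>{(u, i), (v, m + 1 - i)}\<close>, which also says that it is at distance \<open>m + 1 - i\<close> from \<open>v\<close>.
\<close>

datatype 'a subdiv_vertex = Branch 'a | Inner "('a \<times> nat) set"

definition path_vertex :: "nat \<Rightarrow> 'a \<Rightarrow> 'a \<Rightarrow> nat \<Rightarrow> 'a subdiv_vertex" where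
  "path_vertex m u v i =
     (if i = 0 then Branch u
      else if i = m + 1 then Branch v
      else Inner {(u, i), (v, m + 1 - i)})"

definition subdivision :: "nat \<Rightarrow> 'a ugraph \<Rightarrow> 'a subdiv_vertex ugraph" where
  "subdivision m H =
     \<lparr> verts = Branch ` verts H \<union> {path_vertex m u v i | u v i. {u, v} \<in> edges H \<and> 1 \<le> i \<and> i \<le> m},
       edges = {{path_vertex m u v i, path_vertex m u v (i + 1)} | u v i. {u, v} \<in> edges H \<and> i \<le> m} \<rparr>"

lemma path_vertex_rev: "i \<le> m + 1 \<Longrightarrow> path_vertex m v u (m + 1 - i) = path_vertex m u v i"
  by (auto simp: path_vertex_def)

lemma path_vertex_inj_on: "u \<noteq> v \<Longrightarrow> inj_on (path_vertex m u v) {..m + 1}"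
  by (auto simp: path_vertex_def inj_on_def doubleton_eq_iff split: if_splits)

lemma paths_internally_disjoint:
  assumes "path_vertex m u v i = path_vertex m u' v' j" "1 \<le> i" "i \<le> m" "j \<le> m + 1"
  shows "{u, v} = {u', v'}"
  using assms by (auto simp: path_vertex_def doubleton_eq_iff split: if_splits)

lemma finite_simple_graph_subdivision:
  assumes "finite_simple_graph H"
  shows "finite_simple_graph (subdivision m H)"
proof -
  have H: "finite (verts H)" "\<And>u v. {u, v} \<in> edges H \<Longrightarrow> u \<in> verts H \<and> v \<in> verts H \<and> u \<noteq> v"
    using assms by (fastforce simp: finite_simple_graph_def)+
  have "{path_vertex m u v i | u v i. {u, v} \<in> edges H \<and> 1 \<le> i \<and> i \<le> m}
      \<subseteq> (\<lambda>(u, v, i). path_vertex m u v i) ` (verts H \<times> verts H \<times> {..m})"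
    using H(2) by force
  moreover have "finite ((\<lambda>(u, v, i). path_vertex m u v i) ` (verts H \<times> verts H \<times> {..m}))"
    using H(1) by simp
  ultimately have "finite {path_vertex m u v i | u v i. {u, v} \<in> edges H \<and> 1 \<le> i \<and> i \<le> m}"
    by (rule finite_subset)
  then have fin: "finite (verts (subdivision m H))"
    using H(1) by (simp add: subdivision_def)
  have in_verts: "path_vertex m u v i \<in> verts (subdivision m H)"
    if "{u, v} \<in> edges H" "i \<le> m + 1" for u v i
  proof (cases "1 \<le> i \<and> i \<le> m")
    case True
    with that show ?thesis by (auto simp: subdivision_def)
  next
    case False
    with that have "i = 0 \<or> i = m + 1" by linarith
    with H(2)[OF that(1)] show ?thesis by (auto simp: subdivision_def path_vertex_def)
  qed
  have "e \<subseteq> verts (subdivision m H) \<and> card e = 2" if "e \<in> edges (subdivision m H)" for e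
  proof -
    from that obtain u v i where e: "e = {path_vertex m u v i, path_vertex m u v (i + 1)}"
      "{u, v} \<in> edges H" "i \<le> m" by (auto simp: subdivision_def)
    have "path_vertex m u v i \<noteq> path_vertex m u v (i + 1)"
      using inj_onD[OF path_vertex_inj_on, of u v m i "i + 1"] H(2)[OF e(2)] e(3) by auto
    with e in_verts show ?thesis by auto
  qed
  with fin show ?thesis by (simp add: finite_simple_graph_def)
qed

lemma finite_free_edge_counts: "finite (free_edge_counts n H)"
proof (rule finite_subset)
  show "free_edge_counts n H \<subseteq> {..2 ^ n}"
  proof
    fix c assume "c \<in> free_edge_counts n H"
    then obtain G :: "nat ugraph" where G: "c = card (edges G)" "finite_simple_graph G" "card (verts G) = n"
      by (auto simp: free_edge_counts_def)
    then have "edges G \<subseteq> Pow (verts G)" "finite (verts G)"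
      by (auto simp: finite_simple_graph_def)
    with G show "c \<in> {..2 ^ n}"
      by (metis atMost_iff card_Pow card_mono finite_Pow_iff)
  qed
qed simp

lemma extremal_number_eq_Max:
  "free_edge_counts n H \<noteq> {} \<Longrightarrow> extremal_number n H = Max (free_edge_counts n H)"
  by (simp add: extremal_number_def cSup_eq_Max finite_free_edge_counts)

end

theory Submission
  imports Defs "HOL-Library.FuncSet"
begin

text \<open>
  Pass to a subgraph with \<open>n\<close> vertices and all degrees in \<open>[d, K d]\<close>, where \<open>d ^ (s k + 1) \<ge> C n ^ s\<close>.
  Call a pair robust for the length \<open>l\<close> if no small set meets all the paths of length \<open>l\<close> between its
  two vertices.

  If few walks of each length \<open>l \<le> k\<close> have robust ends, most \<open>k\<close>-walks are paths without a robust
  subpath, and boundedly many of these join any two vertices. Counting the spiders formed by \<open>s\<close>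
  such paths, some \<open>s\<close> leaves are shared by many centres, of which \<open>t\<close> with disjoint legs can be
  picked greedily.

  Otherwise a positive proportion of the \<open>l\<close>-walks, for some \<open>2 \<le> l \<le> k\<close>, have robust ends. Then a set
  \<open>X\<close> of at least \<open>c d\<close> neighbours of a vertex is completely joined, by pairs robust for the length
  \<open>h\<close>, to a large set \<open>Y h\<close>, for each \<open>h\<close> from \<open>l\<close> to \<open>2 l - 2\<close>. Since only \<open>O(d)\<close> vertices are adjacent
  to a fixed element of \<open>Y l\<close>, some \<open>s\<close> vertices are joined to \<open>X\<close> by large fans of a common length
  \<open>i < l\<close>. Concatenating these connections produces robust pairs for the length \<open>k\<close>, whatever the
  residue of \<open>k\<close> modulo \<open>2 l\<close>, and a complete bipartite graph of such pairs contains the subdivision.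
\<close>

section \<open>Paths, robust pairs and fans\<close>

text \<open>The exponent comes from the spider count on \<open>n\<close> vertices. There are about
  \<open>n * d ^ (s * k)\<close> spiders and \<open>n ^ s\<close> leaf tuples, and the greedy choice
  succeeds once some tuple has more than a constant times \<open>d ^ (k - 1)\<close> centres. If
  none has, \<open>n * d ^ (s * k)\<close> is at most of order \<open>n ^ s * d ^ (k - 1)\<close>.
  Boundedly many clean paths join any two vertices, so \<open>d ^ k\<close> is at most of order
  \<open>n\<close>; multiplying by \<open>d\<close> then bounds \<open>d ^ (s * k + 1)\<close> by a
  constant times \<open>n ^ s\<close>.

  The obstacle in the other case is that robust pairs come with some length \<open>l\<close> below
  or equal to \<open>k\<close>, while paths of length exactly \<open>k\<close> are needed. Lengths
  can only be added, so a single length would reach only its multiples; this is why a whole range of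
  lengths from the same set \<open>X\<close> is prepared.

  The constants are fixed in an order that avoids circularity. The thresholds \<open>M'\<close> and
  \<open>N\<close> that the embedding needs and the proportions \<open>\<epsilon>\<close>,
  \<open>\<eta>\<close>, \<open>c\<close> depend on \<open>s\<close>, \<open>t\<close>,
  \<open>k\<close>, \<open>K\<close> alone. The robustness \<open>M\<close> of the given pairs comes
  after \<open>c\<close>, since finding fans needs \<open>c * (M - s * k)\<close> to beat a function
  of \<open>M'\<close>; the lower bound on \<open>d\<close> comes last.\<close>

definition walk :: "('a \<Rightarrow> 'a \<Rightarrow> bool) \<Rightarrow> nat \<Rightarrow> 'a list \<Rightarrow> bool" where
  "walk E l p \<longleftrightarrow> length p = Suc l \<and> (\<forall>i<l. E (p ! i) (p ! Suc i))"

definition walks :: "('a \<Rightarrow> 'a \<Rightarrow> bool) \<Rightarrow> nat \<Rightarrow> 'a \<Rightarrow> 'a list set" where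
  "walks E l x = {p. walk E l p \<and> p ! 0 = x}"

definition path :: "('a \<Rightarrow> 'a \<Rightarrow> bool) \<Rightarrow> nat \<Rightarrow> 'a \<Rightarrow> 'a \<Rightarrow> 'a list \<Rightarrow> bool" where
  "path E l x y p \<longleftrightarrow> walk E l p \<and> p ! 0 = x \<and> p ! l = y \<and> distinct p"

text \<open>Fault tolerance is phrased by hitting sets rather than by disjoint paths: a path can
  then be routed around everything already used, and failure directly yields a small set at which
  all the paths can be cut. An edge between distinct vertices is robust for the length 1 whatever
  \<open>M\<close> is, as its path has no inner vertex.\<close>

definition robust :: "('a \<Rightarrow> 'a \<Rightarrow> bool) \<Rightarrow> nat \<Rightarrow> nat \<Rightarrow> 'a \<Rightarrow> 'a \<Rightarrow> bool" where
  "robust E M l x y \<longleftrightarrow> x \<noteq> y \<and>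
     (\<forall>Z. finite Z \<and> card Z \<le> M \<and> x \<notin> Z \<and> y \<notin> Z \<longrightarrow> (\<exists>p. path E l x y p \<and> set p \<inter> Z = {}))"

text \<open>Unlike in \<open>robust\<close>, the forbidden set may contain ends: only the centre is
  protected, so a fan survives the loss of a few vertices of \<open>S\<close>.\<close>

definition fan :: "('a \<Rightarrow> 'a \<Rightarrow> bool) \<Rightarrow> nat \<Rightarrow> nat \<Rightarrow> 'a \<Rightarrow> 'a set \<Rightarrow> bool" where
  "fan E M l x S \<longleftrightarrow>
     (\<forall>Z. finite Z \<and> card Z \<le> M \<and> x \<notin> Z \<longrightarrow> (\<exists>p. \<exists>b\<in>S. path E l x b p \<and> set p \<inter> Z = {}))"

section \<open>Concatenation of paths and of robust connections\<close>

lemma walk_length: "walk E l p \<Longrightarrow> length p = Suc l"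
  by (simp add: walk_def)

lemma walk_take: "walk E l p \<Longrightarrow> j \<le> l \<Longrightarrow> walk E j (take (Suc j) p)"
  by (auto simp: walk_def)

lemma walk_drop: "walk E l p \<Longrightarrow> j \<le> l \<Longrightarrow> walk E (l - j) (drop j p)"
  by (auto simp: walk_def)

lemma walk_append:
  assumes "walk E i p" "walk E j q" "p ! i = q ! 0"
  shows "walk E (i + j) (p @ tl q)" "(p @ tl q) ! 0 = p ! 0" "(p @ tl q) ! (i + j) = q ! j"
proof -
  have len: "length p = Suc i" "length q = Suc j" using assms by (auto simp: walk_def)
  have nth: "(p @ tl q) ! m = (if m \<le> i then p ! m else q ! (m - i))" if "m \<le> i + j" for m
    using that len by (cases "m \<le> i") (auto simp: nth_append nth_tl Suc_diff_Suc)
  show "(p @ tl q) ! 0 = p ! 0" "(p @ tl q) ! (i + j) = q ! j"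
    using nth[of 0] nth[of "i + j"] assms(3) by (auto split: if_splits)
  have "E ((p @ tl q) ! m) ((p @ tl q) ! Suc m)" if "m < i + j" for m
  proof -
    consider "m < i" | "m = i" | "m > i" by linarith
    then show ?thesis
    proof cases
      case 2
      then have "0 < j" using that by simp
      then show ?thesis using 2 nth[of m] nth[of "Suc m"] assms(2,3) that by (auto simp: walk_def)
    next
      case 3
      have "m - i < j" "Suc m - i = Suc (m - i)" using 3 that by auto
      then show ?thesis using 3 nth[of m] nth[of "Suc m"] assms(2) that
        by (auto simp: walk_def)
    qed (use nth[of m] nth[of "Suc m"] assms(1) that in \<open>auto simp: walk_def\<close>)
  qed
  then show "walk E (i + j) (p @ tl q)" using len by (auto simp: walk_def)
qed

lemma path_append:
  assumes "path E i a b p" "path E j b c q" "set p \<inter> set q \<subseteq> {b}"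
  shows "path E (i + j) a c (p @ tl q)"
proof -
  have q: "q = b # tl q" using assms(2) by (cases q) (auto simp: path_def walk_def)
  have "b \<notin> set (tl q)" "distinct (tl q)" using assms(2) q
    by (metis distinct.simps(2) path_def)+
  then have "distinct (p @ tl q)"
    using assms q by (auto simp: path_def dest: list.set_sel(2))
      (metis Int_iff disjoint_iff empty_iff insertE list.set_intros(2) subsetD)
  then show ?thesis using walk_append[of E i p j q] assms by (auto simp: path_def)
qed

lemma path_drop: "path E l x y p \<Longrightarrow> j \<le> l \<Longrightarrow> path E (l - j) (p ! j) y (drop j p)"
  using walk_drop[of E l p j] by (auto simp: path_def walk_def)

lemma path_take: "path E l x y p \<Longrightarrow> j \<le> l \<Longrightarrow> path E j x (p ! j) (take (Suc j) p)"
  using walk_take[of E l p j] by (auto simp: path_def walk_def)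

lemma path_ends: "path E l x y p \<Longrightarrow> x \<in> set p \<and> y \<in> set p"
  by (auto simp: path_def walk_def intro!: nth_mem)

lemma path_length: "path E l x y p \<Longrightarrow> length p = Suc l"
  by (simp add: path_def walk_def)

lemma path_card: "path E l x y p \<Longrightarrow> card (set p) = Suc l"
  by (simp add: path_def walk_def distinct_card)

lemma path_end_neq: "path E l x y p \<Longrightarrow> 0 < l \<Longrightarrow> x \<noteq> y"
  unfolding path_def walk_def by (metis less_Suc_eq_0_disj lessI nat_less_le nth_eq_iff_index_eq)

lemma robust_mono: "robust E M l x y \<Longrightarrow> M' \<le> M \<Longrightarrow> robust E M' l x y"
  unfolding robust_def by (metis le_trans)

lemma fan_mono: "fan E M l x S \<Longrightarrow> M' \<le> M \<Longrightarrow> fan E M' l x S"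
  unfolding fan_def by (metis le_trans)

text \<open>The first path avoids \<open>Z\<close> and also \<open>c\<close>, which costs the extra
  1. The second avoids \<open>Z\<close> and the \<open>i\<close> vertices of the first path other
  than the junction, so the two meet only there.\<close>

lemma robust_fan_trans:
  assumes "fan E (M + 1) i a S" "\<And>b. b \<in> S \<Longrightarrow> b \<noteq> c \<Longrightarrow> robust E (M + i) h b c" "a \<noteq> c"
  shows "robust E M (i + h) a c"
  unfolding robust_def
proof (intro conjI allI impI)
  fix Z assume Z: "finite Z \<and> card Z \<le> M \<and> a \<notin> Z \<and> c \<notin> Z"
  then have "finite (insert c Z) \<and> card (insert c Z) \<le> M + 1 \<and> a \<notin> insert c Z"
    using assms(3) by (auto simp: card_insert_if)
  then obtain p b where p: "b \<in> S" "path E i a b p" "set p \<inter> insert c Z = {}"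
    using assms(1) unfolding fan_def by meson
  have bp: "b \<in> set p" using path_ends[OF p(2)] by simp
  then have bc: "b \<noteq> c" using p(3) by auto
  let ?Z = "Z \<union> (set p - {b})"
  have "card (set p - {b}) = i" using path_card[OF p(2)] bp by simp
  then have "card ?Z \<le> M + i" using Z card_Un_le[of Z "set p - {b}"] by linarith
  moreover have "finite ?Z" "b \<notin> ?Z" "c \<notin> ?Z" using Z p(3) bp by auto
  ultimately obtain q where q: "path E h b c q" "set q \<inter> ?Z = {}"
    using assms(2)[OF p(1) bc] unfolding robust_def by meson
  then have "set p \<inter> set q \<subseteq> {b}" by auto
  from path_append[OF p(2) q(1) this]
  have "path E (i + h) a c (p @ tl q)" .
  moreover have "set (p @ tl q) \<inter> Z = {}"
    using p(3) q(2) by (auto dest: list.set_sel(2)) (metis Int_Un_distrib disjoint_iff list.set_sel(2) list.sel(2) Un_empty)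
  ultimately show "\<exists>p. path E (i + h) a c p \<and> set p \<inter> Z = {}" by blast
qed fact

lemma robust_imp_fan:
  assumes "\<And>b. b \<in> S \<Longrightarrow> a \<noteq> b \<Longrightarrow> robust E M h a b" "M + 1 < card S"
  shows "fan E M h a S"
  unfolding fan_def
proof (intro allI impI)
  fix Z assume Z: "finite Z \<and> card Z \<le> M \<and> a \<notin> Z"
  then have "card (insert a Z) < card S" using assms(2) by (auto simp: card_insert_if)
  then have "\<not> S \<subseteq> insert a Z" using Z by (metis card_mono finite_insert not_le)
  then obtain b where "b \<in> S" "b \<noteq> a" "b \<notin> Z" by auto
  then show "\<exists>p. \<exists>b\<in>S. path E h a b p \<and> set p \<inter> Z = {}"
    using assms(1)[of b] Z unfolding robust_def by metis
qed

text \<open>Equal elements are exempt because the two sets may overlap; later \<open>X\<close> is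
  linked to itself.\<close>

definition linked :: "('a \<Rightarrow> 'a \<Rightarrow> bool) \<Rightarrow> nat \<Rightarrow> nat \<Rightarrow> 'a set \<Rightarrow> 'a set \<Rightarrow> bool" where
  "linked E M h A B \<longleftrightarrow> (\<forall>a\<in>A. \<forall>b\<in>B. a \<noteq> b \<longrightarrow> robust E M h a b)"

lemma linked_mono: "linked E M h A B \<Longrightarrow> M' \<le> M \<Longrightarrow> linked E M' h A B"
  by (meson linked_def robust_mono)

lemma linked_fan_trans:
  assumes "\<And>a. a \<in> A \<Longrightarrow> fan E (M + 1) i a S" "linked E (M + i) h S B"
  shows "linked E M (i + h) A B"
  unfolding linked_def using robust_fan_trans[OF assms(1)] assms(2)
  by (metis linked_def)

lemma linked_trans:
  assumes "linked E (M + 1) i A S" "linked E (M + i) h S B" "M + 2 < card S"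
  shows "linked E M (i + h) A B"
proof (rule linked_fan_trans[OF _ assms(2)])
  fix a assume "a \<in> A"
  then show "fan E (M + 1) i a S"
    using assms(1,3) by (intro robust_imp_fan) (auto simp: linked_def)
qed

section \<open>Walks in nearly regular graphs\<close>

lemma walk_rev:
  assumes "symp E" "walk E l p"
  shows "walk E l (rev p)"
  unfolding walk_def
proof (intro conjI allI impI)
  fix i assume i: "i < l"
  have "E (p ! (l - Suc i)) (p ! Suc (l - Suc i))"
    using assms(2) i unfolding walk_def by (metis diff_less zero_less_Suc less_trans not_less_eq not_less0 neq0_conv)
  then show "E (rev p ! i) (rev p ! Suc i)"
    using i walk_length[OF assms(2)] sympD[OF assms(1)] by (simp add: rev_nth Suc_diff_Suc)
qed (use assms(2) in \<open>simp add: walk_def\<close>)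

lemma path_rev: "symp E \<Longrightarrow> path E l x y p \<Longrightarrow> path E l y x (rev p)"
  using walk_rev[of E l p] by (auto simp: path_def walk_def rev_nth)

lemma robust_sym: "symp E \<Longrightarrow> robust E M l x y \<Longrightarrow> robust E M l y x"
  unfolding robust_def by (metis path_rev set_rev)

lemma linked_sym: "symp E \<Longrightarrow> linked E M h A B \<Longrightarrow> linked E M h B A"
  unfolding linked_def by (metis robust_sym)

locale near_regular =
  fixes V :: "'a set" and E :: "'a \<Rightarrow> 'a \<Rightarrow> bool" and d K :: real
  assumes finite_V: "finite V"
    and sym_E: "symp E"
    and irrefl_E: "\<not> E x x"
    and E_in_V: "E x y \<Longrightarrow> x \<in> V"
    and d_ge_1: "1 \<le> d" and K_ge_1: "1 \<le> K"
    and deg_ge: "x \<in> V \<Longrightarrow> d \<le> card {y. E x y}"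
    and deg_le: "card {y. E x y} \<le> K * d"
begin

lemma E_sym: "E x y \<Longrightarrow> E y x"
  using sym_E by (auto dest: sympD)

lemma E_in_V': "E x y \<Longrightarrow> y \<in> V"
  using E_in_V E_sym by blast

lemma nb_subset: "{y. E x y} \<subseteq> V"
  using E_in_V' by auto

lemma finite_nb [simp]: "finite {y. E x y}"
  using nb_subset finite_V finite_subset by blast

lemma Kd_ge_1: "1 \<le> K * d"
  using d_ge_1 K_ge_1 mult_mono[of 1 K 1 d] by simp

lemma walk_set: "walk E l p \<Longrightarrow> p ! 0 \<in> V \<Longrightarrow> set p \<subseteq> V"
proof
  fix y assume w: "walk E l p" "p ! 0 \<in> V" "y \<in> set p"
  then obtain i where i: "i < length p" "y = p ! i" by (auto simp: in_set_conv_nth)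
  show "y \<in> V"
  proof (cases i)
    case (Suc j)
    then show ?thesis using w i E_in_V' by (auto simp: walk_def)
  qed (use w i in auto)
qed

lemma walks_subset: "walks E l x \<subseteq> {p. set p \<subseteq> insert x V \<and> length p = Suc l}"
proof
  fix p assume p: "p \<in> walks E l x"
  have "y \<in> insert x V" if y: "y \<in> set p" for y
  proof -
    obtain i where i: "i < length p" "y = p ! i" using y by (auto simp: in_set_conv_nth)
    show ?thesis
    proof (cases i)
      case (Suc j)
      then show ?thesis using p i E_in_V' by (auto simp: walk_def walks_def)
    qed (use p i in \<open>auto simp: walks_def\<close>)
  qed
  then show "p \<in> {p. set p \<subseteq> insert x V \<and> length p = Suc l}"
    using p by (auto simp: walks_def walk_def)
qed

lemma finite_walks [simp]: "finite (walks E l x)"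
  by (rule finite_subset[OF walks_subset finite_lists_length_eq]) (simp add: finite_V)

lemma walks_0: "walks E 0 x = {[x]}"
  by (auto simp: walks_def walk_def length_Suc_conv)

lemma walks_Suc: "walks E (Suc l) x = (\<Union>y\<in>{y. E x y}. (#) x ` walks E l y)"
proof (intro set_eqI iffI)
  fix p assume p: "p \<in> walks E (Suc l) x"
  then have "p = x # tl p" "tl p \<in> walks E l (p ! 1)" "E x (p ! 1)"
    by (cases p; force simp: walks_def walk_def nth_tl)+
  then show "p \<in> (\<Union>y\<in>{y. E x y}. (#) x ` walks E l y)" by blast
next
  fix p assume "p \<in> (\<Union>y\<in>{y. E x y}. (#) x ` walks E l y)"
  then obtain y q where "E x y" "q \<in> walks E l y" "p = x # q" by auto
  then show "p \<in> walks E (Suc l) x"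
    by (auto simp: walks_def walk_def nth_Cons split: nat.splits)
qed

lemma card_walks_Suc: "card (walks E (Suc l) x) = (\<Sum>y\<in>{y. E x y}. card (walks E l y))"
proof -
  have "card (walks E (Suc l) x) = (\<Sum>y\<in>{y. E x y}. card ((#) x ` walks E l y))"
    unfolding walks_Suc using finite_walks by (intro card_UN_disjoint) (auto simp: walks_def)
  then show ?thesis by (simp add: card_image)
qed

lemma card_walks_le: "card (walks E l x) \<le> (K * d) ^ l"
proof (induction l arbitrary: x)
  case (Suc l)
  have "real (card (walks E (Suc l) x)) \<le> (\<Sum>y\<in>{y. E x y}. (K * d) ^ l)"
    unfolding card_walks_Suc of_nat_sum by (intro sum_mono Suc)
  also have "\<dots> \<le> (K * d) * (K * d) ^ l"
    using deg_le Kd_ge_1 by (simp add: mult_right_mono)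
  finally show ?case by simp
qed (simp add: walks_0)

lemma card_walks_ge: "x \<in> V \<Longrightarrow> d ^ l \<le> card (walks E l x)"
proof (induction l arbitrary: x)
  case (Suc l)
  have "d * d ^ l \<le> (\<Sum>y\<in>{y. E x y}. d ^ l)"
    using deg_ge[OF Suc.prems] d_ge_1 by (simp add: mult_right_mono)
  also have "\<dots> \<le> real (card (walks E (Suc l) x))"
    unfolding card_walks_Suc of_nat_sum using E_in_V' by (intro sum_mono Suc) auto
  finally show ?case by simp
qed (simp add: walks_0)

text \<open>A position determined by the earlier ones is one free choice less, hence one factor
  \<open>K * d\<close> less. A constant \<open>g\<close> covers walks through a given vertex, and
  \<open>g\<close> reading an earlier entry covers walks that repeat a vertex.\<close>

lemma card_walks_forced:
  assumes "1 \<le> j" "j \<le> l"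
  shows "card {p \<in> walks E l x. p ! j = g (take j p)} \<le> (K * d) ^ (l - 1)"
proof -
  let ?A = "{p \<in> walks E l x. p ! j = g (take j p)}"
  let ?B = "Sigma (walks E (j - 1) x) (\<lambda>q. walks E (l - j) (g q))"
  have "inj_on (\<lambda>p. (take j p, drop j p)) ?A"
    by (rule inj_onI) (metis append_take_drop_id prod.inject)
  moreover have "(\<lambda>p. (take j p, drop j p)) ` ?A \<subseteq> ?B"
    using assms walk_take[of E l _ "j - 1"] walk_drop[of E l _ j]
    by (auto simp: walks_def walk_def)
  moreover have "finite ?B" by auto
  ultimately have "card ?A \<le> card ?B" by (rule card_inj_on_le)
  also have "real (card ?B) = (\<Sum>q\<in>walks E (j - 1) x. real (card (walks E (l - j) (g q))))"
    by (subst card_SigmaI) auto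
  also have "\<dots> \<le> (\<Sum>q\<in>walks E (j - 1) x. (K * d) ^ (l - j))"
    by (intro sum_mono card_walks_le)
  also have "\<dots> \<le> (K * d) ^ (j - 1) * (K * d) ^ (l - j)"
    using card_walks_le Kd_ge_1 by (simp add: mult_right_mono)
  also have "\<dots> = (K * d) ^ (l - 1)"
    using assms by (simp flip: power_add)
  finally show ?thesis by simp
qed

lemma card_walks_hit:
  assumes "finite Z"
  shows "card {p \<in> walks E l x. \<exists>j. 1 \<le> j \<and> j \<le> l \<and> p ! j \<in> Z} \<le> card Z * l * (K * d) ^ (l - 1)"
proof -
  let ?A = "\<lambda>(z, j). {p \<in> walks E l x. p ! j = z}"
  have "{p \<in> walks E l x. \<exists>j. 1 \<le> j \<and> j \<le> l \<and> p ! j \<in> Z} \<subseteq> \<Union> (?A ` (Z \<times> {1..l}))"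
    by fastforce
  then have "card {p \<in> walks E l x. \<exists>j. 1 \<le> j \<and> j \<le> l \<and> p ! j \<in> Z} \<le> card (\<Union> (?A ` (Z \<times> {1..l})))"
    by (rule card_mono[rotated]) (use assms in auto)
  also have "\<dots> \<le> (\<Sum>zj\<in>Z \<times> {1..l}. card (?A zj))"
    by (rule card_UN_le) (use assms in auto)
  also have "real \<dots> \<le> (\<Sum>zj\<in>Z \<times> {1..l}. (K * d) ^ (l - 1))"
    unfolding of_nat_sum using card_walks_forced[where g = "\<lambda>_. _"] by (intro sum_mono) auto
  also have "\<dots> = card Z * l * (K * d) ^ (l - 1)" by (simp add: card_cartesian_product)
  finally show ?thesis by simp
qed

lemma card_walks_not_distinct:
  "card {p \<in> walks E l x. \<not> distinct p} \<le> l * l * (K * d) ^ (l - 1)"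
proof -
  let ?A = "\<lambda>(i, j). {p \<in> walks E l x. i < j \<and> p ! j = take j p ! i}"
  have "{p \<in> walks E l x. \<not> distinct p} \<subseteq> \<Union> (?A ` ({..<l} \<times> {1..l}))"
  proof
    fix p assume p: "p \<in> {p \<in> walks E l x. \<not> distinct p}"
    then obtain i j where "i < length p" "j < length p" "i \<noteq> j" "p ! i = p ! j"
      by (auto simp: distinct_conv_nth)
    then obtain i j where "i < j" "j < length p" "p ! i = p ! j"
      by (metis linorder_neqE_nat)
    then have "(i, j) \<in> {..<l} \<times> {1..l}" "p \<in> ?A (i, j)"
      using p by (auto simp: walks_def walk_def)
    then show "p \<in> \<Union> (?A ` ({..<l} \<times> {1..l}))" by blast
  qed
  then have "card {p \<in> walks E l x. \<not> distinct p} \<le> card (\<Union> (?A ` ({..<l} \<times> {1..l})))"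
    by (rule card_mono[rotated]) auto
  also have "\<dots> \<le> (\<Sum>ij\<in>{..<l} \<times> {1..l}. card (?A ij))"
    by (rule card_UN_le) auto
  also have "real \<dots> \<le> (\<Sum>ij\<in>{..<l} \<times> {1..l}. (K * d) ^ (l - 1))"
    unfolding of_nat_sum
  proof (intro sum_mono)
    fix ij :: "nat \<times> nat" assume "ij \<in> {..<l} \<times> {1..l}"
    then obtain i j where ij: "ij = (i, j)" "1 \<le> j" "j \<le> l" by auto
    have "card (?A ij) \<le> card {p \<in> walks E l x. p ! j = take j p ! i}"
      unfolding ij by (rule card_mono) auto
    then show "real (card (?A ij)) \<le> (K * d) ^ (l - 1)"
      using card_walks_forced[OF ij(2,3), of x "\<lambda>q. q ! i"] by linarith
  qed
  also have "\<dots> = l * l * (K * d) ^ (l - 1)" by (simp add: card_cartesian_product)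
  finally show ?thesis by simp
qed

text \<open>Walks that repeat a vertex or hit a forbidden set are fewer by a factor of order
  \<open>d\<close>, so a larger family of walks into \<open>S\<close> contains a path that avoids
  the set.\<close>

lemma fan_if_many_walks:
  assumes "real (m * m + T * m) * (K * d) ^ (m - 1) < card {r \<in> walks E m u. r ! m \<in> S}"
  shows "fan E T m u S"
  unfolding fan_def
proof (intro allI impI)
  fix Z assume Z: "finite Z \<and> card Z \<le> T \<and> u \<notin> Z"
  let ?H = "{p \<in> walks E m u. \<exists>j. 1 \<le> j \<and> j \<le> m \<and> p ! j \<in> Z}"
  let ?D = "{p \<in> walks E m u. \<not> distinct p}"
  let ?S = "{r \<in> walks E m u. r ! m \<in> S}"
  have "real (card ?H) \<le> card Z * m * (K * d) ^ (m - 1)" using card_walks_hit Z by blast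
  also have "\<dots> \<le> T * m * (K * d) ^ (m - 1)"
    using Z Kd_ge_1 by (intro mult_right_mono) (auto intro!: mult_right_mono)
  finally have "real (card (?H \<union> ?D)) \<le> T * m * (K * d) ^ (m - 1) + m * m * (K * d) ^ (m - 1)"
    using card_walks_not_distinct[of m u] of_nat_mono[OF card_Un_le[of ?H ?D], where 'a = real] by simp
  then have "card (?H \<union> ?D) < card ?S"
    using assms by (simp add: algebra_simps)
  moreover have "finite (?H \<union> ?D)" by simp
  ultimately have "\<not> ?S \<subseteq> ?H \<union> ?D" by (meson card_mono not_le)
  then obtain r where r: "r \<in> ?S" "r \<notin> ?H" "r \<notin> ?D" by blast
  have "set r \<inter> Z = {}"
  proof (rule ccontr)
    assume "set r \<inter> Z \<noteq> {}"
    then obtain j where j: "j < length r" "r ! j \<in> Z" by (auto simp: in_set_conv_nth)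
    then show False using r Z by (cases "j = 0") (auto simp: walks_def walk_def)
  qed
  then show "\<exists>p. \<exists>b\<in>S. path E m u b p \<and> set p \<inter> Z = {}"
    using r by (auto simp: path_def walks_def)
qed

section \<open>Walks with robust subwalks, and clean paths\<close>

definition all_walks :: "nat \<Rightarrow> 'a list set" where
  "all_walks l = (\<Union>x\<in>V. walks E l x)"

lemma finite_all_walks [simp]: "finite (all_walks l)"
  by (simp add: all_walks_def finite_V)

lemma all_walksI: "walk E l p \<Longrightarrow> p ! 0 \<in> V \<Longrightarrow> p \<in> all_walks l"
  by (auto simp: all_walks_def walks_def)

text \<open>A walk is recovered from its middle part and its extensions at both ends; the left
  extension is read backwards so that it too starts at an end of the middle part.\<close>

lemma card_subwalks_le:
  assumes "i + l \<le> k"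
  shows "card {p \<in> all_walks k. R (p ! i) (p ! (i + l))}
     \<le> card {q \<in> all_walks l. R (q ! 0) (q ! l)} * (K * d) ^ (k - l)"
proof -
  let ?A = "{p \<in> all_walks k. R (p ! i) (p ! (i + l))}"
  let ?Q = "{q \<in> all_walks l. R (q ! 0) (q ! l)}"
  let ?B = "Sigma ?Q (\<lambda>q. walks E i (q ! 0) \<times> walks E (k - (i + l)) (q ! l))"
  let ?f = "\<lambda>p. (take (Suc l) (drop i p), rev (take (Suc i) p), drop (i + l) p)"
  have "inj_on ?f ?A"
  proof (rule inj_onI)
    fix p p' assume p: "p \<in> ?A" "p' \<in> ?A" "?f p = ?f p'"
    have len: "length p = Suc k" "length p' = Suc k"
      using p(1,2) by (auto simp: all_walks_def walks_def walk_def)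
    show "p = p'"
    proof (rule nth_equalityI)
      fix m assume m: "m < length p"
      consider "m \<le> i" | "i \<le> m" "m \<le> i + l" | "i + l \<le> m" by linarith
      then show "p ! m = p' ! m"
      proof cases
        case 1
        have "take (Suc i) p = take (Suc i) p'" using p(3) by simp
        then show ?thesis using 1 by (metis le_imp_less_Suc nth_take)
      next
        case 2
        then have *: "m - i < Suc l" "i + (m - i) = m" by auto
        have "take (Suc l) (drop i p) ! (m - i) = take (Suc l) (drop i p') ! (m - i)" using p(3) by simp
        then show ?thesis using * m len assms by (simp add: nth_drop)
      next
        case 3
        have "drop (i + l) p ! (m - (i + l)) = drop (i + l) p' ! (m - (i + l))" using p(3) by simp
        then show ?thesis using 3 m len assms by (simp add: nth_drop)
      qed
    qed (use len in simp)
  qed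
  moreover have "?f ` ?A \<subseteq> ?B"
  proof
    fix t assume "t \<in> ?f ` ?A"
    then obtain p where p: "p \<in> all_walks k" "R (p ! i) (p ! (i + l))" "t = ?f p" by auto
    have w: "walk E k p" "p ! 0 \<in> V" using p(1) by (auto simp: all_walks_def walks_def)
    have len: "length p = Suc k" using walk_length[OF w(1)] .
    have "p ! i \<in> V" using walk_set[OF w] len assms by (auto simp: subset_iff)
    moreover have "walk E l (take (Suc l) (drop i p))"
      using walk_take[OF walk_drop[OF w(1), of i], of l] assms by simp
    ultimately have "take (Suc l) (drop i p) \<in> ?Q"
      using len assms p(2) by (auto intro!: all_walksI)
    moreover have "rev (take (Suc i) p) \<in> walks E i (p ! i)"
      using walk_rev[OF sym_E walk_take[OF w(1), of i]] len assms by (auto simp: walks_def rev_nth)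
    moreover have "drop (i + l) p \<in> walks E (k - (i + l)) (p ! (i + l))"
      using walk_drop[OF w(1), of "i + l"] len assms by (auto simp: walks_def)
    ultimately show "t \<in> ?B" using p(3) len assms by auto
  qed
  moreover have "finite ?B" by auto
  ultimately have "card ?A \<le> card ?B" by (rule card_inj_on_le)
  also have "real (card ?B) = (\<Sum>q\<in>?Q. real (card (walks E i (q ! 0))) * real (card (walks E (k - (i + l)) (q ! l))))"
    by (subst card_SigmaI) (auto simp: card_cartesian_product)
  also have "\<dots> \<le> (\<Sum>q\<in>?Q. (K * d) ^ i * (K * d) ^ (k - (i + l)))"
    using Kd_ge_1 by (intro sum_mono mult_mono card_walks_le) auto
  also have "\<dots> = card ?Q * (K * d) ^ (k - l)"
    using assms by (simp flip: power_add)
  finally show ?thesis by simp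
qed

text \<open>Only subpaths of length at least 2 are tested, as edges are always robust. The condition
  is inherited by subpaths, which is what an induction on the length needs.\<close>

definition clean_paths :: "nat \<Rightarrow> nat \<Rightarrow> 'a \<Rightarrow> 'a \<Rightarrow> 'a list set" where
  "clean_paths M l x y = {p. path E l x y p \<and> (\<forall>i j. i + 2 \<le> j \<and> j \<le> l \<longrightarrow> \<not> robust E M (j - i) (p ! i) (p ! j))}"

lemma finite_clean_paths [simp]: "finite (clean_paths M l x y)"
  by (rule finite_subset[OF _ finite_walks[of l x]]) (auto simp: clean_paths_def path_def walks_def)

lemma clean_pathsD:
  "p \<in> clean_paths M l x y \<Longrightarrow> i + 2 \<le> j \<Longrightarrow> j \<le> l \<Longrightarrow> \<not> robust E M (j - i) (p ! i) (p ! j)"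
  by (simp add: clean_paths_def)

lemma clean_paths_path: "p \<in> clean_paths M l x y \<Longrightarrow> path E l x y p"
  by (simp add: clean_paths_def)

lemma clean_paths_take:
  "p \<in> clean_paths M l x y \<Longrightarrow> j \<le> l \<Longrightarrow> take (Suc j) p \<in> clean_paths M j x (p ! j)"
  using path_take[of E l x y p j] by (auto simp: clean_paths_def)

lemma clean_paths_drop:
  assumes "p \<in> clean_paths M l x y" "j \<le> l"
  shows "drop j p \<in> clean_paths M (l - j) (p ! j) y"
proof -
  have p: "path E l x y p" using assms(1) by (simp add: clean_paths_def)
  have "\<not> robust E M (b - a) (drop j p ! a) (drop j p ! b)" if ab: "a + 2 \<le> b" "b \<le> l - j" for a b
  proof -
    have "(j + a) + 2 \<le> j + b" "j + b \<le> l" using ab assms(2) by auto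
    then have "\<not> robust E M ((j + b) - (j + a)) (p ! (j + a)) (p ! (j + b))"
      using assms(1) unfolding clean_paths_def by blast
    then show ?thesis using path_length[OF p] ab assms(2) by simp
  qed
  then show ?thesis using path_drop[OF p assms(2)] by (auto simp: clean_paths_def)
qed

text \<open>Non-robustness of the endpoints provides a small set that meets all the paths between them,
  and cutting the paths there reduces the claim to shorter paths.\<close>

lemma card_clean_paths_le:
  assumes "1 \<le> l" "l \<le> k" "Q = M * k + 1"
  shows "card (clean_paths M l x y) \<le> Q ^ (2 * l - 1)"
  using assms(1,2)
proof (induction l arbitrary: x y rule: less_induct)
  case (less l)
  consider "clean_paths M l x y = {}" | "l = 1" | "l \<ge> 2" "clean_paths M l x y \<noteq> {}"
    using less.prems by linarith
  then show ?case
  proof cases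
    case 2
    have "clean_paths M l x y \<subseteq> {[x, y]}"
      unfolding 2 by (auto simp: clean_paths_def path_def walk_def length_Suc_conv)
    then have "card (clean_paths M l x y) \<le> card {[x, y]}" by (rule card_mono[rotated]) auto
    also have "\<dots> \<le> Q ^ (2 * l - 1)" using assms(3) by simp
    finally show ?thesis .
  next
    case 3
    then obtain p where p: "p \<in> clean_paths M l x y" by auto
    then have "x \<noteq> y" using path_end_neq[of E l x y p] 3 by (auto simp: clean_paths_def)
    moreover have "\<not> robust E M l x y"
      using clean_pathsD[OF p, of 0 l] 3(1) clean_paths_path[OF p] by (simp add: path_def)
    ultimately obtain Z where Z: "finite Z" "card Z \<le> M" "x \<notin> Z" "y \<notin> Z"
      "\<And>p. path E l x y p \<Longrightarrow> set p \<inter> Z \<noteq> {}" unfolding robust_def by blast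
    let ?A = "\<lambda>(w, j). {p \<in> clean_paths M l x y. p ! j = w}"
    have "clean_paths M l x y \<subseteq> \<Union> (?A ` (Z \<times> {1..<l}))"
    proof
      fix p assume p: "p \<in> clean_paths M l x y"
      then have pp: "path E l x y p" by (simp add: clean_paths_def)
      obtain j where j: "j < length p" "p ! j \<in> Z" using Z(5)[OF pp] by (auto simp: in_set_conv_nth)
      have "j \<noteq> 0" "j \<noteq> l" using j Z(3,4) pp by (auto simp: path_def intro: Nat.gr0I)
      then have "(p ! j, j) \<in> Z \<times> {1..<l}" "p \<in> ?A (p ! j, j)"
        using p j path_length[OF pp] by auto
      then show "p \<in> \<Union> (?A ` (Z \<times> {1..<l}))" by blast
    qed
    then have "card (clean_paths M l x y) \<le> card (\<Union> (?A ` (Z \<times> {1..<l})))"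
      by (rule card_mono[rotated]) (use Z(1) in auto)
    also have "\<dots> \<le> (\<Sum>wj\<in>Z \<times> {1..<l}. card (?A wj))"
      by (rule card_UN_le) (use Z in auto)
    also have "\<dots> \<le> (\<Sum>wj\<in>Z \<times> {1..<l}. Q ^ (2 * l - 2))"
    proof (intro sum_mono)
      fix wj assume "wj \<in> Z \<times> {1..<l}"
      then obtain w j where wj: "wj = (w, j)" "1 \<le> j" "j < l" by auto
      let ?B = "clean_paths M j x w \<times> clean_paths M (l - j) w y"
      let ?g = "\<lambda>p. (take (Suc j) p, drop j p)"
      have "inj_on ?g (?A wj)"
      proof (rule inj_onI)
        fix p p' assume "?g p = ?g p'"
        then have "take j p = take j p'" "drop j p = drop j p'"
          by (auto dest: arg_cong[where f = "take j"])
        then show "p = p'" by (metis append_take_drop_id)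
      qed
      moreover have "?g ` ?A wj \<subseteq> ?B"
        using clean_paths_take[of _ M l x y j] clean_paths_drop[of _ M l x y j] wj by force
      moreover have "finite ?B" by simp
      ultimately have "card (?A wj) \<le> card ?B" by (rule card_inj_on_le)
      also have "\<dots> \<le> Q ^ (2 * j - 1) * Q ^ (2 * (l - j) - 1)"
        unfolding card_cartesian_product using wj less.prems by (intro mult_mono less.IH) auto
      also have "\<dots> = Q ^ (2 * l - 2)"
        using wj by (simp flip: power_add) (intro arg_cong[where f = "(^) Q"], linarith)
      finally show "card (?A wj) \<le> Q ^ (2 * l - 2)" .
    qed
    \<comment> \<open>The two pieces of a cut path account for \<open>2 * l - 2\<close> factors
      \<open>Q\<close>; the choice of the cut vertex and of its position, at most
      \<open>M * k\<close> ways, is the remaining one.\<close>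
    also have "\<dots> \<le> Q * Q ^ (2 * l - 2)"
    proof -
      have "card Z * (l - 1) \<le> M * k" using Z(2) less.prems by (intro mult_mono) auto
      then have "card (Z \<times> {1..<l}) \<le> Q" using assms(3) by (simp add: card_cartesian_product)
      then show ?thesis by (simp add: mult_right_mono)
    qed
    also have "\<dots> = Q ^ (2 * l - 1)"
      using 3(1) by (simp add: Suc_diff_Suc numeral_2_eq_2 flip: power_Suc)
    finally show ?thesis .
  qed simp
qed

end

section \<open>Greedy embeddings and spiders\<close>

text \<open>Copies of the subdivided graph are described by branch vertices \<open>a\<close>,
  \<open>b\<close> and vertex lists \<open>P\<close>, which keeps the combinatorics free of the
  vertex type of \<open>subdivision\<close> until the end.\<close>

definition contains_subdivided :: "('a \<Rightarrow> 'a \<Rightarrow> bool) \<Rightarrow> nat \<Rightarrow> nat \<Rightarrow> nat \<Rightarrow> bool" where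
  "contains_subdivided E s t k \<longleftrightarrow>
     (\<exists>a b P. inj_on a {..<s} \<and> inj_on b {..<t} \<and> a ` {..<s} \<inter> b ` {..<t} = {} \<and>
       (\<forall>i<s. \<forall>j<t. path E k (a i) (b j) (P i j) \<and>
          set (P i j) \<inter> (a ` {..<s} \<union> b ` {..<t}) = {a i, b j}) \<and>
       (\<forall>i<s. \<forall>j<t. \<forall>i'<s. \<forall>j'<t. (i, j) \<noteq> (i', j') \<longrightarrow>
          set (P i j) \<inter> set (P i' j') \<subseteq> a ` {..<s} \<union> b ` {..<t}))"

text \<open>The paths are embedded one at a time: the other branch vertices and all earlier paths
  together have at most \<open>s + t + s * t * (k + 1)\<close> vertices, which robustness lets the
  next path avoid.\<close>

lemma contains_subdivided_if_linked:
  assumes "linked E M k A B" "finite A" "finite B" "s \<le> card A" "s + t \<le> card B"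
    and M: "s + t + s * t * (k + 1) \<le> M"
  shows "contains_subdivided E s t k"
proof -
  obtain A0 where A0: "A0 \<subseteq> A" "card A0 = s" using assms(4) by (meson obtain_subset_with_card_n)
  have fin: "finite A0" using A0 assms(2) finite_subset by blast
  \<comment> \<open>Since \<open>A\<close> and \<open>B\<close> may overlap, \<open>s\<close> spare
    elements of \<open>B\<close> pay for the removal of \<open>A0\<close>.\<close>
  have "t \<le> card (B - A0)"
    using diff_card_le_card_Diff[OF fin, of B] A0 assms(5) by linarith
  then obtain B0 where B0: "B0 \<subseteq> B - A0" "card B0 = t" by (meson obtain_subset_with_card_n)
  have finB: "finite B0" using B0 assms(3) finite_subset by blast
  obtain a where a: "bij_betw a {0..<s} A0" using ex_bij_betw_nat_finite[OF fin] A0(2) by auto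
  obtain b where b: "bij_betw b {0..<t} B0" using ex_bij_betw_nat_finite[OF finB] B0(2) by auto
  let ?U = "A0 \<union> B0"
  have cU: "card ?U \<le> s + t" using card_Un_le[of A0 B0] A0 B0 by simp
  have aA: "a i \<in> A0" if "i < s" for i using a that by (auto simp: bij_betw_def)
  have bB: "b i \<in> B0" if "i < t" for i using b that by (auto simp: bij_betw_def)
  have "\<exists>P. (\<forall>(i,j)\<in>I. path E k (a i) (b j) (P (i,j)) \<and> set (P (i,j)) \<inter> ?U = {a i, b j}) \<and>
      (\<forall>q\<in>I. \<forall>q'\<in>I. q \<noteq> q' \<longrightarrow> set (P q) \<inter> set (P q') \<subseteq> ?U)"
    if "finite I" "I \<subseteq> {..<s} \<times> {..<t}" for I
    using that
  proof (induction I rule: finite_induct)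
    case (insert q I)
    obtain i j where q: "q = (i, j)" "i < s" "j < t" using insert.prems by auto
    obtain P where P: "\<forall>(i,j)\<in>I. path E k (a i) (b j) (P (i,j)) \<and> set (P (i,j)) \<inter> ?U = {a i, b j}"
      "\<forall>q\<in>I. \<forall>q'\<in>I. q \<noteq> q' \<longrightarrow> set (P q) \<inter> set (P q') \<subseteq> ?U"
      using insert by auto
    let ?Z = "(?U - {a i, b j}) \<union> ((\<Union>q\<in>I. set (P q)) - ?U)"
    have "card (\<Union>q\<in>I. set (P q)) \<le> (\<Sum>q\<in>I. card (set (P q)))"
      by (rule card_UN_le) (rule insert)
    also have "\<dots> \<le> (\<Sum>q\<in>I. k + 1)"
      by (rule sum_mono) (use P(1) path_card in fastforce)
    also have "\<dots> \<le> s * t * (k + 1)"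
    proof -
      have "card I \<le> card ({..<s} \<times> {..<t})" using insert.prems by (intro card_mono) auto
      then show ?thesis by (simp add: card_cartesian_product mult_right_mono del: mult_Suc_right)
    qed
    finally have 1: "card (\<Union>q\<in>I. set (P q)) \<le> s * t * (k + 1)" .
    have "card ((\<Union>q\<in>I. set (P q)) - ?U) \<le> card (\<Union>q\<in>I. set (P q))"
      by (rule card_mono) (use insert in auto)
    moreover have "card (?U - {a i, b j}) \<le> card ?U"
      by (rule card_mono) (use fin finB in auto)
    ultimately have "card ?Z \<le> M"
      using 1 cU M card_Un_le[of "?U - {a i, b j}" "(\<Union>q\<in>I. set (P q)) - ?U"] by linarith
    moreover have "finite ?Z" "a i \<notin> ?Z" "b j \<notin> ?Z"
      using fin finB insert.hyps aA[OF q(2)] bB[OF q(3)] by auto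
    moreover have "robust E M k (a i) (b j)"
      using assms(1) A0(1) B0(1) aA[OF q(2)] bB[OF q(3)] unfolding linked_def
      by (metis DiffD1 DiffD2 subsetD)
    ultimately obtain p where p: "path E k (a i) (b j) p" "set p \<inter> ?Z = {}"
      unfolding robust_def by meson
    have "set p \<inter> ?U = {a i, b j}"
      using p(2) path_ends[OF p(1)] aA[OF q(2)] bB[OF q(3)] by blast
    then have "\<forall>(i,j)\<in>insert q I. path E k (a i) (b j) ((P(q := p)) (i,j)) \<and>
        set ((P(q := p)) (i,j)) \<inter> ?U = {a i, b j}"
      using P(1) p(1) q(1) by (auto simp del: Un_iff)
    moreover have disj: "set p \<inter> set (P q') \<subseteq> ?U" if "q' \<in> I" for q'
      using p(2) that by blast
    have "set ((P(q := p)) q1) \<inter> set ((P(q := p)) q2) \<subseteq> ?U"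
      if "q1 \<in> insert q I" "q2 \<in> insert q I" "q1 \<noteq> q2" for q1 q2
      using that P(2) disj[of q1] disj[of q2] by (cases "q1 = q"; cases "q2 = q") auto
    ultimately show ?case by blast
  qed simp
  from this[of "{..<s} \<times> {..<t}"] obtain P where P:
    "\<forall>(i,j)\<in>{..<s} \<times> {..<t}. path E k (a i) (b j) (P (i,j)) \<and> set (P (i,j)) \<inter> ?U = {a i, b j}"
    "\<forall>q\<in>{..<s} \<times> {..<t}. \<forall>q'\<in>{..<s} \<times> {..<t}. q \<noteq> q' \<longrightarrow> set (P q) \<inter> set (P q') \<subseteq> ?U"
    by auto
  have img: "a ` {..<s} = A0" "b ` {..<t} = B0" "inj_on a {..<s}" "inj_on b {..<t}"
    using a b by (auto simp: bij_betw_def atLeast0LessThan)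
  show ?thesis
    unfolding contains_subdivided_def
    by (rule exI[of _ a], rule exI[of _ b], rule exI[of _ "\<lambda>i j. P (i, j)"])
      (use img P B0 in auto)
qed

section \<open>Counting spiders and choosing their centres\<close>

lemma card_list_choices_le:
  assumes "\<And>y. finite (F y)" "\<And>y. card (F y) \<le> A"
  shows "finite {ps. list_all2 (\<lambda>p y. p \<in> F y) ps ys} \<and>
    card {ps. list_all2 (\<lambda>p y. p \<in> F y) ps ys} \<le> A ^ length ys"
proof (induction ys)
  case (Cons y ys)
  let ?S = "{ps. list_all2 (\<lambda>p y. p \<in> F y) ps ys}"
  have eq: "{ps. list_all2 (\<lambda>p y. p \<in> F y) ps (y # ys)} = (\<lambda>(p, ps). p # ps) ` (F y \<times> ?S)"
    by (auto simp: list_all2_Cons2)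
  have "card ((\<lambda>(p, ps). p # ps) ` (F y \<times> ?S)) \<le> card (F y \<times> ?S)"
    by (rule card_image_le) (use Cons assms in auto)
  also have "\<dots> \<le> A * A ^ length ys"
    unfolding card_cartesian_product using Cons assms by (intro mult_mono) auto
  finally show ?case unfolding eq using Cons assms by auto
qed simp

context near_regular
begin

lemma card_ball_le:
  "card {x. \<exists>j<k. \<exists>q\<in>walks E j w. q ! j = x} \<le> k * (K * d) ^ (k - 1)"
proof -
  have "{x. \<exists>j<k. \<exists>q\<in>walks E j w. q ! j = x} = (\<Union>j\<in>{..<k}. (\<lambda>q. q ! j) ` walks E j w)"
    by auto
  then have "card {x. \<exists>j<k. \<exists>q\<in>walks E j w. q ! j = x} \<le> (\<Sum>j\<in>{..<k}. card ((\<lambda>q. q ! j) ` walks E j w))"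
    using card_UN_le[of "{..<k}" "\<lambda>j. (\<lambda>q. q ! j) ` walks E j w"] by simp
  also have "\<dots> \<le> (\<Sum>j\<in>{..<k}. card (walks E j w))"
    by (intro sum_mono card_image_le) simp
  also have "real \<dots> \<le> (\<Sum>j\<in>{..<k}. (K * d) ^ (k - 1))"
    unfolding of_nat_sum
  proof (intro sum_mono)
    fix j assume "j \<in> {..<k}"
    then have "(K * d) ^ j \<le> (K * d) ^ (k - 1)" using Kd_ge_1 by (intro power_increasing) auto
    then show "real (card (walks E j w)) \<le> (K * d) ^ (k - 1)" using card_walks_le[of j w] by linarith
  qed
  finally show ?thesis by simp
qed

definition clean_from :: "nat \<Rightarrow> nat \<Rightarrow> 'a \<Rightarrow> 'a list set" where
  "clean_from M k x = {p \<in> walks E k x. p \<in> clean_paths M k x (p ! k)}"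

lemma finite_clean_from [simp]: "finite (clean_from M k x)"
  by (simp add: clean_from_def)

text \<open>For this symmetric relation \<open>sorted_wrt\<close> means pairwise. Lists order the
  legs, so the leaves form an \<open>s\<close>-tuple, and a leg is added by a single cons.\<close>

definition spiders :: "nat \<Rightarrow> nat \<Rightarrow> nat \<Rightarrow> 'a \<Rightarrow> 'a list list set" where
  "spiders M k r x = {ps. length ps = r \<and> set ps \<subseteq> clean_from M k x \<and>
     sorted_wrt (\<lambda>p q. set p \<inter> set q = {x}) ps}"

lemma finite_spiders [simp]: "finite (spiders M k r x)"
  by (rule finite_subset[OF _ finite_lists_length_eq[of "clean_from M k x" r]])
    (auto simp: spiders_def)

text \<open>A new leg has to avoid at most \<open>s * k\<close> vertices of the earlier legs. This
  excludes only of order \<open>d ^ (k - 1)\<close> walks, hence at most half of the clean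
  ones.\<close>

lemma card_spiders_ge:
  fixes s :: nat
  assumes "d ^ k / 4 \<le> card (clean_from M k x)" "s * k * k * (K * d) ^ (k - 1) \<le> d ^ k / 8"
  shows "r \<le> s \<Longrightarrow> (d ^ k / 8) ^ r \<le> card (spiders M k r x)"
proof (induction r)
  case 0
  have "spiders M k 0 x = {[]}" by (auto simp: spiders_def)
  then show ?case by simp
next
  case (Suc r)
  let ?C = "\<lambda>ps. {p \<in> clean_from M k x. \<forall>q\<in>set ps. set p \<inter> set q = {x}}"
  let ?S = "Sigma (spiders M k r x) ?C"
  have C: "d ^ k / 8 \<le> card (?C ps)" if ps: "ps \<in> spiders M k r x" for ps
  proof -
    have x_in: "x \<in> set p" "card (set p) = Suc k" if "p \<in> clean_from M k x" for p
      using that path_ends path_card by (fastforce simp: clean_from_def clean_paths_def)+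
    let ?Z = "(\<Union>q\<in>set ps. set q - {x})"
    have "card ?Z \<le> (\<Sum>q\<in>set ps. card (set q - {x}))" by (rule card_UN_le) simp
    also have "\<dots> = (\<Sum>q\<in>set ps. k)"
      by (rule sum.cong) (use ps x_in in \<open>auto simp: spiders_def\<close>)
    also have "\<dots> \<le> s * k"
      using card_length[of ps] ps Suc.prems by (auto simp: spiders_def intro: mult_right_mono)
    finally have Z: "card ?Z \<le> s * k" .
    let ?H = "{p \<in> walks E k x. \<exists>j. 1 \<le> j \<and> j \<le> k \<and> p ! j \<in> ?Z}"
    have "clean_from M k x \<subseteq> ?C ps \<union> ?H"
    proof
      fix p assume p: "p \<in> clean_from M k x"
      show "p \<in> ?C ps \<union> ?H"
      proof (cases "p \<in> ?C ps")
        case False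
        then obtain q where q: "q \<in> set ps" "set p \<inter> set q \<noteq> {x}" using p by auto
        then have "x \<in> set p \<inter> set q" using x_in p ps by (auto simp: spiders_def)
        then obtain y where y: "y \<in> set p" "y \<in> ?Z" using q by blast
        then obtain j where j: "j < length p" "p ! j = y" by (auto simp: in_set_conv_nth)
        have "p ! 0 = x" "y \<noteq> x" using y p by (auto simp: clean_from_def walks_def)
        then have "1 \<le> j" "j \<le> k" "p \<in> walks E k x"
          using p j by (cases j; auto simp: clean_from_def walks_def walk_def)+
        then have "p \<in> ?H" using y j by blast
        then show ?thesis by simp
      qed simp
    qed
    then have "card (clean_from M k x) \<le> card (?C ps \<union> ?H)" by (rule card_mono[rotated]) simp
    also have "\<dots> \<le> card (?C ps) + card ?H" by (rule card_Un_le)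
    finally have "real (card (clean_from M k x)) \<le> card (?C ps) + real (card ?H)"
      by (simp flip: of_nat_add)
    moreover have "real (card ?H) \<le> card ?Z * k * (K * d) ^ (k - 1)"
      by (rule card_walks_hit) simp
    moreover have "card ?Z * k * (K * d) ^ (k - 1) \<le> s * k * k * (K * d) ^ (k - 1)"
      using Z Kd_ge_1 by (intro mult_right_mono) (auto simp flip: of_nat_mult)
    ultimately show ?thesis using assms by linarith
  qed
  have "(d ^ k / 8) ^ Suc r \<le> card (spiders M k r x) * (d ^ k / 8)"
    using Suc d_ge_1 by (simp add: mult_right_mono mult.commute)
  also have "\<dots> \<le> (\<Sum>ps\<in>spiders M k r x. real (card (?C ps)))"
    using sum_mono[of "spiders M k r x" "\<lambda>_. d ^ k / 8"] C by simp
  also have "\<dots> = card ?S" by (subst card_SigmaI) auto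
  also have "\<dots> = card ((\<lambda>(ps, p). p # ps) ` ?S)"
    by (subst card_image) (auto simp: inj_on_def)
  also have "\<dots> \<le> card (spiders M k (Suc r) x)"
    by (intro of_nat_mono card_mono finite_spiders) (auto simp: spiders_def)
  finally show ?case .
qed

lemma clean_from_path: "p \<in> clean_from M k x \<Longrightarrow> path E k x (p ! k) p"
  by (simp add: clean_from_def clean_paths_def)

text \<open>A used vertex that is not a leaf can only lie on a new spider strictly before the ends
  of its legs, so it blocks only centres within \<open>k - 1\<close> steps of it. The size of
  \<open>B\<close> exceeds the number of all centres blocked in this way.\<close>

lemma contains_subdivided_if_many_spiders:
  assumes "1 \<le> k" "1 \<le> s" "1 \<le> t" "length ys = s"
    and ps: "\<And>x. x \<in> B \<Longrightarrow> ps x \<in> spiders M k s x \<and> map (\<lambda>p. p ! k) (ps x) = ys"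
    and B: "finite B" "real (t * (s * (k + 1))) * (k * (K * d) ^ (k - 1)) < card B"
  shows "contains_subdivided E s t k"
proof -
  define S where "S x = (\<Union>p\<in>set (ps x). set p)" for x
  have len: "length (ps x) = s" if "x \<in> B" for x using ps[OF that] by (simp add: spiders_def)
  have nth_path: "path E k x (ys ! i) (ps x ! i)" "ps x ! i \<in> set (ps x)" if "x \<in> B" "i < s" for x i
  proof -
    show *: "ps x ! i \<in> set (ps x)" using len that by simp
    have "map (\<lambda>p. p ! k) (ps x) ! i = ys ! i" using ps[OF that(1)] by simp
    moreover have "ps x ! i \<in> clean_from M k x" using * ps[OF that(1)] by (auto simp: spiders_def)
    ultimately show "path E k x (ys ! i) (ps x ! i)" using clean_from_path len that by fastforce
  qed
  have disj: "set (ps x ! i) \<inter> set (ps x ! j) = {x}" if "x \<in> B" "i < s" "j < s" "i \<noteq> j" for x i j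
  proof -
    have sw: "sorted_wrt (\<lambda>p q. set p \<inter> set q = {x}) (ps x)" using ps[OF that(1)] by (simp add: spiders_def)
    have *: "set (ps x ! i) \<inter> set (ps x ! j) = {x}" if "i < j" "j < s" for i j
      using sorted_wrt_nth_less[OF sw that(1)] len[OF \<open>x \<in> B\<close>] that(2) by simp
    show ?thesis using *[of i j] *[of j i] that by (metis Int_commute linorder_neqE_nat)
  qed
  have xy: "x \<noteq> ys ! i" if "x \<in> B" "i < s" for x i
    using path_end_neq[OF nth_path(1)[OF that]] assms(1) by auto
  have x_notin: "x \<notin> set ys" if "x \<in> B" for x
    using xy[OF that] assms(4) by (metis in_set_conv_nth)
  have cS: "finite (S x) \<and> card (S x) \<le> s * (k + 1)" if "x \<in> B" for x
  proof -
    have "card (S x) \<le> (\<Sum>p\<in>set (ps x). card (set p))" unfolding S_def by (rule card_UN_le) simp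
    also have "\<dots> \<le> (\<Sum>p\<in>set (ps x). k + 1)"
    proof (intro sum_mono)
      fix p assume "p \<in> set (ps x)"
      then have "p \<in> clean_from M k x" using ps[OF that] by (auto simp: spiders_def)
      then show "card (set p) \<le> k + 1" using path_card[OF clean_from_path] by fastforce
    qed
    also have "\<dots> \<le> s * (k + 1)"
      using card_length[of "ps x"] len[OF that] by (simp add: mult_right_mono del: mult_Suc_right)
    finally show ?thesis by (simp add: S_def)
  qed
  have "\<exists>T\<subseteq>B. card T = r \<and> (\<forall>x\<in>T. \<forall>x'\<in>T. x \<noteq> x' \<longrightarrow> S x \<inter> S x' \<subseteq> set ys)" if "r \<le> t" for r
    using that
  proof (induction r)
    case (Suc r)
    then obtain T where T: "T \<subseteq> B" "card T = r" "\<forall>x\<in>T. \<forall>x'\<in>T. x \<noteq> x' \<longrightarrow> S x \<inter> S x' \<subseteq> set ys"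
      by auto
    have finT: "finite T" using T(1) B(1) finite_subset by blast
    \<comment> \<open>The leaves are shared by all spiders and are the branch vertices of one side,
      so they may be met again.\<close>
    define W where "W = (\<Union>x\<in>T. S x) - set ys"
    have finW: "finite W" unfolding W_def using finT cS T(1) by auto
    have "card W \<le> card (\<Union>x\<in>T. S x)" unfolding W_def
      by (rule card_mono) (use finT cS T(1) in auto)
    also have "\<dots> \<le> (\<Sum>x\<in>T. card (S x))" by (rule card_UN_le) fact
    also have "\<dots> \<le> (\<Sum>x\<in>T. s * (k + 1))" by (rule sum_mono) (use cS T(1) in auto)
    also have "\<dots> \<le> t * (s * (k + 1))" using T(2) Suc.prems by (simp add: mult_right_mono)
    finally have cW: "card W \<le> t * (s * (k + 1))" .
    let ?N = "\<lambda>w. {x. \<exists>j<k. \<exists>q\<in>walks E j w. q ! j = x}"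
    have finN: "finite (?N w)" for w
    proof -
      have "?N w = (\<Union>j\<in>{..<k}. (\<lambda>q. q ! j) ` walks E j w)" by auto
      then show ?thesis by simp
    qed
    have "card (\<Union>w\<in>W. ?N w) \<le> (\<Sum>w\<in>W. card (?N w))" by (rule card_UN_le) (rule finW)
    also have "real \<dots> \<le> (\<Sum>w\<in>W. k * (K * d) ^ (k - 1))"
      unfolding of_nat_sum by (intro sum_mono card_ball_le)
    also have "\<dots> = card W * (k * (K * d) ^ (k - 1))" by simp
    also have "\<dots> \<le> real (t * (s * (k + 1))) * (k * (K * d) ^ (k - 1))"
      using cW Kd_ge_1 by (intro mult_right_mono of_nat_mono) auto
    finally have "real (card (\<Union>w\<in>W. ?N w)) < card B" using B(2) by linarith
    then have "card (\<Union>w\<in>W. ?N w) < card B" by simp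
    moreover have "finite (\<Union>w\<in>W. ?N w)" using finN finW by auto
    ultimately have "\<not> B \<subseteq> (\<Union>w\<in>W. ?N w)" by (meson card_mono not_le)
    then obtain x where x: "x \<in> B" "x \<notin> (\<Union>w\<in>W. ?N w)" by blast
    have SW: "S x \<inter> W = {}"
    proof (rule ccontr)
      assume "S x \<inter> W \<noteq> {}"
      then obtain p w where p: "p \<in> set (ps x)" "w \<in> set p" "w \<in> W" by (auto simp: S_def)
      have pc: "p \<in> clean_from M k x" using p(1) ps[OF x(1)] by (auto simp: spiders_def)
      have pw: "walk E k p" "p ! 0 = x" using pc by (auto simp: clean_from_def walks_def)
      obtain j where j: "j \<le> k" "p ! j = w" using p(2) walk_length[OF pw(1)]
        by (metis in_set_conv_nth less_Suc_eq_le)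
      have "p ! k \<in> set (map (\<lambda>p. p ! k) (ps x))" using p(1) by simp
      then have "p ! k \<in> set ys" using ps[OF x(1)] by simp
      then have "j < k" using j p(3) by (cases "j = k") (auto simp: W_def)
      moreover have "rev (take (Suc j) p) \<in> walks E j w" "rev (take (Suc j) p) ! j = x"
        using walk_rev[OF sym_E walk_take[OF pw(1) j(1)]] walk_length[OF pw(1)] j pw(2)
        by (auto simp: walks_def rev_nth)
      ultimately show False using x(2) p(3) by blast
    qed
    have "x \<in> S x" unfolding S_def
      using nth_path[OF x(1), of 0] assms(2) path_ends by fastforce
    then have "x \<notin> T" using SW x_notin[OF x(1)] by (auto simp: W_def)
    then have "card (insert x T) = Suc r" using T(2) finT by simp
    moreover have "S x \<inter> S x' \<subseteq> set ys" if "x' \<in> T" for x'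
      using SW that by (auto simp: W_def)
    then have "S x1 \<inter> S x2 \<subseteq> set ys" if "x1 \<in> insert x T" "x2 \<in> insert x T" "x1 \<noteq> x2" for x1 x2
      using T(3) that by (metis Int_commute insertE)
    moreover have "insert x T \<subseteq> B" using T(1) x(1) by simp
    ultimately show ?case by meson
  qed (auto intro!: exI[of _ "{}"])
  from this[of t] obtain T where T: "T \<subseteq> B" "card T = t"
    "\<And>x x'. x \<in> T \<Longrightarrow> x' \<in> T \<Longrightarrow> x \<noteq> x' \<Longrightarrow> S x \<inter> S x' \<subseteq> set ys" by blast
  have "finite T" using T(1) B(1) finite_subset by blast
  then obtain b where b: "bij_betw b {0..<t} T" using ex_bij_betw_nat_finite T(2) by blast
  have bT: "b j \<in> T" "b j \<in> B" if "j < t" for j using b that T(1) by (auto simp: bij_betw_def)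
  have binj: "b j \<noteq> b j'" if "j < t" "j' < t" "j \<noteq> j'" for j j'
    using b that by (auto simp: bij_betw_def inj_on_def)
  have in_S: "set (ps x ! i) \<subseteq> S x" if "x \<in> B" "i < s" for x i
    using nth_path(2)[OF that] by (auto simp: S_def)
  have b0: "b 0 \<in> B" using bT \<open>1 \<le> t\<close> by auto
    \<comment> \<open>Two legs of a spider meet only in its centre, so a leaf lies on no leg but its
      own.\<close>
    have ys_in: "i' = i" if x: "x \<in> B" "i < s" "i' < s" "ys ! i' \<in> set (ps x ! i)" for x i i'
    proof (rule ccontr)
      assume "i' \<noteq> i"
      then have "ys ! i' \<in> {x}"
        using disj[OF x(1,2,3)] x(4) path_ends[OF nth_path(1)[OF x(1,3)]] by blast
      then show False using xy[OF x(1,3)] by simp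
    qed
    have ys_inj: "ys ! i \<noteq> ys ! i'" if "i < s" "i' < s" "i \<noteq> i'" for i i'
      using ys_in[OF b0 that(2,1)] that(3) path_ends[OF nth_path(1)[OF b0 that(2)]] by metis
    have Ys: "(!) ys ` {..<s} = set ys" using assms(4) by (auto simp: set_conv_nth)
    have Bs: "b ` {..<t} = T" using b by (simp add: bij_betw_def atLeast0LessThan)
    have meet: "set (ps (b j) ! i) \<inter> (set ys \<union> T) = {ys ! i, b j}" if ij: "i < s" "j < t" for i j
    proof -
      have "set (ps (b j) ! i) \<inter> set ys \<subseteq> {ys ! i}"
      proof
        fix y assume y: "y \<in> set (ps (b j) ! i) \<inter> set ys"
        then obtain i' where "i' < s" "y = ys ! i'" using assms(4) by (auto simp: in_set_conv_nth)
        then show "y \<in> {ys ! i}" using ys_in[OF bT(2)[OF ij(2)] ij(1)] y by blast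
      qed
      moreover have "x = b j" if x: "x \<in> T" "x \<in> set (ps (b j) ! i)" for x
      proof (rule ccontr)
        assume "x \<noteq> b j"
        have xB: "x \<in> B" using x(1) T(1) by auto
        have "x \<in> S x" using in_S[OF xB, of 0] path_ends[OF nth_path(1)[OF xB, of 0]] assms(2) by auto
        then have "x \<in> set ys"
          using T(3)[OF x(1) bT(1)[OF ij(2)] \<open>x \<noteq> b j\<close>] in_S[OF bT(2)[OF ij(2)] ij(1)] x(2) by blast
        then show False using x_notin[OF xB] by simp
      qed
      moreover have "ys ! i \<in> set ys" using ij assms(4) by simp
      ultimately show ?thesis
        using path_ends[OF nth_path(1)[OF bT(2)[OF ij(2)] ij(1)]] bT(1)[OF ij(2)] by blast
    qed
    have other: "set (ps (b j) ! i) \<inter> set (ps (b j') ! i') \<subseteq> set ys \<union> T"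
      if "i < s" "j < t" "i' < s" "j' < t" "(i, j) \<noteq> (i', j')" for i j i' j'
    proof (cases "j = j'")
      case True
      then have "set (ps (b j) ! i) \<inter> set (ps (b j') ! i') = {b j}"
        using disj[OF bT(2)[OF that(2)] that(1,3)] that(5) by auto
      then show ?thesis using bT(1)[OF that(2)] by auto
    next
      case False
      then show ?thesis
        using T(3)[OF bT(1)[OF that(2)] bT(1)[OF that(4)] binj[OF that(2,4)]]
          in_S[OF bT(2)[OF that(2)] that(1)] in_S[OF bT(2)[OF that(4)] that(3)] by blast
    qed
    show ?thesis
      unfolding contains_subdivided_def
    proof (intro exI conjI)
      show "inj_on ((!) ys) {..<s}" using ys_inj by (auto simp: inj_on_def)
      show "inj_on b {..<t}" using binj by (auto simp: inj_on_def)
      show "(!) ys ` {..<s} \<inter> b ` {..<t} = {}" unfolding Ys Bs using x_notin T(1) by blast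
      show "\<forall>i<s. \<forall>j<t. path E k (ys ! i) (b j) (rev (ps (b j) ! i)) \<and>
          set (rev (ps (b j) ! i)) \<inter> ((!) ys ` {..<s} \<union> b ` {..<t}) = {ys ! i, b j}"
        unfolding Ys Bs using meet path_rev[OF sym_E nth_path(1)] bT by simp
      show "\<forall>i<s. \<forall>j<t. \<forall>i'<s. \<forall>j'<t. (i, j) \<noteq> (i', j') \<longrightarrow>
          set (rev (ps (b j) ! i)) \<inter> set (rev (ps (b j') ! i')) \<subseteq> (!) ys ` {..<s} \<union> b ` {..<t}"
        unfolding Ys Bs using other by simp
    qed
qed

text \<open>\<open>A\<close> bounds the clean paths between two vertices and
  \<open>U * d ^ (k - 1)\<close> the centres that the greedy choice can lose. The other factors in
  \<open>dn\<close> are 8 per leg for choosing the legs disjoint, \<open>4 * K ^ k\<close> for the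
  share of good centres, and \<open>4 * A\<close> from the bound on \<open>d ^ k\<close> in terms of
  the number of vertices.\<close>

lemma contains_subdivided_if_few_robust:
  assumes "1 \<le> k" "1 \<le> s" "1 \<le> t" "V \<noteq> {}"
    and few: "\<And>l. 2 \<le> l \<Longrightarrow> l \<le> k \<Longrightarrow>
      card {q \<in> all_walks l. robust E M l (q ! 0) (q ! l)} \<le> card V * d ^ l / (4 * real ((k + 1) * (k + 1)) * K ^ k)"
    and d: "8 * (s + 1) * k * k * K ^ k \<le> d"
    and A: "A = real ((M * k + 1) ^ (2 * k - 1))"
    and U_def: "U = real (t * (s * (k + 1))) * (k * K ^ (k - 1))"
    and dn: "4 * A * (U * (8 * A) ^ s * (4 * K ^ k)) * real (card V) ^ s < d ^ (s * k + 1)"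
  shows "contains_subdivided E s t k"
proof -
  let ?n = "real (card V)"
  define c where "c = real ((k + 1) * (k + 1))"
  have c: "0 < c" unfolding c_def of_nat_0_less_iff by simp
  have A1: "1 \<le> A" unfolding A by simp
  have n: "0 < ?n" using assms(4) finite_V by (simp add: card_gt_0_iff)
  have Kk: "1 \<le> K ^ k" using K_ge_1 by simp
  have Kdk: "(s + 1) * k * k * (K * d) ^ (k - 1) \<le> d ^ k / 8"
  proof -
    have "(s + 1) * k * k * (K * d) ^ (k - 1) \<le> (s + 1) * k * k * (K ^ k * d ^ (k - 1))"
      unfolding power_mult_distrib using K_ge_1 d_ge_1
      by (intro mult_left_mono mult_right_mono power_increasing) auto
    also have "\<dots> = (8 * (s + 1) * k * k * K ^ k) * d ^ (k - 1) / 8" by (simp add: algebra_simps)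
    also have "\<dots> \<le> d * d ^ (k - 1) / 8"
      using d d_ge_1 by (intro divide_right_mono mult_right_mono) (simp_all add: algebra_simps)
    also have "\<dots> = d ^ k / 8" using assms(1) by (simp flip: power_Suc)
    finally show ?thesis .
  qed
  have pos: "0 \<le> k * k * (K * d) ^ (k - 1)" "0 \<le> s * k * k * (K * d) ^ (k - 1)" using Kd_ge_1 by auto
  have Kdk1: "k * k * (K * d) ^ (k - 1) \<le> d ^ k / 8" and Kdks: "s * k * k * (K * d) ^ (k - 1) \<le> d ^ k / 8"
    using Kdk pos by (auto simp: algebra_simps)
  define X where "X = {x \<in> V. d ^ k / 4 \<le> card (clean_from M k x)}"
  have finX: "finite X" unfolding X_def using finite_V by simp
  \<comment> \<open>Per vertex there are at least \<open>d ^ k\<close> walks on average, of which at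
    most \<open>d ^ k / 8\<close> repeat a vertex and at most \<open>d ^ k / 4\<close> contain a
    robust subwalk. So at least \<open>d ^ k / 2\<close> are clean, and centres outside
    \<open>X\<close> supply at most half of that.\<close>
  have cX: "?n / (4 * K ^ k) \<le> card X"
  proof -
    let ?CL = "\<Union>x\<in>V. clean_from M k x" and ?ND = "\<Union>x\<in>V. {p \<in> walks E k x. \<not> distinct p}"
    let ?I = "{(i, l). 2 \<le> l \<and> i + l \<le> k}"
    let ?bad = "\<lambda>(i, l). {p \<in> all_walks k. robust E M l (p ! i) (p ! (i + l))}"
    have I: "?I \<subseteq> {..k} \<times> {..k}" by auto
    then have finI: "finite ?I" using finite_subset by blast
    have cI: "card ?I \<le> c" unfolding c_def using card_mono[OF _ I]
      by (simp add: card_cartesian_product del: mult_Suc mult_Suc_right flip: of_nat_mult of_nat_Suc)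
    have "all_walks k \<subseteq> ?CL \<union> ?ND \<union> \<Union> (?bad ` ?I)"
    proof
      fix p assume p: "p \<in> all_walks k"
      then obtain x where x: "x \<in> V" "p \<in> walks E k x" by (auto simp: all_walks_def)
      show "p \<in> ?CL \<union> ?ND \<union> \<Union> (?bad ` ?I)"
      proof (cases "\<exists>i j. i + 2 \<le> j \<and> j \<le> k \<and> robust E M (j - i) (p ! i) (p ! j)")
        case True
        then obtain i j where ij: "i + 2 \<le> j" "j \<le> k" "robust E M (j - i) (p ! i) (p ! j)" by blast
        then have "(i, j - i) \<in> ?I" "p \<in> ?bad (i, j - i)" using p by auto
        then show ?thesis by blast
      next
        case False
        then show ?thesis using x by (auto simp: clean_from_def clean_paths_def path_def walks_def)
      qed
    qed
    then have "card (all_walks k) \<le> card (?CL \<union> ?ND \<union> \<Union> (?bad ` ?I))"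
      by (rule card_mono[rotated]) (use finite_V finI in auto)
    also have "\<dots> \<le> card ?CL + card ?ND + card (\<Union> (?bad ` ?I))"
      using card_Un_le[of "?CL \<union> ?ND" "\<Union> (?bad ` ?I)"] card_Un_le[of ?CL ?ND] by linarith
    finally have "real (card (all_walks k)) \<le> card ?CL + real (card ?ND) + card (\<Union> (?bad ` ?I))"
      by (simp flip: of_nat_add)
    moreover have "?n * d ^ k \<le> card (all_walks k)"
    proof -
      have "card (all_walks k) = (\<Sum>x\<in>V. card (walks E k x))"
        unfolding all_walks_def by (intro card_UN_disjoint ballI finite_V finite_walks) (auto simp: walks_def)
      moreover have "(\<Sum>x\<in>V. d ^ k) \<le> (\<Sum>x\<in>V. real (card (walks E k x)))"
        by (intro sum_mono card_walks_ge)
      ultimately show ?thesis by simp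
    qed
    moreover have "card ?ND \<le> ?n * (d ^ k / 8)"
    proof -
      have "card ?ND \<le> (\<Sum>x\<in>V. card {p \<in> walks E k x. \<not> distinct p})"
        by (rule card_UN_le) (rule finite_V)
      also have "real \<dots> \<le> (\<Sum>x\<in>V. d ^ k / 8)"
        unfolding of_nat_sum
      proof (intro sum_mono)
        fix x
        show "real (card {p \<in> walks E k x. \<not> distinct p}) \<le> d ^ k / 8"
          using card_walks_not_distinct[of k x] Kdk1 by simp
      qed
      finally show ?thesis by simp
    qed
    moreover have "card (\<Union> (?bad ` ?I)) \<le> ?n * (d ^ k / 4)"
    proof -
      have "card (\<Union> (?bad ` ?I)) \<le> (\<Sum>il\<in>?I. card (?bad il))"
        by (rule card_UN_le) (rule finI)
      also have "real \<dots> \<le> (\<Sum>il\<in>?I. ?n * d ^ k / (4 * c))"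
        unfolding of_nat_sum
      proof (intro sum_mono)
        fix il assume "il \<in> ?I"
        then obtain i l where il: "il = (i, l)" "2 \<le> l" "i + l \<le> k" by auto
        have "real (card (?bad il)) \<le> card {q \<in> all_walks l. robust E M l (q ! 0) (q ! l)} * (K * d) ^ (k - l)"
          unfolding il using card_subwalks_le[OF il(3)] by simp
        also have "\<dots> \<le> ?n * d ^ l / (4 * c * K ^ k) * (K * d) ^ (k - l)"
          using few[of l] il Kd_ge_1 unfolding c_def by (intro mult_right_mono) simp_all
        also have "\<dots> \<le> ?n * d ^ l / (4 * c * K ^ k) * (K ^ k * d ^ (k - l))"
          unfolding power_mult_distrib using K_ge_1 d_ge_1 c
          by (intro mult_left_mono mult_right_mono power_increasing) auto
        also have "\<dots> = ?n * (d ^ l * d ^ (k - l)) / (4 * c)"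
          using Kk c K_ge_1 by (simp add: field_simps)
        also have "d ^ l * d ^ (k - l) = d ^ k" using il by (simp flip: power_add)
        finally show "real (card (?bad il)) \<le> ?n * d ^ k / (4 * c)" .
      qed
      also have "\<dots> = card ?I * (?n * d ^ k / (4 * c))" by simp
      also have "\<dots> \<le> c * (?n * d ^ k / (4 * c))"
        using cI n d_ge_1 c by (intro mult_right_mono) auto
      also have "\<dots> = ?n * (d ^ k / 4)" using c by (simp add: field_simps)
      finally show ?thesis by simp
    qed
    ultimately have "?n * d ^ k / 2 \<le> card ?CL" by (simp add: field_simps)
    also have "card ?CL \<le> (\<Sum>x\<in>V. card (clean_from M k x))"
      by (rule card_UN_le) (rule finite_V)
    also have "real \<dots> \<le> (\<Sum>x\<in>V. (if x \<in> X then (K * d) ^ k else 0) + d ^ k / 4)"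
      unfolding of_nat_sum
    proof (intro sum_mono)
      fix x assume "x \<in> V"
      have "card (clean_from M k x) \<le> card (walks E k x)"
        by (rule card_mono) (auto simp: clean_from_def)
      then have "real (card (clean_from M k x)) \<le> (K * d) ^ k" using card_walks_le[of k x] by linarith
      then show "real (card (clean_from M k x)) \<le> (if x \<in> X then (K * d) ^ k else 0) + d ^ k / 4"
        using \<open>x \<in> V\<close> d_ge_1 by (auto simp: X_def intro: add_increasing2)
    qed
    also have "\<dots> = card X * (K * d) ^ k + ?n * (d ^ k / 4)"
    proof -
      have "(\<Sum>x\<in>V. if x \<in> X then (K * d) ^ k else 0) = (\<Sum>x\<in>X. (K * d) ^ k)"
        by (rule sum.mono_neutral_cong_right) (auto simp: finite_V X_def)
      then show ?thesis by (simp add: sum.distrib)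
    qed
    finally have "?n * d ^ k / 4 \<le> card X * K ^ k * d ^ k"
      by (simp add: power_mult_distrib mult.assoc)
    then have "?n / 4 * d ^ k \<le> card X * K ^ k * d ^ k" by simp
    moreover have "0 < d ^ k" using d_ge_1 by simp
    ultimately have "?n / 4 \<le> card X * K ^ k" by (metis mult_le_cancel_right_pos)
    then show ?thesis using Kk by (simp add: field_simps)
  qed
  define D where "D = Sigma X (spiders M k s)"
  define g where "g = (\<lambda>(x :: 'a, ps). map (\<lambda>p :: 'a list. p ! k) ps)"
  define Y where "Y = {ys. set ys \<subseteq> V \<and> length ys = s}"
  have finD: "finite D" unfolding D_def using finX by auto
  have finY: "finite Y" unfolding Y_def by (rule finite_lists_length_eq) (rule finite_V)
  have cY: "card Y = card V ^ s" unfolding Y_def by (rule card_lists_length_eq) (rule finite_V)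
  have gY: "g z \<in> Y" if z: "z \<in> D" for z
  proof -
    obtain x ps where xps: "z = (x, ps)" "x \<in> V" "ps \<in> spiders M k s x"
      using z by (auto simp: D_def X_def)
    have "p ! k \<in> V" if "p \<in> set ps" for p
    proof -
      have "walk E k p" "p ! 0 \<in> V" using that xps by (auto simp: spiders_def clean_from_def walks_def)
      then show ?thesis using walk_set walk_length by (metis lessI nth_mem subsetD)
    qed
    then show ?thesis using xps by (auto simp: Y_def g_def spiders_def)
  qed
  have cD: "?n / (4 * K ^ k) * (d ^ k / 8) ^ s \<le> card D"
  proof -
    have "?n / (4 * K ^ k) * (d ^ k / 8) ^ s \<le> card X * (d ^ k / 8) ^ s"
      using cX d_ge_1 by (intro mult_right_mono) auto
    also have "\<dots> = (\<Sum>x\<in>X. (d ^ k / 8) ^ s)" by simp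
    also have "\<dots> \<le> (\<Sum>x\<in>X. real (card (spiders M k s x)))"
      using card_spiders_ge Kdks by (intro sum_mono) (auto simp: X_def)
    also have "\<dots> = card D" unfolding D_def using finX by (subst card_SigmaI) auto
    finally show ?thesis .
  qed
  have "V \<noteq> {}" by fact
  then obtain v where "v \<in> V" by blast
  then have "replicate s v \<in> Y" by (auto simp: Y_def)
  then obtain ys where ys: "ys \<in> Y" "card D \<le> card (g -` {ys} \<inter> D) * card Y"
    using pigeonhole_card[of g D Y] finD finY gY by blast
  define B where "B = {x \<in> X. \<exists>ps\<in>spiders M k s x. map (\<lambda>p. p ! k) ps = ys}"
  define ps where "ps x = (SOME ps. ps \<in> spiders M k s x \<and> map (\<lambda>p. p ! k) ps = ys)" for x
  have ps: "ps x \<in> spiders M k s x \<and> map (\<lambda>p. p ! k) (ps x) = ys" if "x \<in> B" for x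
    unfolding ps_def by (rule someI_ex) (use that in \<open>auto simp: B_def\<close>)
  have finB: "finite B" unfolding B_def using finX by simp
  \<comment> \<open>Once the centre and the leaves are fixed, each leg is one of at most
    \<open>A\<close> clean paths.\<close>
  have fib: "real (card (g -` {ys} \<inter> D)) \<le> card B * A ^ s"
  proof -
    let ?L = "\<lambda>x. {ps. list_all2 (\<lambda>p y. p \<in> clean_paths M k x y) ps ys}"
    have cl: "card (clean_paths M k x y) \<le> (M * k + 1) ^ (2 * k - 1)" for x y
      by (rule card_clean_paths_le[where k = k]) (use assms(1) in auto)
    have L: "finite (?L x) \<and> card (?L x) \<le> ((M * k + 1) ^ (2 * k - 1)) ^ length ys" for x
      by (rule card_list_choices_le) (use cl in auto)
    have "g -` {ys} \<inter> D \<subseteq> Sigma B ?L"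
    proof
      fix z assume "z \<in> g -` {ys} \<inter> D"
      then obtain x qs where z: "z = (x, qs)" "x \<in> X" "qs \<in> spiders M k s x" "map (\<lambda>p. p ! k) qs = ys"
        by (auto simp: D_def g_def)
      have "qs \<in> ?L x"
        using z(3,4) by (auto simp: list_all2_conv_all_nth spiders_def clean_from_def subset_iff)
      then show "z \<in> Sigma B ?L" using z by (auto simp: B_def)
    qed
    then have "card (g -` {ys} \<inter> D) \<le> card (Sigma B ?L)"
      by (rule card_mono[rotated]) (use finB L in auto)
    also have "\<dots> = (\<Sum>x\<in>B. card (?L x))" by (rule card_SigmaI) (use finB L in auto)
    also have "\<dots> \<le> (\<Sum>x\<in>B. ((M * k + 1) ^ (2 * k - 1)) ^ length ys)"
      using L by (intro sum_mono) auto
    also have "\<dots> = card B * ((M * k + 1) ^ (2 * k - 1)) ^ s"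
      using ys(1) by (simp add: Y_def)
    finally show ?thesis unfolding A by (simp flip: of_nat_mult of_nat_power)
  qed
  have U0: "0 \<le> U" unfolding U_def using K_ge_1 by simp
  show ?thesis
  proof (rule contains_subdivided_if_many_spiders[OF assms(1-3) _ ps finB])
    show "length ys = s" using ys(1) by (simp add: Y_def)
    show "real (t * (s * (k + 1))) * (real k * (K * d) ^ (k - 1)) < real (card B)"
    proof (rule ccontr)
      assume "\<not> ?thesis"
      then have cB: "card B \<le> U * d ^ (k - 1)" by (simp add: U_def power_mult_distrib mult.assoc)
      have "X \<noteq> {}" using cX n Kk by (auto simp: divide_le_0_iff)
      then obtain x where x: "x \<in> X" by blast
      have "card (clean_from M k x) \<le> card (\<Union>y\<in>V. clean_paths M k x y)"
      proof (rule card_mono)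
        show "clean_from M k x \<subseteq> (\<Union>y\<in>V. clean_paths M k x y)"
        proof
          fix p assume p: "p \<in> clean_from M k x"
          then have "walk E k p" "p ! 0 \<in> V" using x by (auto simp: X_def clean_from_def walks_def)
          then have "p ! k \<in> V" using walk_set walk_length by (metis lessI nth_mem subsetD)
          then show "p \<in> (\<Union>y\<in>V. clean_paths M k x y)" using p by (auto simp: clean_from_def)
        qed
      qed (use finite_V in auto)
      also have "\<dots> \<le> (\<Sum>y\<in>V. card (clean_paths M k x y))" by (rule card_UN_le) (rule finite_V)
      also have "\<dots> \<le> (\<Sum>y\<in>V. (M * k + 1) ^ (2 * k - 1))"
        by (intro sum_mono card_clean_paths_le[where k = k]) (use assms(1) in auto)
      finally have "card (clean_from M k x) \<le> card V * (M * k + 1) ^ (2 * k - 1)" by simp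
      then have "real (card (clean_from M k x)) \<le> ?n * A"
        unfolding A by (metis of_nat_le_iff of_nat_mult)
      \<comment> \<open>A good centre sends at least \<open>d ^ k / 4\<close> clean walks into
        \<open>V\<close>, with at most \<open>A\<close> to each end.\<close>
      then have dkn: "d ^ k \<le> 4 * A * ?n" using x by (simp add: X_def algebra_simps)
      have "?n / (4 * K ^ k) * (d ^ k / 8) ^ s \<le> card B * A ^ s * ?n ^ s"
      proof -
        have "real (card D) \<le> real (card (g -` {ys} \<inter> D)) * real (card Y)"
          using ys(2) by (simp flip: of_nat_mult)
        also have "\<dots> \<le> card B * A ^ s * ?n ^ s"
          using fib cY by (simp add: mult_right_mono)
        finally show ?thesis using cD by linarith
      qed
      also have "\<dots> \<le> U * d ^ (k - 1) * A ^ s * ?n ^ s"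
        using cB A1 by (intro mult_right_mono) auto
      finally have le: "?n / (4 * K ^ k) * (d ^ k / 8) ^ s \<le> U * d ^ (k - 1) * A ^ s * ?n ^ s" .
      have "?n / (4 * K ^ k) * (d ^ k / 8) ^ s = ?n * d ^ (s * k) / (4 * K ^ k * 8 ^ s)"
        by (simp add: power_divide mult.commute[of s k] flip: power_mult)
      with le have "?n * d ^ (s * k) / (4 * K ^ k * 8 ^ s) \<le> U * d ^ (k - 1) * A ^ s * ?n ^ s"
        by metis
      then have "?n * d ^ (s * k) \<le> U * d ^ (k - 1) * A ^ s * ?n ^ s * (4 * K ^ k * 8 ^ s)"
        using Kk by (subst (asm) pos_divide_le_eq) auto
      also have "\<dots> = U * (8 * A) ^ s * (4 * K ^ k) * ?n ^ s * d ^ (k - 1)"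
        by (simp add: power_mult_distrib)
      finally have "?n * d ^ (s * k) \<le> U * (8 * A) ^ s * (4 * K ^ k) * ?n ^ s * d ^ (k - 1)" .
      \<comment> \<open>The extra factor \<open>d\<close> completes \<open>d ^ (k - 1)\<close> to
        \<open>d ^ k\<close>, to which the previous bound applies; this is the source of the
        exponent \<open>s * k + 1\<close>.\<close>
      then have "?n * d ^ (s * k) * d \<le> U * (8 * A) ^ s * (4 * K ^ k) * ?n ^ s * d ^ (k - 1) * d"
        using d_ge_1 by (intro mult_right_mono) auto
      also have "\<dots> = U * (8 * A) ^ s * (4 * K ^ k) * ?n ^ s * d ^ k"
        using assms(1) by (simp add: mult.assoc flip: power_Suc2)
      also have "\<dots> \<le> U * (8 * A) ^ s * (4 * K ^ k) * ?n ^ s * (4 * A * ?n)"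
        using dkn U0 A1 Kk by (intro mult_left_mono) auto
      finally have "?n * d ^ (s * k + 1) \<le> ?n * (4 * A * (U * (8 * A) ^ s * (4 * K ^ k)) * ?n ^ s)"
        by (simp add: algebra_simps)
      then have "d ^ (s * k + 1) \<le> 4 * A * (U * (8 * A) ^ s * (4 * K ^ k)) * ?n ^ s"
        using n by (metis mult_le_cancel_left_pos)
      then show False using dn by simp
    qed
  qed
qed

end

section \<open>Many robust pairs\<close>

text \<open>Lengths that are \<open>0\<close> or \<open>l, \<dots>, 2 l - 2\<close> modulo \<open>2 l\<close> are realized from \<open>X\<close>. The residue
  \<open>2 l - 1\<close> needs the fans; the residues below \<open>l\<close> are sums of two of these lengths, except that
  \<open>l = 2\<close>, \<open>k = 1\<close> modulo \<open>4\<close> again needs the fans.\<close>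

lemma contains_subdivided_if_structure:
  assumes l: "2 \<le> l" "l \<le> k"
    and M: "M = s + t + s * t * (k + 1)" and M': "M' = M + (k + 3) * (k + 1)"
    and N: "M' + 3 \<le> N" "s + t \<le> N"
    and E: "symp E"
    and X: "finite X" "N \<le> card X"
    and Y: "\<And>h. l \<le> h \<Longrightarrow> h \<le> 2 * l - 2 \<Longrightarrow> \<exists>Y. finite Y \<and> N \<le> card Y \<and> linked E M' h X Y"
    and W: "1 \<le> i" "i \<le> l - 1" "finite W" "s \<le> card W" "\<And>w. w \<in> W \<Longrightarrow> fan E M' i w X"
  shows "contains_subdivided E s t k"
proof -
  \<comment> \<open>\<open>j\<close> counts spare units of \<open>k + 1\<close> in the robustness; a
    concatenation spends one unit.\<close>
  define P where "P j h \<longleftrightarrow> (\<exists>B. finite B \<and> N \<le> card B \<and> linked E (M + j * (k + 1)) h X B)" for j h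
  have P_mono: "P j h" if "P j' h" "j \<le> j'" for j j' h
  proof -
    have "M + j * (k + 1) \<le> M + j' * (k + 1)" using that(2) by (intro add_left_mono mult_right_mono) auto
    then show ?thesis using that(1) linked_mono unfolding P_def by blast
  qed
  have base: "P (k + 3) h" if "l \<le> h" "h \<le> 2 * l - 2" for h
    using Y[OF that] unfolding P_def M' by blast
  \<comment> \<open>Going to the set for the length \<open>l\<close> and back returns to
    \<open>X\<close>, so \<open>2 * l\<close> can be added to any length already available.\<close>
  have XX: "linked E (M + (k + 2) * (k + 1)) (2 * l) X X" if "2 * l \<le> k"
  proof -
    have e: "M + (k + 3) * (k + 1) = M + (k + 2) * (k + 1) + (k + 1)" by (simp add: algebra_simps)
 have ll: "l \<le> l" "l \<le> 2 * l - 2" using l by auto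
    obtain B where B: "N \<le> card B" "linked E M' l X B" using Y[OF ll] by blast
    have "linked E (M + (k + 2) * (k + 1)) (l + l) X X"
    proof (rule linked_trans)
      show "linked E (M + (k + 2) * (k + 1) + 1) l X B"
        by (rule linked_mono[OF B(2)]) (unfold M' e, linarith)
      show "linked E (M + (k + 2) * (k + 1) + l) l B X"
        by (rule linked_sym[OF E linked_mono[OF B(2)]]) (unfold M' e, use l in linarith)
      show "M + (k + 2) * (k + 1) + 2 < card B" using B(1) N(1) unfolding M' e by linarith
    qed
    then show ?thesis by (simp add: mult_2)
  qed
  have step: "P j (h + 2 * l)" if hyp: "P (Suc j) h" "Suc j \<le> k + 2" "h + 2 * l \<le> k" for j h
  proof -
    obtain B where B: "finite B" "N \<le> card B" "linked E (M + Suc j * (k + 1)) h X B"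
      using hyp(1) unfolding P_def by blast
    have le: "M + Suc j * (k + 1) \<le> M + (k + 2) * (k + 1)"
      using hyp(2) by (intro add_left_mono mult_right_mono) auto
    have "linked E (M + j * (k + 1)) (2 * l + h) X B"
    proof (rule linked_trans)
      show "linked E (M + j * (k + 1) + 1) (2 * l) X X"
        by (rule linked_mono[OF XX]) (use hyp le in simp_all)
      show "linked E (M + j * (k + 1) + 2 * l) h X B"
        by (rule linked_mono[OF B(3)]) (use hyp in auto)
      show "M + j * (k + 1) + 2 < card X"
        using X(2) N(1) le by (simp add: M' add_mult_distrib)
    qed
    then show ?thesis using B unfolding P_def by (auto simp: add.commute)
  qed
  \<comment> \<open>The budget in this claim falls by \<open>2 * l\<close> with every step, which
    covers the one unit spent; at least three units are left whenever
    \<open>h \<le> k\<close>.\<close>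
  have reach: "P (k + 3 - h) h"
    if "l \<le> h" "h \<le> k" "l \<le> h mod (2 * l) \<and> h mod (2 * l) \<le> 2 * l - 2 \<or> h mod (2 * l) = 0" for h
    using that
  proof (induction h rule: less_induct)
    case (less h)
    consider "h < 2 * l" | "h = 2 * l" | "2 * l < h" by linarith
    then show ?case
    proof cases
      case 1
      then have "P (k + 3) h" using less.prems l by (intro base) auto
      then show ?thesis by (rule P_mono) simp
    next
      case 2
      then have "P (k + 2) h" using XX X N(2) less.prems unfolding P_def by auto
      then show ?thesis by (rule P_mono) (use 2 l in simp)
    next
      case 3
      have md: "(h - 2 * l) mod (2 * l) = h mod (2 * l)" using 3 by (simp add: le_mod_geq)
      \<comment> \<open>Otherwise \<open>h - 2 * l\<close> would itself be the residue, positive and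
        below \<open>l\<close>, which is excluded.\<close>
      have "l \<le> h - 2 * l"
      proof (rule ccontr)
        assume small: "\<not> l \<le> h - 2 * l"
        then have "(h - 2 * l) mod (2 * l) = h - 2 * l" by simp
        then show False using md less.prems(3) 3 small by linarith
      qed
      then have "P (k + 3 - (h - 2 * l)) (h - 2 * l)"
        using less.IH[of "h - 2 * l"] less.prems md l 3 by auto
      then have "P (Suc (k + 3 - h)) (h - 2 * l)"
        by (rule P_mono) (use 3 l less.prems in auto)
      from step[OF this] show ?thesis using 3 l less.prems by simp
    qed
  qed
  have reach1: "\<exists>B. finite B \<and> s + t \<le> card B \<and> linked E (M + (k + 1)) h X B"
    if "l \<le> h" "h \<le> k" "l \<le> h mod (2 * l) \<and> h mod (2 * l) \<le> 2 * l - 2 \<or> h mod (2 * l) = 0" for h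
    using P_mono[OF reach[OF that], of 1] that(2) N(2) unfolding P_def by fastforce
  have fin: "contains_subdivided E s t k"
    if "linked E M k A B" "finite A" "finite B" "s \<le> card A" "s + t \<le> card B" for A B
    using contains_subdivided_if_linked[OF that] by (simp add: M)
  have MX: "M + 2 < card X" using N(1) X(2) by (simp add: M')
  have viaX: ?thesis if hyp: "l \<le> k" "l \<le> k mod (2 * l) \<and> k mod (2 * l) \<le> 2 * l - 2 \<or> k mod (2 * l) = 0"
  proof -
    obtain B where B: "finite B" "s + t \<le> card B" "linked E (M + (k + 1)) k X B"
      using reach1[of k] hyp by blast
    then show ?thesis using fin[of X B] X N(2) linked_mono[OF B(3), of M] by simp
  qed
  have viaW: ?thesis if hyp: "l \<le> k - i" "i \<le> k"
    "l \<le> (k - i) mod (2 * l) \<and> (k - i) mod (2 * l) \<le> 2 * l - 2 \<or> (k - i) mod (2 * l) = 0"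
  proof -
    obtain B where B: "finite B" "s + t \<le> card B" "linked E (M + (k + 1)) (k - i) X B"
      using reach1[of "k - i"] hyp by auto
    have "linked E M (i + (k - i)) W B"
    proof (rule linked_fan_trans)
      show "fan E (M + 1) i w X" if "w \<in> W" for w
        by (rule fan_mono[OF W(5)[OF that]]) (simp add: M')
      show "linked E (M + i) (k - i) X B"
        by (rule linked_mono[OF B(3)]) (use hyp in simp)
    qed
    then show ?thesis using fin[of W B] W B hyp by simp
  qed
  have viaY: ?thesis if h: "l \<le> h" "h \<le> 2 * l - 2" "l \<le> k - h" "h \<le> k"
    "l \<le> (k - h) mod (2 * l) \<and> (k - h) mod (2 * l) \<le> 2 * l - 2 \<or> (k - h) mod (2 * l) = 0" for h
  proof -
    obtain B where B: "finite B" "s + t \<le> card B" "linked E (M + (k + 1)) (k - h) X B"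
      using reach1[of "k - h"] h by auto
    obtain Y where Y: "finite Y" "N \<le> card Y" "linked E M' h X Y" using Y[OF h(1,2)] by blast
    have "linked E M (h + (k - h)) Y B"
    proof (rule linked_trans)
      show "linked E (M + 1) h Y X"
        by (rule linked_sym[OF E linked_mono[OF Y(3)]]) (simp add: M')
      show "linked E (M + h) (k - h) X B"
        by (rule linked_mono[OF B(3)]) (use h in simp)
    qed (rule MX)
    then show ?thesis using fin[of Y B] Y B h N(2) by simp
  qed
  define r where "r = k mod (2 * l)"
  define a where "a = k div (2 * l)"
  have k: "k = 2 * l * a + r" "r < 2 * l" using l by (auto simp: a_def r_def)
  have md: "(2 * l * b + c) mod (2 * l) = c" if "c < 2 * l" for b c using that by simp
  have big: "2 * l \<le> k" "a \<noteq> 0" if "r < l"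
  proof -
    show "a \<noteq> 0" using k l that by (cases a) auto
    then show "2 * l \<le> k" using k by (cases a) auto
  qed
  consider "l \<le> r" "r \<le> 2 * l - 2" | "r = 2 * l - 1" | "r + 2 \<le> l" | "r = l - 1" "3 \<le> l" | "r = l - 1" "l = 2"
    using k(2) l by linarith
  then show ?thesis
  proof cases
    case 1
    then show ?thesis using viaX l by (simp add: r_def)
  next
    case 2
    \<comment> \<open>The fan shortens the residue \<open>2 * l - 1\<close> by between 1 and
      \<open>l - 1\<close>, exactly into the admissible range.\<close>
    have "k - i = 2 * l * a + (r - i)" using k(1) 2 W(2) by simp
    then have "(k - i) mod (2 * l) = r - i" using md[of "r - i" a] k(2) by simp
    moreover have "l \<le> k - i" "i \<le> k" using k(1) 2 W(2) l by auto
    moreover have "l \<le> r - i" "r - i \<le> 2 * l - 2" using 2 W(1,2) l by linarith+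
    ultimately show ?thesis using viaW by simp
  next
    case 3
    then obtain b where b: "a = Suc b" using big(2) by (cases a) auto
    \<comment> \<open>One period is opened up and split into \<open>l\<close> and a remainder of
      residue \<open>l + r\<close>, which is at most \<open>2 * l - 2\<close>.\<close>
    have "k - l = 2 * l * b + (l + r)" using k(1) b by simp
    then have "(k - l) mod (2 * l) = l + r" using md[of "l + r" b] 3 by simp
    then show ?thesis using viaY[of l] big(1) 3 l by simp
  next
    case 4
    then obtain b where b: "a = Suc b" using big(2) by (cases a) auto
    \<comment> \<open>Splitting off \<open>l\<close> would leave the bad residue
      \<open>2 * l - 1\<close>. The length \<open>l + 1\<close> leaves \<open>2 * l - 2\<close>
      instead, and it is available because \<open>3 \<le> l\<close>.\<close>
    have "k - (l + 1) = 2 * l * b + (2 * l - 2)" using k(1) b 4 by simp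
    then have "(k - (l + 1)) mod (2 * l) = 2 * l - 2" "2 * l - 2 \<le> k - (l + 1)"
      using md[of "2 * l - 2" b] l by simp_all
    moreover from this have "l + 1 \<le> 2 * l - 2" "l \<le> k - (l + 1)" using 4 by linarith+
    ultimately show ?thesis using viaY[of "l + 1"] big(1) 4 l by simp
  next
    case 5
    \<comment> \<open>For \<open>l = 2\<close> the only prepared length is 2, so parity can be
      corrected only by the fan, whose length is forced to be 1; it leaves a multiple of 4.\<close>
    then have i: "i = 1" using W(1,2) by simp
    have "k - i = 2 * l * a + 0" using k(1) 5 i by simp
    then have "(k - i) mod (2 * l) = 0" using md[of 0 a] l by simp
    then show ?thesis using viaW big(1) 5 i by simp
  qed
qed

text \<open>Each new \<open>y\<close> shrinks the current set by a factor \<open>c\<close>, and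
  taking the earlier choices as \<open>F\<close> keeps them distinct. Treating the indices one after
  another inside the shrinking set produces a single \<open>X\<close> that serves all of
  them.\<close>

lemma common_neighbours:
  fixes rel :: "'i \<Rightarrow> 'a \<Rightarrow> 'b \<Rightarrow> bool" and c :: real
  assumes "0 < c" "finite X0" "X0 \<noteq> {}"
    and step: "\<And>i X F. i \<in> I \<Longrightarrow> X \<subseteq> X0 \<Longrightarrow> X \<noteq> {} \<Longrightarrow> finite F \<Longrightarrow> card F \<le> N \<Longrightarrow> \<exists>y. y \<notin> F \<and> c * card X \<le> card {x \<in> X. rel i x y}"
    and "finite I"
  shows "\<exists>X\<subseteq>X0. c ^ (N * card I) * card X0 \<le> card X \<and>
    (\<exists>Y. \<forall>i\<in>I. finite (Y i) \<and> card (Y i) = N \<and> (\<forall>x\<in>X. \<forall>y\<in>Y i. rel i x y))"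
proof -
  have one: "\<exists>X\<subseteq>X1. c ^ m * card X1 \<le> card X \<and> (\<exists>Y. finite Y \<and> card Y = m \<and> (\<forall>x\<in>X. \<forall>y\<in>Y. rel i x y))"
    if i: "i \<in> I" and X1: "X1 \<subseteq> X0" "X1 \<noteq> {}" and "m \<le> N" for i X1 m
    using that(4)
  proof (induction m)
    case 0
    show ?case by (intro exI[of _ X1]) (auto intro: exI[of _ "{}"])
  next
    case (Suc m)
    then obtain X Y where X: "X \<subseteq> X1" "c ^ m * card X1 \<le> card X"
      and Y: "finite Y" "card Y = m" "\<forall>x\<in>X. \<forall>y\<in>Y. rel i x y" by auto
    have "0 < card X1" using X1 assms(2) by (meson card_gt_0_iff finite_subset)
    then have "0 < c ^ m * card X1" using assms(1) by simp
    then have "X \<noteq> {}" using X(2) by auto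
    then obtain y where y: "y \<notin> Y" "c * card X \<le> card {x \<in> X. rel i x y}"
      using step[OF i _ _ Y(1), of X] X(1) Y(2) Suc.prems X1(1) by (metis Suc_leD dual_order.trans)
    have "c ^ Suc m * card X1 \<le> c * card X" using mult_left_mono[OF X(2), of c] assms(1) by (simp add: mult.assoc)
    also have "\<dots> \<le> card {x \<in> X. rel i x y}" by (rule y(2))
    finally show ?case using X Y y
      by (intro exI[of _ "{x \<in> X. rel i x y}"] conjI exI[of _ "insert y Y"]) auto
  qed
  have "\<exists>X\<subseteq>X0. c ^ (N * card J) * card X0 \<le> card X \<and>
    (\<exists>Y. \<forall>i\<in>J. finite (Y i) \<and> card (Y i) = N \<and> (\<forall>x\<in>X. \<forall>y\<in>Y i. rel i x y))"
    if "finite J" "J \<subseteq> I" for J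
    using that
  proof (induction J rule: finite_induct)
    case empty
    show ?case by (intro exI[of _ X0]) auto
  next
    case (insert i I)
    have "\<exists>X\<subseteq>X0. c ^ (N * card I) * card X0 \<le> card X \<and>
      (\<exists>Y. \<forall>i\<in>I. finite (Y i) \<and> card (Y i) = N \<and> (\<forall>x\<in>X. \<forall>y\<in>Y i. rel i x y))"
      using insert.IH insert.prems by simp
    then obtain X Y where X: "X \<subseteq> X0" "c ^ (N * card I) * card X0 \<le> card X"
      and Y: "\<forall>i\<in>I. finite (Y i) \<and> card (Y i) = N \<and> (\<forall>x\<in>X. \<forall>y\<in>Y i. rel i x y)" by blast
    have "0 < c ^ (N * card I) * card X0" using assms(1-3) by (simp add: card_gt_0_iff)
    then have "X \<noteq> {}" using X(2) by auto
    then obtain X' Y' where X': "X' \<subseteq> X" "c ^ N * card X \<le> card X'"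
      and Y': "finite Y'" "card Y' = N" "\<forall>x\<in>X'. \<forall>y\<in>Y'. rel i x y"
      using one[of i X N] X insert.prems by auto
    have "c ^ (N * card (insert i I)) * card X0 = c ^ N * (c ^ (N * card I) * card X0)"
      using insert.hyps by (simp add: power_add)
    also have "\<dots> \<le> c ^ N * card X" using X(2) assms(1) by (intro mult_left_mono) auto
    also have "\<dots> \<le> card X'" by (rule X'(2))
    finally have "c ^ (N * card (insert i I)) * card X0 \<le> card X'" .
    then show ?case using X X' Y Y' insert.hyps
      by (intro exI[of _ X'] conjI exI[of _ "Y(i := Y')"]) (auto simp: subset_iff)
  qed
  from this[OF \<open>finite I\<close> order_refl] show ?thesis .
qed

section \<open>Fans and dense walks\<close>

context near_regular
begin

text \<open>A vertex outside \<open>Z\<close> is not the centre of a fan, so at most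
  \<open>T\<close> vertices meet all its paths of length \<open>m\<close> into \<open>X\<close>.
  Either the end \<open>x\<close> is one of them, or the path passes through one of them, again
  outside \<open>Z\<close>, and continues with a shorter path.\<close>

lemma card_reached_le:
  fixes T :: nat and X :: "'a set"
  assumes Z: "\<And>w i. 1 \<le> i \<Longrightarrow> i < l \<Longrightarrow> fan E T i w X \<Longrightarrow> w \<in> Z" and X: "finite X"
  shows "1 \<le> m \<Longrightarrow> m < l \<Longrightarrow> u \<notin> Z \<Longrightarrow>
    card {x \<in> X. \<exists>p. path E m u x p \<and> set p \<inter> Z \<subseteq> {x}} \<le> (T * l + 1) ^ m"
proof (induction m arbitrary: u rule: less_induct)
  case (less m)
  let ?Q = "T * l + 1"
  let ?R = "\<lambda>m u. {x \<in> X. \<exists>p. path E m u x p \<and> set p \<inter> Z \<subseteq> {x}}"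
  have "\<not> fan E T m u X" using Z less.prems by blast
  then obtain Zu where Zu: "finite Zu" "card Zu \<le> T" "u \<notin> Zu"
    "\<And>p b. b \<in> X \<Longrightarrow> path E m u b p \<Longrightarrow> set p \<inter> Zu \<noteq> {}" unfolding fan_def by blast
  let ?A = "\<lambda>(w, j). ?R (m - j) w"
  have "?R m u \<subseteq> Zu \<union> \<Union> (?A ` ((Zu - Z) \<times> {1..<m}))"
  proof
    fix x assume "x \<in> ?R m u"
    then obtain p where p: "x \<in> X" "path E m u x p" "set p \<inter> Z \<subseteq> {x}" by auto
    obtain j where j: "j < length p" "p ! j \<in> Zu" using Zu(4)[OF p(1,2)] by (auto simp: in_set_conv_nth)
    have j0: "j \<noteq> 0" using j Zu(3) p(2) by (auto simp: path_def intro: Nat.gr0I)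
    have jm: "j \<le> m" using j path_length[OF p(2)] by simp
    show "x \<in> Zu \<union> \<Union> (?A ` ((Zu - Z) \<times> {1..<m}))"
    proof (cases "j = m")
      case True
      then show ?thesis using j p(2) by (auto simp: path_def)
    next
      case False
      have dp: "path E (m - j) (p ! j) x (drop j p)" by (rule path_drop[OF p(2) jm])
      have "p ! j \<noteq> x" using path_end_neq[OF dp] False jm by simp
      then have "p ! j \<notin> Z" using p(3) j nth_mem by blast
      then have "(p ! j, j) \<in> (Zu - Z) \<times> {1..<m}" using j j0 jm False by auto
      moreover have "x \<in> ?R (m - j) (p ! j)"
        using p(1,3) dp set_drop_subset[of j p] by blast
      ultimately show ?thesis by blast
    qed
  qed
  moreover have fin: "finite (Zu \<union> \<Union> (?A ` ((Zu - Z) \<times> {1..<m})))" using Zu(1) X by auto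
  ultimately have "card (?R m u) \<le> card (Zu \<union> \<Union> (?A ` ((Zu - Z) \<times> {1..<m})))" by (rule card_mono[rotated])
  also have "\<dots> \<le> card Zu + card (\<Union> (?A ` ((Zu - Z) \<times> {1..<m})))" by (rule card_Un_le)
  also have "card (\<Union> (?A ` ((Zu - Z) \<times> {1..<m}))) \<le> (\<Sum>wj\<in>(Zu - Z) \<times> {1..<m}. card (?A wj))"
    by (rule card_UN_le) (use Zu(1) in auto)
  also have "\<dots> \<le> (\<Sum>wj\<in>(Zu - Z) \<times> {1..<m}. ?Q ^ (m - 1))"
  proof (intro sum_mono)
    fix wj assume "wj \<in> (Zu - Z) \<times> {1..<m}"
    then obtain w j where wj: "wj = (w, j)" "w \<notin> Z" "1 \<le> j" "j < m" by auto
    have "card (?R (m - j) w) \<le> ?Q ^ (m - j)"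
      using less.prems wj by (intro less.IH) auto
    also have "\<dots> \<le> ?Q ^ (m - 1)" using wj by (intro power_increasing) auto
    finally show "card (?A wj) \<le> ?Q ^ (m - 1)" using wj by simp
  qed
  also have "\<dots> \<le> T * (m - 1) * ?Q ^ (m - 1)"
  proof -
    have "card (Zu - Z) \<le> T" using Zu card_mono[of Zu "Zu - Z"] by fastforce
    then have "card ((Zu - Z) \<times> {1..<m}) \<le> T * (m - 1)"
      unfolding card_cartesian_product by (intro mult_mono) auto
    then show ?thesis by (simp add: mult_right_mono del: mult_Suc mult_Suc_right)
  qed
  finally have "card (?R m u) \<le> T + T * (m - 1) * ?Q ^ (m - 1)" using Zu(2) by linarith
  also have "\<dots> \<le> T * ?Q ^ (m - 1) + T * (m - 1) * ?Q ^ (m - 1)" by simp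
  also have "\<dots> = T * m * ?Q ^ (m - 1)" using less.prems(1) by (cases m) (auto simp: algebra_simps)
  also have "\<dots> \<le> ?Q * ?Q ^ (m - 1)" using less.prems by (intro mult_right_mono) (auto simp: le_SucI)
  also have "\<dots> = ?Q ^ m" using less.prems(1) by (metis Suc_pred' less_eq_Suc_le One_nat_def power_Suc)
  finally show ?case .
qed

text \<open>If the set \<open>Z\<close> of centres of fans were small, robustness would give every \<open>x\<close> in \<open>X\<close> many
  neighbours of \<open>y\<close> that reach \<open>x\<close> outside \<open>Z\<close>, whereas each of them reaches boundedly many \<open>x\<close>.\<close>

lemma exists_fans:
  assumes l: "2 \<le> l" and X: "finite X" and rob: "\<And>x. x \<in> X \<Longrightarrow> robust E M l x y"
    and s: "s * l \<le> M"
    and count: "K * d * real ((T * l + 1) ^ (l - 1)) < card X * real (M - s * l)"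
  shows "\<exists>i W. 1 \<le> i \<and> i \<le> l - 1 \<and> finite W \<and> card W = s \<and> (\<forall>w\<in>W. fan E T i w X)"
proof (rule ccontr)
  assume neg: "\<not> ?thesis"
  define F where "F i = {w. fan E T i w X}" for i
  have F: "finite (F i) \<and> card (F i) \<le> s" if "1 \<le> i" "i \<le> l - 1" for i
  proof -
    have "F i \<subseteq> V"
    proof
      fix w assume "w \<in> F i"
      then have "fan E T i w X" by (simp add: F_def)
      then obtain p b where "path E i w b p" unfolding fan_def by (metis card.empty empty_iff finite.emptyI zero_le)
      then have "E w (p ! 1)" using that(1) by (auto simp: path_def walk_def)
      then show "w \<in> V" by (rule E_in_V)
    qed
    then have fin: "finite (F i)" using finite_V finite_subset by blast
    have "\<not> s \<le> card (F i)"
    proof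
      assume "s \<le> card (F i)"
      then obtain W where "W \<subseteq> F i" "card W = s" by (meson obtain_subset_with_card_n)
      then show False using neg that fin finite_subset[of W "F i"] by (auto simp: F_def)
    qed
    then show ?thesis using fin by simp
  qed
  define Z where "Z = (\<Union>i\<in>{1..l - 1}. F i)"
  have finZ: "finite Z" unfolding Z_def using F by auto
  have "card Z \<le> (\<Sum>i\<in>{1..l - 1}. card (F i))" unfolding Z_def by (rule card_UN_le) simp
  also have "\<dots> \<le> (\<Sum>i\<in>{1..l - 1}. s)" by (rule sum_mono) (use F in auto)
  also have "\<dots> \<le> s * l" by simp
  finally have cZ: "card Z \<le> s * l" .
  let ?R = "\<lambda>u. {x \<in> X. \<exists>p. path E (l - 1) u x p \<and> set p \<inter> Z \<subseteq> {x}}"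
  have R: "card (?R u) \<le> (T * l + 1) ^ (l - 1)" if "u \<notin> Z" for u
    by (rule card_reached_le[where l = l]) (use X l that in \<open>auto simp: Z_def F_def\<close>)
  let ?U = "\<lambda>x. {u \<in> {u. E y u} - Z. x \<in> ?R u}"
  have finU: "finite (?U x)" for x by simp
  \<comment> \<open>Otherwise \<open>Z\<close> and these neighbours together could be avoided by a
    path from \<open>x\<close> to \<open>y\<close>. Its last vertex before \<open>y\<close> differs
    from \<open>x\<close> because \<open>2 \<le> l\<close>, lies outside \<open>Z\<close> and
    reaches \<open>x\<close>, so it belongs to the avoided set.\<close>
  have U: "M - s * l \<le> card (?U x)" if xX: "x \<in> X" for x
  proof (rule ccontr)
    assume "\<not> ?thesis"
    then have "card ((Z \<union> ?U x) - {x, y}) \<le> M"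
      using card_Un_le[of Z "?U x"] cZ card_mono[of "Z \<union> ?U x" "(Z \<union> ?U x) - {x, y}"] finZ finU by force
    moreover have "finite ((Z \<union> ?U x) - {x, y})" "x \<notin> (Z \<union> ?U x) - {x, y}" "y \<notin> (Z \<union> ?U x) - {x, y}"
      using finZ finU by auto
    ultimately obtain p where p: "path E l x y p" "set p \<inter> ((Z \<union> ?U x) - {x, y}) = {}"
      using rob[OF xX] unfolding robust_def by meson
    let ?u = "p ! (l - 1)"
    have len: "length p = Suc l" by (rule path_length[OF p(1)])
    have tp: "path E (l - 1) x ?u (take l p)" using path_take[OF p(1), of "l - 1"] l by simp
    have Suc_l: "Suc (l - 1) = l" using l by simp
    have "\<forall>i<l. E (p ! i) (p ! Suc i)" using p(1) by (simp add: path_def walk_def)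
    then have "E (p ! (l - 1)) (p ! Suc (l - 1))" using Suc_l by (metis lessI)
    then have "E ?u y" using p(1) unfolding Suc_l by (simp add: path_def)
    have "y \<notin> set (take l p)"
    proof
      assume "y \<in> set (take l p)"
      then obtain j where "j < l" "p ! j = p ! l" using p(1) len by (auto simp: in_set_conv_nth path_def)
      then show False using p(1) len by (auto simp: path_def nth_eq_iff_index_eq)
    qed
    moreover have "set (take l p) \<subseteq> set p" by (rule set_take_subset)
    ultimately have avoid: "set (take l p) \<inter> Z \<subseteq> {x}" using p(2) by blast
    have "?u \<noteq> x" using path_end_neq[OF tp] l by auto
    moreover have "?u \<in> set (take l p)" using path_ends[OF tp] by simp
    ultimately have uZ: "?u \<notin> Z" "?u \<notin> ?U x"
      using avoid p(2) \<open>y \<notin> set (take l p)\<close> \<open>set (take l p) \<subseteq> set p\<close> by blast+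
    have "path E (l - 1) ?u x (rev (take l p))" by (rule path_rev[OF sym_E tp])
    moreover have "set (rev (take l p)) \<inter> Z \<subseteq> {x}" using avoid by simp
    ultimately have "x \<in> ?R ?u" using xX by blast
    then show False using uZ E_sym[OF \<open>E ?u y\<close>] by blast
  qed
  \<comment> \<open>Double counting of the pairs of an \<open>x\<close> in \<open>X\<close> and a
    neighbour of \<open>y\<close> that reaches it.\<close>
  have "card X * (M - s * l) \<le> (\<Sum>x\<in>X. card (?U x))"
    using sum_mono[of X "\<lambda>_. M - s * l" "\<lambda>x. card (?U x)"] U by simp
  also have "\<dots> = (\<Sum>u\<in>{u. E y u} - Z. card {x \<in> X. x \<in> ?R u})"
    by (rule sum_multicount_gen) (use X in auto)
  also have "\<dots> \<le> (\<Sum>u\<in>{u. E y u} - Z. (T * l + 1) ^ (l - 1))"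
    using R by (intro sum_mono) auto
  also have "\<dots> \<le> card {u. E y u} * (T * l + 1) ^ (l - 1)"
    by (simp add: mult_right_mono card_mono)
  finally have "real (card X * (M - s * l)) \<le> real (card {u. E y u} * (T * l + 1) ^ (l - 1))"
    by (simp only: of_nat_le_iff)
  also have "\<dots> \<le> K * d * real ((T * l + 1) ^ (l - 1))"
    unfolding of_nat_mult using deg_le[of y] by (intro mult_right_mono) auto
  finally show False using count by simp
qed

lemma power_Kd_le: "(K * d) ^ m \<le> K ^ k * d ^ m" if "m \<le> k"
  unfolding power_mult_distrib using that K_ge_1 d_ge_1
  by (intro mult_right_mono power_increasing) auto

text \<open>The walks of length \<open>i\<close> from \<open>v\<close> a positive proportion of whose extensions to length \<open>l - 1\<close> end in
  a vertex that is robust for \<open>x\<close>. As \<open>x\<close> is a neighbour of \<open>v\<close>, the prefix \<open>x, v\<close> turns these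
  extensions into walks of length \<open>l\<close>.\<close>

definition dense_walks :: "nat \<Rightarrow> nat \<Rightarrow> real \<Rightarrow> 'a \<Rightarrow> nat \<Rightarrow> 'a \<Rightarrow> 'a list set" where
  "dense_walks M l \<eta> v i x = {q \<in> walks E i v.
     \<eta> * d ^ (l - 1 - i) \<le> card {r \<in> walks E (l - 1 - i) (q ! i). robust E M l x (r ! (l - 1 - i))}}"

lemma finite_dense_walks [simp]: "finite (dense_walks M l \<eta> v i x)"
  by (simp add: dense_walks_def)

text \<open>Walks of length \<open>i\<close> that are not dense have fewer than
  \<open>\<eta> * d ^ (l - 1 - i)\<close> good extensions each. Together these make up at most half
  of the assumed number, and dense walks have to supply the rest.\<close>

lemma card_dense_walks_ge:
  assumes "2 \<le> l" "l \<le> k" "1 \<le> i" "i \<le> l - 1" "0 \<le> \<eta>"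
    and many: "2 * K ^ k * \<eta> * d ^ (l - 1) \<le> card {p \<in> walks E (l - 1) v. robust E M l x (p ! (l - 1))}"
  shows "\<eta> * d ^ i \<le> card (dense_walks M l \<eta> v i x)"
proof -
  let ?m = "l - 1 - i"
  let ?P = "{p \<in> walks E (l - 1) v. robust E M l x (p ! (l - 1))}"
  let ?C = "\<lambda>q. {r \<in> walks E ?m (q ! i). robust E M l x (r ! ?m)}"
  let ?D = "dense_walks M l \<eta> v i x"
  let ?f = "\<lambda>p. (take (Suc i) p, drop i p)"
  have Kk: "1 \<le> K ^ k" using K_ge_1 by simp
  have "inj_on ?f ?P"
  proof (rule inj_onI)
    fix p p' assume "?f p = ?f p'"
    then have "take i p = take i p'" "drop i p = drop i p'"
      by (auto dest: arg_cong[where f = "take i"])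
    then show "p = p'" by (metis append_take_drop_id)
  qed
  moreover have "?f ` ?P \<subseteq> Sigma (walks E i v) ?C"
  proof
    fix z assume "z \<in> ?f ` ?P"
    then obtain p where p: "walk E (l - 1) p" "p ! 0 = v" "robust E M l x (p ! (l - 1))" "z = ?f p"
      by (auto simp: walks_def)
    then show "z \<in> Sigma (walks E i v) ?C"
      using walk_take[OF p(1) assms(4)] walk_drop[OF p(1) assms(4)] assms(3,4) walk_length[OF p(1)]
      by (auto simp: walks_def Suc_diff_Suc)
  qed
  ultimately have "card ?P \<le> card (Sigma (walks E i v) ?C)" by (rule card_inj_on_le) auto
  also have "\<dots> = (\<Sum>q\<in>walks E i v. card (?C q))" by (rule card_SigmaI) auto
  also have "real \<dots> \<le> (\<Sum>q\<in>walks E i v. (if q \<in> ?D then (K * d) ^ ?m else 0) + \<eta> * d ^ ?m)"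
    unfolding of_nat_sum
  proof (intro sum_mono)
    fix q assume "q \<in> walks E i v"
    have "card (?C q) \<le> card (walks E ?m (q ! i))" by (rule card_mono) auto
    then have "real (card (?C q)) \<le> (K * d) ^ ?m" using card_walks_le[of ?m "q ! i"] by linarith
    then show "real (card (?C q)) \<le> (if q \<in> ?D then (K * d) ^ ?m else 0) + \<eta> * d ^ ?m"
      using \<open>q \<in> walks E i v\<close> d_ge_1 assms(5) by (auto simp: dense_walks_def intro: add_increasing2)
  qed
  also have "\<dots> = card ?D * (K * d) ^ ?m + card (walks E i v) * (\<eta> * d ^ ?m)"
  proof -
    have "(\<Sum>q\<in>walks E i v. if q \<in> ?D then (K * d) ^ ?m else 0) = (\<Sum>q\<in>?D. (K * d) ^ ?m)"
      by (rule sum.mono_neutral_cong_right) (auto simp: dense_walks_def)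
    then show ?thesis by (simp add: sum.distrib)
  qed
  also have "\<dots> \<le> card ?D * (K ^ k * d ^ ?m) + (K ^ k * d ^ i) * (\<eta> * d ^ ?m)"
    using power_Kd_le[of ?m k] power_Kd_le[of i k] card_walks_le[of i v] assms d_ge_1
    by (intro add_mono mult_left_mono mult_right_mono) (auto intro: order_trans)
  finally have "2 * K ^ k * \<eta> * d ^ (l - 1) \<le> card ?D * (K ^ k * d ^ ?m) + K ^ k * \<eta> * (d ^ i * d ^ ?m)"
    using many by (simp add: algebra_simps)
  moreover have "d ^ i * d ^ ?m = d ^ (l - 1)" using assms by (simp flip: power_add)
  ultimately have "(\<eta> * d ^ i) * (K ^ k * d ^ ?m) \<le> card ?D * (K ^ k * d ^ ?m)"
    by (simp add: algebra_simps)
  moreover have "0 < K ^ k * d ^ ?m" using Kk d_ge_1 by simp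
  ultimately show ?thesis by (metis mult_le_cancel_right_pos)
qed

text \<open>Double counting of pairs \<open>(x, q)\<close>: dropping the walks that hit
  \<open>F\<close> costs at most half of the dense walks of each \<open>x\<close>, while all
  \<open>x\<close> draw on the same \<open>K ^ k * d ^ i\<close> walks from \<open>v\<close>. Some
  walk is therefore dense for the stated proportion of \<open>X\<close>, and its end is the new
  \<open>y\<close>.\<close>

lemma dense_walks_step:
  assumes "2 \<le> l" "l \<le> k" "1 \<le> i" "i \<le> l - 1" "0 < \<eta>"
    and X: "finite X" "X \<noteq> {}" "\<And>x. x \<in> X \<Longrightarrow>
      2 * K ^ k * \<eta> * d ^ (l - 1) \<le> card {p \<in> walks E (l - 1) v. robust E M l x (p ! (l - 1))}"
    and F: "finite F" "card F \<le> N"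
    and d: "2 * N * k * K ^ k \<le> \<eta> * d"
  shows "\<exists>y. y \<notin> F \<and> \<eta> / (2 * K ^ k) * card X \<le> card {x \<in> X. \<exists>q\<in>dense_walks M l \<eta> v i x. q ! i = y}"
proof -
  have Kk: "1 \<le> K ^ k" using K_ge_1 by simp
  let ?D = "\<lambda>x. {q \<in> dense_walks M l \<eta> v i x. q ! i \<notin> F}"
  let ?H = "{q \<in> walks E i v. \<exists>j. 1 \<le> j \<and> j \<le> i \<and> q ! j \<in> F}"
  have "real (card ?H) \<le> card F * i * (K * d) ^ (i - 1)" by (rule card_walks_hit) fact
  also have "\<dots> \<le> N * k * (K ^ k * d ^ (i - 1))"
    using F(2) assms(2-4) power_Kd_le[of "i - 1" k] Kd_ge_1
    by (intro mult_mono of_nat_mono) (auto intro!: mult_mono)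
  also have "\<dots> = (2 * N * k * K ^ k) * d ^ (i - 1) / 2" by simp
  also have "\<dots> \<le> (\<eta> * d) * d ^ (i - 1) / 2"
    using d d_ge_1 by (intro divide_right_mono mult_right_mono) auto
  also have "\<dots> = \<eta> * d ^ i / 2" using assms(3) by (simp add: mult.assoc flip: power_Suc)
  finally have H: "real (card ?H) \<le> \<eta> * d ^ i / 2" .
  have D: "\<eta> * d ^ i / 2 \<le> card (?D x)" if "x \<in> X" for x
  proof -
    have "\<eta> * d ^ i \<le> card (dense_walks M l \<eta> v i x)"
      using card_dense_walks_ge[OF assms(1-4) _ X(3)[OF that]] assms(5) by simp
    moreover have "dense_walks M l \<eta> v i x \<subseteq> ?D x \<union> ?H" using assms(3) by (auto simp: dense_walks_def)
    then have "card (dense_walks M l \<eta> v i x) \<le> card (?D x \<union> ?H)" by (rule card_mono[rotated]) simp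
    then have "card (dense_walks M l \<eta> v i x) \<le> card (?D x) + card ?H"
      using card_Un_le[of "?D x" ?H] by linarith
    ultimately show ?thesis using H by linarith
  qed
  have "card X * (\<eta> * d ^ i / 2) \<le> (\<Sum>x\<in>X. real (card (?D x)))"
    using sum_mono[of X "\<lambda>_. \<eta> * d ^ i / 2" "\<lambda>x. real (card (?D x))"] D by simp
  also have "(\<Sum>x\<in>X. real (card (?D x))) = (\<Sum>q\<in>walks E i v. real (card {x \<in> X. q \<in> ?D x}))"
  proof -
    have "(\<Sum>x\<in>X. card {q \<in> walks E i v. q \<in> ?D x}) = (\<Sum>q\<in>walks E i v. card {x \<in> X. q \<in> ?D x})"
      by (rule sum_multicount_gen) (use X in auto)
    moreover have "{q \<in> walks E i v. q \<in> ?D x} = ?D x" for x by (auto simp: dense_walks_def)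
    ultimately show ?thesis by (metis (no_types, lifting) of_nat_sum sum.cong)
  qed
  finally have sum: "card X * (\<eta> * d ^ i / 2) \<le> (\<Sum>q\<in>walks E i v. real (card {x \<in> X. q \<in> ?D x}))" .
  show ?thesis
  proof (cases "\<exists>q\<in>walks E i v. q ! i \<notin> F \<and> \<eta> / (2 * K ^ k) * card X \<le> card {x \<in> X. q \<in> ?D x}")
    case True
    then obtain q where q: "q \<in> walks E i v" "q ! i \<notin> F" "\<eta> / (2 * K ^ k) * card X \<le> card {x \<in> X. q \<in> ?D x}"
      by blast
    have "card {x \<in> X. q \<in> ?D x} \<le> card {x \<in> X. \<exists>q'\<in>dense_walks M l \<eta> v i x. q' ! i = q ! i}"
      by (rule card_mono) (use X in auto)
    then show ?thesis using q by (intro exI[of _ "q ! i"]) auto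
  next
    case False
    \<comment> \<open>The value at which \<open>K ^ k * d ^ i\<close> walks, each counted below
      \<open>?\<theta>\<close> times, fall short of the lower bound on the sum.\<close>
    let ?\<theta> = "\<eta> / (2 * K ^ k) * card X"
    have pos: "0 < ?\<theta>" using assms(5) Kk X by (simp add: card_gt_0_iff)
    have "walks E i v \<noteq> {}"
    proof
      assume "walks E i v = {}"
      then have "card X * (\<eta> * d ^ i / 2) \<le> 0" using sum by simp
      moreover have "0 < card X * (\<eta> * d ^ i / 2)" using assms(5) d_ge_1 X by (simp add: card_gt_0_iff)
      ultimately show False by linarith
    qed
    moreover have "real (card {x \<in> X. q \<in> ?D x}) < ?\<theta>" if "q \<in> walks E i v" for q
    proof (cases "q ! i \<in> F")
      case True
      then show ?thesis using pos by simp
    next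
      case nF: False
      then show ?thesis using False that by force
    qed
    ultimately have "(\<Sum>q\<in>walks E i v. real (card {x \<in> X. q \<in> ?D x})) < (\<Sum>q\<in>walks E i v. ?\<theta>)"
      by (intro sum_strict_mono) auto
    also have "\<dots> = card (walks E i v) * ?\<theta>" by simp
    also have "\<dots> \<le> (K ^ k * d ^ i) * ?\<theta>"
      using card_walks_le[of i v] power_Kd_le[of i k] assms(1-4) pos
      by (intro mult_right_mono[OF order_trans]) auto
    also have "\<dots> = card X * (\<eta> * d ^ i / 2)" using Kk K_ge_1 by (simp add: field_simps)
    finally show ?thesis using sum by linarith
  qed
qed

text \<open>From the end of \<open>q\<close>, many walks of length \<open>l - 1 - i\<close> lead to
  robust partners of \<open>x\<close>, which gives a fan; a robust connection of length
  \<open>l\<close> completes it. As \<open>i\<close> runs through \<open>1, \<dots>, l - 1\<close>,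
  the total lengths run through \<open>2 * l - 2, \<dots>, l\<close>. For \<open>i = l - 1\<close>
  the fan has length 0.\<close>

lemma robust_if_dense_walk:
  assumes "2 \<le> l" "l \<le> k" "1 \<le> i" "i \<le> l - 1" "0 < \<eta>" "M' + k \<le> M"
    and q: "q \<in> dense_walks M l \<eta> v i x" "q ! i \<noteq> x"
    and d: "real (k * k + (M' + 1) * k) * K ^ k < \<eta> * d"
  shows "robust E M' (2 * l - 1 - i) x (q ! i)"
proof -
  let ?m = "l - 1 - i"
  let ?S = "{b. robust E M l x b}"
  have "fan E (M' + 1) ?m (q ! i) ?S"
  proof (rule fan_if_many_walks)
    have dense: "\<eta> * d ^ ?m \<le> card {r \<in> walks E ?m (q ! i). r ! ?m \<in> ?S}"
      using q(1) by (simp add: dense_walks_def)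
    have "real (?m * ?m + (M' + 1) * ?m) * (K * d) ^ (?m - 1) < \<eta> * d ^ ?m"
    proof (cases "?m = 0")
      case True
      then show ?thesis using assms(5) by simp
    next
      case False
      have "?m * ?m + (M' + 1) * ?m \<le> k * k + (M' + 1) * k"
        using assms by (intro add_mono mult_mono) auto
      then have "real (?m * ?m + (M' + 1) * ?m) * (K * d) ^ (?m - 1) \<le> real (k * k + (M' + 1) * k) * (K ^ k * d ^ (?m - 1))"
        using power_Kd_le[of "?m - 1" k] assms(2) Kd_ge_1 by (intro mult_mono of_nat_mono) auto
      also have "\<dots> = real (k * k + (M' + 1) * k) * K ^ k * d ^ (?m - 1)" by simp
      also have "\<dots> < (\<eta> * d) * d ^ (?m - 1)"
        using d d_ge_1 by (intro mult_strict_right_mono) auto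
      also have "\<dots> = \<eta> * d ^ ?m" using False by (metis mult.assoc power_eq_if)
      finally show ?thesis .
    qed
    then show "real (?m * ?m + (M' + 1) * ?m) * (K * d) ^ (?m - 1)
        < real (card {r \<in> walks E ?m (q ! i). r ! ?m \<in> ?S})" using dense by linarith
  qed
  then have "robust E M' (?m + l) (q ! i) x"
  proof (rule robust_fan_trans)
    fix b assume "b \<in> ?S"
    then have "robust E M l x b" by simp
    moreover have "M' + ?m \<le> M" using assms(2,6) by linarith
    ultimately show "robust E (M' + ?m) l b x" using robust_mono robust_sym[OF sym_E] by meson
  qed (rule q(2))
  moreover have "?m + l = 2 * l - 1 - i" using assms by simp
  ultimately show ?thesis using robust_sym[OF sym_E] by simp
qed

text \<open>Two strengths of robustness occur: \<open>M\<close> for the given pairs, spent on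
  finding the fans, and the smaller \<open>M'\<close>, which survives in all the connections and
  suffices for the embedding. The constant \<open>c\<close> is the proportion of \<open>d\<close>
  that remains in \<open>X\<close> after choosing \<open>N\<close> common partners for each of fewer
  than \<open>k\<close> indices.\<close>

lemma contains_subdivided_if_many_robust:
  fixes \<epsilon> :: real
  assumes l: "2 \<le> l" "l \<le> k" and "V \<noteq> {}"
    and M': "M' = s + t + s * t * (k + 1) + (k + 3) * (k + 1)"
    and N: "N = M' + 3 + s + t"
    and \<epsilon>: "0 < \<epsilon>" "\<epsilon> \<le> 1"
    and \<eta>: "\<eta> = \<epsilon> / (4 * K ^ (k + 1))"
    and c: "c = (\<eta> / (2 * K ^ k)) ^ (N * k) * (\<epsilon> / (2 * K ^ k))"
    and M: "M' + k \<le> M" "s * k \<le> M" "K * real ((M' * k + 1) ^ k) < c * real (M - s * k)"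
    and d: "real (k * k + (M' + 1) * k) * K ^ k < \<eta> * d" "2 * N * k * K ^ k \<le> \<eta> * d" "N \<le> c * d"
    and rich: "\<epsilon> * card V * d ^ l \<le> card {p \<in> all_walks l. robust E M l (p ! 0) (p ! l)}"
  shows "contains_subdivided E s t k"
proof -
  have Kk: "1 \<le> K ^ k" using K_ge_1 by simp
  have \<eta>0: "0 < \<eta>" using \<epsilon> K_ge_1 unfolding \<eta> by simp
  define b where "b = \<eta> / (2 * K ^ k)"
  have b0: "0 < b" unfolding b_def using \<eta>0 Kk by simp
  have "\<eta> \<le> 1" unfolding \<eta> using \<epsilon> one_le_power[OF K_ge_1, of "k + 1"] by (simp add: divide_le_eq)
  then have b1: "b \<le> 1" unfolding b_def using Kk by (simp add: divide_le_eq)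
  let ?P = "\<lambda>v x. {p \<in> walks E (l - 1) v. robust E M l x (p ! (l - 1))}"
  \<comment> \<open>Averaging over the second vertex \<open>v\<close> of a walk: its first vertex is
    a neighbour \<open>x\<close> of \<open>v\<close>, and the rest is a walk of length
    \<open>l - 1\<close> from \<open>v\<close>.\<close>
  have "\<exists>v\<in>V. \<epsilon> * d ^ l \<le> (\<Sum>x\<in>{x. E v x}. real (card (?P v x)))"
  proof (rule ccontr)
    assume neg: "\<not> ?thesis"
    let ?R = "{p \<in> all_walks l. robust E M l (p ! 0) (p ! l)}"
    let ?S = "Sigma V (\<lambda>v. Sigma {x. E v x} (?P v))"
    let ?f = "\<lambda>p. (p ! 1, p ! 0, tl p)"
    have "inj_on ?f ?R"
    proof (rule inj_onI)
      fix p p' assume p: "p \<in> ?R" "p' \<in> ?R" "?f p = ?f p'"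
      then have "p \<noteq> []" "p' \<noteq> []" by (auto simp: all_walks_def walks_def walk_def)
      then show "p = p'" using p(3) by (cases p; cases p') auto
    qed
    moreover have "?f ` ?R \<subseteq> ?S"
    proof
      fix z assume "z \<in> ?f ` ?R"
      then obtain p where p: "walk E l p" "p ! 0 \<in> V" "robust E M l (p ! 0) (p ! l)" "z = ?f p"
        by (auto simp: all_walks_def walks_def)
      have e: "E (p ! 0) (p ! 1)" using p(1) l by (simp add: walk_def)
      have tl: "walk E (l - 1) (tl p)" using walk_drop[OF p(1), of 1] l by (simp add: drop_Suc)
      have "tl p ! 0 = p ! 1" "tl p ! (l - 1) = p ! l"
        using walk_length[OF p(1)] l by (auto simp: nth_tl)
      then show "z \<in> ?S" using p tl e E_in_V' E_sym by (auto simp: walks_def)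
    qed
    ultimately have "card ?R \<le> card ?S" by (rule card_inj_on_le) (use finite_V in auto)
    also have "\<dots> = (\<Sum>v\<in>V. \<Sum>x\<in>{x. E v x}. card (?P v x))"
      using finite_V by (simp add: card_SigmaI)
    finally have "real (card ?R) \<le> (\<Sum>v\<in>V. \<Sum>x\<in>{x. E v x}. real (card (?P v x)))"
      by (simp flip: of_nat_sum)
    also have "\<dots> < (\<Sum>v\<in>V. \<epsilon> * d ^ l)"
      using neg finite_V assms(3) by (intro sum_strict_mono) (auto simp: not_le)
    finally show False using rich by (simp add: algebra_simps)
  qed
  then obtain v where v: "v \<in> V" "\<epsilon> * d ^ l \<le> (\<Sum>x\<in>{x. E v x}. real (card (?P v x)))" by blast
  define X0 where "X0 = {x. E v x \<and> 2 * K ^ k * \<eta> * d ^ (l - 1) \<le> card (?P v x)}"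
  have finX0: "finite X0" unfolding X0_def by (rule finite_subset[OF _ finite_nb[of v]]) auto
  \<comment> \<open>With this threshold the at most \<open>K * d\<close> neighbours outside
    \<open>X0\<close> contribute at most half of \<open>\<epsilon> * d ^ l\<close>.\<close>
  have \<eta>K: "2 * K ^ k * \<eta> = \<epsilon> / (2 * K)" unfolding \<eta> using K_ge_1 by (simp add: field_simps)
  have dl: "d * d ^ (l - 1) = d ^ l" using l by (simp flip: power_Suc)
  have cX0: "\<epsilon> / (2 * K ^ k) * d \<le> card X0"
  proof -
    have "\<epsilon> * d ^ l \<le> (\<Sum>x\<in>{x. E v x}. (if x \<in> X0 then (K * d) ^ (l - 1) else 0) + \<epsilon> / (2 * K) * d ^ (l - 1))"
    proof (rule order_trans[OF v(2) sum_mono])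
      fix x assume x: "x \<in> {x. E v x}"
      have "card (?P v x) \<le> card (walks E (l - 1) v)" by (rule card_mono) auto
      then have "real (card (?P v x)) \<le> (K * d) ^ (l - 1)" using card_walks_le[of "l - 1" v] by linarith
      then show "real (card (?P v x)) \<le> (if x \<in> X0 then (K * d) ^ (l - 1) else 0) + \<epsilon> / (2 * K) * d ^ (l - 1)"
        using x \<epsilon> d_ge_1 K_ge_1 unfolding X0_def \<eta>K by (auto intro: add_increasing2)
    qed
    also have "\<dots> = card X0 * (K * d) ^ (l - 1) + card {x. E v x} * (\<epsilon> / (2 * K) * d ^ (l - 1))"
    proof -
      have "(\<Sum>x\<in>{x. E v x}. if x \<in> X0 then (K * d) ^ (l - 1) else 0) = (\<Sum>x\<in>X0. (K * d) ^ (l - 1))"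
        by (rule sum.mono_neutral_cong_right) (auto simp: X0_def)
      then show ?thesis by (simp add: sum.distrib)
    qed
    also have "\<dots> \<le> card X0 * (K ^ k * d ^ (l - 1)) + (K * d) * (\<epsilon> / (2 * K) * d ^ (l - 1))"
      using power_Kd_le[of "l - 1" k] l deg_le[of v] \<epsilon> d_ge_1 K_ge_1
      by (intro add_mono mult_left_mono mult_right_mono) auto
    also have "(K * d) * (\<epsilon> / (2 * K) * d ^ (l - 1)) = \<epsilon> * d ^ l / 2"
      using K_ge_1 unfolding dl[symmetric] by (simp add: field_simps)
    finally have "\<epsilon> / 2 * d * d ^ (l - 1) \<le> card X0 * K ^ k * d ^ (l - 1)"
      unfolding dl[symmetric] by (simp add: algebra_simps)
    moreover have "0 < d ^ (l - 1)" using d_ge_1 by simp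
    ultimately have "\<epsilon> / 2 * d \<le> card X0 * K ^ k" by (metis mult_le_cancel_right_pos)
    then show ?thesis using Kk by (simp add: field_simps)
  qed
  have "0 < \<epsilon> / (2 * K ^ k) * d" using \<epsilon> Kk d_ge_1 by simp
  then have X0: "X0 \<noteq> {}" using cX0 by auto
  let ?rel = "\<lambda>i x y. \<exists>q\<in>dense_walks M l \<eta> v i x. q ! i = y"
  have "\<exists>X\<subseteq>X0. b ^ (N * card {1..l - 1}) * card X0 \<le> card X \<and>
    (\<exists>Y. \<forall>i\<in>{1..l - 1}. finite (Y i) \<and> card (Y i) = N \<and> (\<forall>x\<in>X. \<forall>y\<in>Y i. ?rel i x y))"
  proof (rule common_neighbours[OF b0 finX0 X0])
    fix i :: nat and X F :: "'a set" assume h: "i \<in> {1..l - 1}" "X \<subseteq> X0" "X \<noteq> {}" "finite F" "card F \<le> N"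
    show "\<exists>y. y \<notin> F \<and> b * card X \<le> card {x \<in> X. ?rel i x y}"
      unfolding b_def
      by (rule dense_walks_step[OF l _ _ \<eta>0]) (use h d(2) finX0 finite_subset[of X X0] in \<open>auto simp: X0_def\<close>)
  qed simp
  then obtain X Y where X: "X \<subseteq> X0" "b ^ (N * (l - 1)) * card X0 \<le> card X"
    and Y': "\<forall>i\<in>{1..l - 1}. finite (Y i) \<and> card (Y i) = N \<and> (\<forall>x\<in>X. \<forall>y\<in>Y i. ?rel i x y)"
    by (auto simp del: One_nat_def)
  have Y: "finite (Y i) \<and> card (Y i) = N \<and> (\<forall>x\<in>X. \<forall>y\<in>Y i. ?rel i x y)" if "1 \<le> i" "i \<le> l - 1" for i
    using Y' that by simp
  have finX: "finite X" using X(1) finX0 finite_subset by blast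
  have cX: "c * d \<le> card X"
  proof -
    have "c * d = b ^ (N * k) * (\<epsilon> / (2 * K ^ k) * d)" unfolding c b_def by simp
    also have "\<dots> \<le> b ^ (N * (l - 1)) * card X0"
      using cX0 b0 b1 l \<open>0 < \<epsilon> / (2 * K ^ k) * d\<close> by (intro mult_mono power_decreasing) auto
    finally show ?thesis using X(2) by linarith
  qed
  have l1: "1 \<le> l - 1" using l by simp
  have "Y (l - 1) \<noteq> {}" using Y[OF l1] N by auto
  then obtain y where y: "y \<in> Y (l - 1)" by blast
  \<comment> \<open>At full length only the trivial extension is left, so dense means that the end
    is itself a robust partner of \<open>x\<close>, and with the original \<open>M\<close> rather
    than \<open>M'\<close>.\<close>
  have rob: "robust E M l x y" if x: "x \<in> X" for x
  proof -
    obtain q where q: "q \<in> dense_walks M l \<eta> v (l - 1) x" "q ! (l - 1) = y"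
      using Y[OF l1] y x by blast
    then have "\<eta> \<le> card {r \<in> {[y]}. robust E M l x (r ! 0)}"
      by (simp add: dense_walks_def walks_0)
    then have "{r \<in> {[y]}. robust E M l x (r ! 0)} \<noteq> {}" using \<eta>0 by (metis card.empty not_le of_nat_0)
    then show ?thesis by auto
  qed
  have sl: "s * l \<le> s * k" using l by simp
  have count: "K * d * real ((M' * l + 1) ^ (l - 1)) < card X * real (M - s * l)"
  proof -
    have "(M' * l + 1) ^ (l - 1) \<le> (M' * k + 1) ^ k"
      using l by (intro order_trans[OF power_mono power_increasing]) auto
    then have "K * d * real ((M' * l + 1) ^ (l - 1)) \<le> d * (K * real ((M' * k + 1) ^ k))"
      using K_ge_1 d_ge_1 by (simp add: mult.assoc mult.left_commute[of K] del: of_nat_power)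
    also have "\<dots> < d * (c * real (M - s * k))"
      using M(3) d_ge_1 by (intro mult_strict_left_mono) auto
    also have "\<dots> = (c * d) * real (M - s * k)" by simp
    also have "\<dots> \<le> card X * real (M - s * l)"
      using cX sl l by (intro mult_mono of_nat_mono diff_le_mono2) auto
    finally show ?thesis .
  qed
  have "s * l \<le> M" using sl M(2) by linarith
  from exists_fans[OF l(1) finX rob this count] obtain i W
    where W: "1 \<le> i" "i \<le> l - 1" "finite W" "card W = s" "\<forall>w\<in>W. fan E M' i w X" by blast
  show ?thesis
  proof (rule contains_subdivided_if_structure[OF l refl _ _ _ sym_E finX])
    show "M' = s + t + s * t * (k + 1) + (k + 3) * (k + 1)" by (rule M')
    show "M' + 3 \<le> N" "s + t \<le> N" using N by auto
    show "N \<le> card X" using d(3) cX by linarith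
    show "1 \<le> i" "i \<le> l - 1" "finite W" "s \<le> card W" using W by auto
    show "fan E M' i w X" if "w \<in> W" for w using W that by blast
    fix h assume h: "l \<le> h" "h \<le> 2 * l - 2"
    define j where "j = 2 * l - 1 - h"
    have j: "1 \<le> j" "j \<le> l - 1" "h = 2 * l - 1 - j" using h l by (auto simp: j_def)
    have "linked E M' h X (Y j)"
      unfolding linked_def
    proof (intro ballI impI)
      fix x y assume xy: "x \<in> X" "y \<in> Y j" "x \<noteq> y"
      then obtain q where q: "q \<in> dense_walks M l \<eta> v j x" "q ! j = y" using Y[OF j(1,2)] by blast
      then show "robust E M' h x y"
        using robust_if_dense_walk[OF l j(1,2) \<eta>0 M(1) q(1) _ d(1)] xy(3) j(3) by auto
    qed
    then show "\<exists>Y. finite Y \<and> N \<le> card Y \<and> linked E M' h X Y" using Y[OF j(1,2)] by auto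
  qed
qed

end

section \<open>Almost regular subgraphs and extremal numbers\<close>

lemma contains_copy_trans:
  assumes "contains_copy G K" "contains_copy K H"
  shows "contains_copy G H"
proof -
  obtain f where f: "inj_on f (verts K)" "f ` verts K \<subseteq> verts G" "\<forall>e\<in>edges K. f ` e \<in> edges G"
    using assms(1) by (auto simp: contains_copy_def)
  obtain g where g: "inj_on g (verts H)" "g ` verts H \<subseteq> verts K" "\<forall>e\<in>edges H. g ` e \<in> edges K"
    using assms(2) by (auto simp: contains_copy_def)
  have "inj_on (f \<circ> g) (verts H)" using f(1) g(1,2) by (meson comp_inj_on inj_on_subset)
  moreover have "(f \<circ> g) ` verts H \<subseteq> verts G" using f(2) g(2) by auto
  moreover have "\<forall>e\<in>edges H. (f \<circ> g) ` e \<in> edges G" using f(3) g(3) by (metis image_comp)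
  ultimately show ?thesis unfolding contains_copy_def by blast
qed

text \<open>Inner vertices are named by unordered pairs, so relabelling by \<open>\<phi>\<close>
  inside the name respects both orientations of an edge.\<close>

lemma contains_copy_subdivision:
  assumes \<phi>: "inj_on \<phi> (verts H)" "\<phi> ` verts H \<subseteq> verts K" "\<And>e. e \<in> edges H \<Longrightarrow> \<phi> ` e \<in> edges K"
    and H: "\<And>e. e \<in> edges H \<Longrightarrow> e \<subseteq> verts H"
  shows "contains_copy (subdivision m K) (subdivision m H)"
proof -
  define F where "F z = (case z of Branch v \<Rightarrow> Branch (\<phi> v) | Inner S \<Rightarrow> Inner (map_prod \<phi> id ` S))" for z
  have F: "F (path_vertex m u v i) = path_vertex m (\<phi> u) (\<phi> v) i" for u v i
    by (simp add: F_def path_vertex_def)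
  have edge: "{\<phi> u, \<phi> v} \<in> edges K" if "{u, v} \<in> edges H" for u v
    using \<phi>(3)[OF that] by simp
  let ?V = "verts H \<times> (UNIV :: nat set)"
  have Inner: "S \<subseteq> ?V" if "Inner S \<in> verts (subdivision m H)" for S
    using that H by (fastforce simp: subdivision_def path_vertex_def split: if_splits)
  have Branch: "v \<in> verts H" if "Branch v \<in> verts (subdivision m H)" for v
    using that by (auto simp: subdivision_def path_vertex_def split: if_splits)
  have inj: "inj_on (map_prod \<phi> (id :: nat \<Rightarrow> nat)) ?V"
    using \<phi>(1) by (auto simp: inj_on_def)
  have "inj_on F (verts (subdivision m H))"
  proof (rule inj_onI)
    fix y z assume yz: "y \<in> verts (subdivision m H)" "z \<in> verts (subdivision m H)" "F y = F z"
    show "y = z"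
    proof (cases y)
      case y: (Branch u)
      then obtain v where "z = Branch v" "\<phi> u = \<phi> v" using yz(3) by (cases z) (auto simp: F_def)
      then show ?thesis using y yz(1,2) Branch inj_onD[OF \<phi>(1)] by auto
    next
      case y: (Inner S)
      then obtain S' where z: "z = Inner S'" "map_prod \<phi> id ` S = map_prod \<phi> id ` S'"
        using yz(3) by (cases z) (auto simp: F_def)
      then have "S = S'" using inj_on_image_eq_iff[OF inj] Inner y yz(1,2) by blast
      then show ?thesis using y z by simp
    qed
  qed
  moreover have "F ` verts (subdivision m H) \<subseteq> verts (subdivision m K)"
  proof
    fix z assume "z \<in> F ` verts (subdivision m H)"
    then obtain y where y: "y \<in> verts (subdivision m H)" "z = F y" by auto
    then consider v where "v \<in> verts H" "y = Branch v"
      | u v i where "{u, v} \<in> edges H" "1 \<le> i" "i \<le> m" "y = path_vertex m u v i"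
      by (auto simp: subdivision_def)
    then show "z \<in> verts (subdivision m K)"
    proof cases
      case 1
      then show ?thesis using y \<phi>(2) by (auto simp: F_def subdivision_def)
    next
      case 2
      then show ?thesis using y(2) edge[OF 2(1)] F unfolding subdivision_def by fastforce
    qed
  qed
  moreover have "\<forall>e\<in>edges (subdivision m H). F ` e \<in> edges (subdivision m K)"
    using edge F by (fastforce simp: subdivision_def)
  ultimately show ?thesis unfolding contains_copy_def by blast
qed

lemma bipartite_into_complete_bipartite:
  assumes "finite_simple_graph H" "bipartite H"
  obtains \<phi> s t where "1 \<le> s" "1 \<le> t" "inj_on \<phi> (verts H)"
    "\<phi> ` verts H \<subseteq> verts (complete_bipartite s t)"
    "\<And>e. e \<in> edges H \<Longrightarrow> \<phi> ` e \<in> edges (complete_bipartite s t)"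
proof -
  obtain A B where AB: "A \<union> B = verts H" "A \<inter> B = {}" "\<forall>e\<in>edges H. \<exists>a\<in>A. \<exists>b\<in>B. e = {a, b}"
    using assms(2) by (auto simp: bipartite_def)
  have fin: "finite A" "finite B" using AB(1) assms(1) by (metis finite_Un finite_simple_graph_def)+
  obtain f where f: "bij_betw f A {0..<card A}" using ex_bij_betw_finite_nat[OF fin(1)] by blast
  obtain g where g: "bij_betw g B {0..<card B}" using ex_bij_betw_finite_nat[OF fin(2)] by blast
  define \<phi> where "\<phi> v = (if v \<in> A then Inl (f v) else Inr (g v))" for v
  have fA: "f v < Suc (card A)" if "v \<in> A" for v using bij_betwE[OF f] that by (auto simp: less_Suc_eq)
  have gB: "g v < Suc (card B)" if "v \<in> B" for v using bij_betwE[OF g] that by (auto simp: less_Suc_eq)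
  show ?thesis
  \<comment> \<open>The successors keep both parameters positive even if a side of \<open>H\<close>
    is empty.\<close>
  proof (rule that[of "Suc (card A)" "Suc (card B)" \<phi>])
    show "inj_on \<phi> (verts H)"
      using f g unfolding \<phi>_def AB(1)[symmetric]
      by (intro inj_onI) (auto simp: bij_betw_def split: if_splits dest: inj_onD)
    show "\<phi> ` verts H \<subseteq> verts (complete_bipartite (Suc (card A)) (Suc (card B)))"
      using fA gB AB(1) by (auto simp: \<phi>_def complete_bipartite_def)
    fix e assume "e \<in> edges H"
    then obtain a b where ab: "a \<in> A" "b \<in> B" "e = {a, b}" using AB(3) by blast
    then have "b \<notin> A" using AB(2) by auto
    then show "\<phi> ` e \<in> edges (complete_bipartite (Suc (card A)) (Suc (card B)))"
      using ab fA[OF ab(1)] gB[OF ab(2)] by (auto simp: \<phi>_def complete_bipartite_def)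
  qed auto
qed

lemma extremal_number_mono:
  assumes "contains_copy K H"
  shows "extremal_number n H \<le> extremal_number n K"
proof (cases "free_edge_counts n H = {}")
  case False
  have "free_edge_counts n H \<subseteq> free_edge_counts n K"
    using assms contains_copy_trans unfolding free_edge_counts_def by blast
  then show ?thesis
    using False Max_mono[OF _ False finite_free_edge_counts] extremal_number_eq_Max
    by (metis subset_empty)
qed (simp add: extremal_number_def Sup_nat_def)

lemma extremal_number_bigo:
  assumes "0 < C"
    and "\<And>(G :: nat ugraph) n. 1 \<le> n \<Longrightarrow> finite_simple_graph G \<Longrightarrow> card (verts G) = n \<Longrightarrow>
      C * real n powr \<beta> \<le> card (edges G) \<Longrightarrow> contains_copy G H"
  shows "(\<lambda>n. real (extremal_number n H)) \<in> O(\<lambda>n. real n powr \<beta>)"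
proof (rule bigoI[where c = C])
  have "real (extremal_number n H) \<le> C * real n powr \<beta>" if "1 \<le> n" for n
  proof (cases "free_edge_counts n H = {}")
    case False
    then have "extremal_number n H \<in> free_edge_counts n H"
      using Max_in[OF finite_free_edge_counts False] extremal_number_eq_Max by metis
    then obtain G :: "nat ugraph" where "extremal_number n H = card (edges G)"
      "finite_simple_graph G" "card (verts G) = n" "\<not> contains_copy G H"
      by (auto simp: free_edge_counts_def)
    then show ?thesis using assms(2)[OF that, of G] by fastforce
  qed (use assms(1) in \<open>simp add: extremal_number_def Sup_nat_def\<close>)
  then show "\<forall>\<^sub>F n in sequentially. norm (real (extremal_number n H)) \<le> C * norm (real n powr \<beta>)"
    by (auto intro!: eventually_sequentiallyI[of 1])
qed

section \<open>Near-regular subgraphs of dense graphs\<close>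

definition edge_count :: "'a set set \<Rightarrow> 'a set \<Rightarrow> nat" where
  "edge_count Es S = card {e \<in> Es. e \<subseteq> S}"

definition adjacent_in :: "'a set set \<Rightarrow> 'a set \<Rightarrow> 'a \<Rightarrow> 'a \<Rightarrow> bool" where
  "adjacent_in Es S x y \<longleftrightarrow> x \<in> S \<and> y \<in> S \<and> {x, y} \<in> Es"

lemma card_adjacent_in:
  assumes "\<forall>e\<in>Es. card e = 2" "x \<in> S"
  shows "card {y. adjacent_in Es S x y} = card {e \<in> Es. e \<subseteq> S \<and> x \<in> e}"
proof (rule bij_betw_same_card[of "\<lambda>y. {x, y}"], unfold bij_betw_def, intro conjI)
  show "inj_on (\<lambda>y. {x, y}) {y. adjacent_in Es S x y}" by (auto simp: inj_on_def doubleton_eq_iff)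
  show "(\<lambda>y. {x, y}) ` {y. adjacent_in Es S x y} = {e \<in> Es. e \<subseteq> S \<and> x \<in> e}"
  proof (intro equalityI subsetI)
    fix e assume e: "e \<in> {e \<in> Es. e \<subseteq> S \<and> x \<in> e}"
    then have "card e = 2" using assms(1) by auto
    then obtain a b where "e = {a, b}" by (auto simp: card_2_iff)
    then have "\<exists>y. e = {x, y}" using e by auto
    then show "e \<in> (\<lambda>y. {x, y}) ` {y. adjacent_in Es S x y}"
      using e assms(2) by (auto simp: adjacent_in_def)
  qed (use assms(2) in \<open>auto simp: adjacent_in_def\<close>)
qed

lemma ex_max_of_finite:
  fixes f :: "'a \<Rightarrow> 'b :: linorder"
  assumes "finite A" "A \<noteq> {}"
  shows "\<exists>x\<in>A. \<forall>y\<in>A. f y \<le> f x"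
proof -
  have "Max (f ` A) \<in> f ` A" using assms by (intro Max_in) auto
  then obtain x where "x \<in> A" "f x = Max (f ` A)" by auto
  then show ?thesis using assms(1) by (metis Max_ge finite_imageI imageI)
qed

lemma edge_count_remove:
  assumes "finite Es" "\<forall>e\<in>Es. card e = 2" "x \<in> S"
  shows "edge_count Es S = edge_count Es (S - {x}) + card {y. adjacent_in Es S x y}"
proof -
  have "{e \<in> Es. e \<subseteq> S} = {e \<in> Es. e \<subseteq> S - {x}} \<union> {e \<in> Es. e \<subseteq> S \<and> x \<in> e}" by auto
  then have "card {e \<in> Es. e \<subseteq> S} = card {e \<in> Es. e \<subseteq> S - {x}} + card {e \<in> Es. e \<subseteq> S \<and> x \<in> e}"
    using assms(1) by (subst card_Un_disjoint[symmetric]) auto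
  then show ?thesis using card_adjacent_in[OF assms(2,3)] by (simp add: edge_count_def)
qed

lemma handshake:
  assumes "finite Es" "\<forall>e\<in>Es. card e = 2" "finite S"
  shows "(\<Sum>x\<in>S. card {y. adjacent_in Es S x y}) = 2 * edge_count Es S"
proof -
  let ?E = "{e \<in> Es. e \<subseteq> S}"
  have "(\<Sum>x\<in>S. card {y. adjacent_in Es S x y}) = (\<Sum>x\<in>S. card {e \<in> ?E. x \<in> e})"
    by (rule sum.cong) (use card_adjacent_in[OF assms(2)] in \<open>auto simp: conj_assoc\<close>)
  also have "\<dots> = (\<Sum>e\<in>?E. card {x \<in> S. x \<in> e})"
    by (rule sum_multicount_gen) (use assms in auto)
  also have "\<dots> = (\<Sum>e\<in>?E. 2)"
  proof (rule sum.cong)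
    fix e assume "e \<in> ?E"
    then have "{x \<in> S. x \<in> e} = e" "card e = 2" using assms(2) by auto
    then show "card {x \<in> S. x \<in> e} = 2" by simp
  qed simp
  finally show ?thesis by (simp add: edge_count_def)
qed

text \<open>Every edge that meets \<open>H\<close> lies in the union of \<open>H\<close> and one of the \<open>p\<close> parts of an equipartition
  of \<open>S - H\<close>.\<close>

lemma edge_count_le_parts:
  assumes "finite Es" "\<forall>e\<in>Es. card e = 2" "finite S" "H \<subseteq> S" "1 \<le> p"
    and b: "\<And>Q. Q \<subseteq> S \<Longrightarrow> card Q \<le> card H + (card S div p + 1) \<Longrightarrow> edge_count Es Q \<le> b"
  shows "edge_count Es S \<le> edge_count Es (S - H) + p * b"
proof -
  have finSH: "finite (S - H)" using assms(3) by simp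
  obtain g where g: "bij_betw g (S - H) {0..<card (S - H)}" using ex_bij_betw_finite_nat[OF finSH] by blast
  \<comment> \<open>Residue classes of an enumeration modulo \<open>p\<close> serve as parts of
    nearly equal size.\<close>
  define Q where "Q i = {v \<in> S - H. g v mod p = i}" for i
  have cQ: "card (Q i) \<le> card S div p + 1" for i
  proof -
    have "inj_on (\<lambda>v. g v div p) (Q i)"
    proof (rule inj_onI)
      fix u v assume uv: "u \<in> Q i" "v \<in> Q i" "g u div p = g v div p"
      then have "g u = g v" unfolding Q_def by (metis (mono_tags, lifting) div_mult_mod_eq mem_Collect_eq)
      then show "u = v" using uv g by (auto simp: bij_betw_def inj_on_def Q_def)
    qed
    moreover have "(\<lambda>v. g v div p) ` Q i \<subseteq> {..card S div p}"
    proof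
      fix z assume "z \<in> (\<lambda>v. g v div p) ` Q i"
      then obtain v where v: "v \<in> S - H" "z = g v div p" by (auto simp: Q_def)
      have "g v < card (S - H)" using g v(1) by (auto simp: bij_betw_def)
      also have "\<dots> \<le> card S" by (rule card_mono) (use assms(3) in auto)
      finally show "z \<in> {..card S div p}" using v(2) by (simp add: div_le_mono)
    qed
    ultimately have "card (Q i) \<le> card {..card S div p}" by (rule card_inj_on_le) simp
    then show ?thesis by simp
  qed
  have finH: "finite H" using assms(3,4) finite_subset by blast
  have HQ: "edge_count Es (H \<union> Q i) \<le> b" for i
    by (rule b) (use assms(4) cQ[of i] card_Un_le[of H "Q i"] in \<open>auto simp: Q_def\<close>)
  have "{e \<in> Es. e \<subseteq> S} \<subseteq> {e \<in> Es. e \<subseteq> S - H} \<union> (\<Union>i\<in>{..<p}. {e \<in> Es. e \<subseteq> H \<union> Q i})"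
  proof
    fix e assume e: "e \<in> {e \<in> Es. e \<subseteq> S}"
    show "e \<in> {e \<in> Es. e \<subseteq> S - H} \<union> (\<Union>i\<in>{..<p}. {e \<in> Es. e \<subseteq> H \<union> Q i})"
    proof (cases "e \<subseteq> S - H")
      case False
      then obtain x where x: "x \<in> e" "x \<in> H" using e by auto
      have "card e = 2" using e assms(2) by auto
      then obtain y where y: "e = {x, y}" using x(1) by (auto simp: card_2_iff)
      have "y \<in> H \<union> Q (g y mod p)" using e y by (auto simp: Q_def)
      moreover have "g y mod p < p" using assms(5) by simp
      ultimately show ?thesis using e x y by blast
    qed (use e in simp)
  qed
  then have "edge_count Es S \<le> card ({e \<in> Es. e \<subseteq> S - H} \<union> (\<Union>i\<in>{..<p}. {e \<in> Es. e \<subseteq> H \<union> Q i}))"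
    unfolding edge_count_def by (rule card_mono[rotated]) (use assms(1) in auto)
  also have "\<dots> \<le> edge_count Es (S - H) + card (\<Union>i\<in>{..<p}. {e \<in> Es. e \<subseteq> H \<union> Q i})"
    unfolding edge_count_def by (rule card_Un_le)
  also have "card (\<Union>i\<in>{..<p}. {e \<in> Es. e \<subseteq> H \<union> Q i}) \<le> (\<Sum>i\<in>{..<p}. edge_count Es (H \<union> Q i))"
    unfolding edge_count_def by (rule card_UN_le) simp
  also have "\<dots> \<le> (\<Sum>i\<in>{..<p}. b)" using HQ by (intro sum_mono)
  finally show ?thesis by simp
qed

text \<open>The set \<open>S\<close> maximizes the ratio of the number of edges to \<open>card S powr (1 + \<alpha>)\<close>, so all small
  sets are sparse and deleting the few vertices of large degree costs few edges; a set \<open>T\<close>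
  that maximizes \<open>edge_count Es T - d * card T\<close> in the rest then has minimum degree at least \<open>d\<close>.\<close>

lemma near_regular_subgraph:
  fixes \<alpha> C :: real
  assumes "0 < \<alpha>" "0 < C" "1 \<le> p" and p: "(3 / real p) powr \<alpha> \<le> 1 / 12"
    and G: "finite Es" "\<forall>e\<in>Es. card e = 2" "finite V" "V \<noteq> {}"
    and many: "C * real (card V) powr (1 + \<alpha>) \<le> edge_count Es V"
  shows "\<exists>T (d :: real). T \<subseteq> V \<and> T \<noteq> {} \<and> C / 4 * real (card T) powr \<alpha> \<le> d \<and>
    (\<forall>x\<in>T. d \<le> card {y. adjacent_in Es T x y} \<and> card {y. adjacent_in Es T x y} \<le> 8 * real p * d)"
proof -
  let ?e = "\<lambda>S. real (edge_count Es S)"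
  let ?r = "\<lambda>S. ?e S / real (card S) powr (1 + \<alpha>)"
  let ?F = "{S. S \<subseteq> V \<and> S \<noteq> {}}"
  have finF: "finite ?F" using G(3) by simp
  have "?F \<noteq> {}" using G(4) by auto
  then obtain S where S: "S \<in> ?F" "\<And>S'. S' \<in> ?F \<Longrightarrow> ?r S' \<le> ?r S"
    using finF ex_max_of_finite[of ?F ?r] by blast
  define B where "B = ?r S"
  define m where "m = real (card S)"
  have finS: "finite S" using S(1) G(3) finite_subset by blast
  have m1: "1 \<le> m" using S(1) finS unfolding m_def by (simp add: Suc_le_eq card_gt_0_iff)
  have cpos: "0 < real (card S') powr (1 + \<alpha>)" if "S' \<in> ?F" for S'
    using that G(3) finite_subset[of S' V] by (auto simp: card_gt_0_iff)
  have "C \<le> ?r V" using many cpos[of V] G(4) by (simp add: pos_le_divide_eq)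
  also have "\<dots> \<le> B" unfolding B_def using G(4) by (intro S(2)) auto
  finally have CB: "C \<le> B" .
  have B0: "0 < B" using CB assms(2) by simp
  have eS: "?e S = B * m powr (1 + \<alpha>)" using cpos[OF S(1)] by (simp add: B_def m_def)
  have "{e \<in> Es. e \<subseteq> {}} = {}" using G(2) by force
  then have e0: "edge_count Es {} = 0" by (simp only: edge_count_def card.empty)
  have sparse: "?e Q \<le> B * real (card Q) powr (1 + \<alpha>)" if "Q \<subseteq> V" for Q
  proof (cases "Q = {}")
    case True
    then show ?thesis using e0 by simp
  next
    case False
    then have "?r Q \<le> B" unfolding B_def using that by (intro S(2)) auto
    then show ?thesis using cpos[of Q] that False by (simp add: pos_divide_le_eq)
  qed
  \<comment> \<open>Chosen so that \<open>S\<close> spans \<open>4 * d * m\<close> edges, that is,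
    has average degree \<open>8 * d\<close>.\<close>
  define d where "d = B * m powr \<alpha> / 4"
  have d0: "0 < d" using B0 m1 by (simp add: d_def)
  have md: "B * m powr (1 + \<alpha>) = 4 * d * m" using m1 by (simp add: d_def powr_add)
  let ?deg = "\<lambda>x. card {y. adjacent_in Es S x y}"
  \<comment> \<open>The threshold is \<open>p\<close> times the average degree, so \<open>H\<close>
    contains at most a fraction \<open>1 / p\<close> of \<open>S\<close>.\<close>
  define H where "H = {x \<in> S. 8 * p * d < ?deg x}"
  have finH: "finite H" "H \<subseteq> S" using finS by (auto simp: H_def)
  have cH: "card H * p \<le> m"
  proof -
    have "card H * (8 * p * d) \<le> (\<Sum>x\<in>H. real (?deg x))"
      using sum_mono[of H "\<lambda>_. 8 * p * d" "\<lambda>x. real (?deg x)"] by (force simp: H_def)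
    also have "\<dots> \<le> (\<Sum>x\<in>S. real (?deg x))" by (rule sum_mono2) (use finS finH in auto)
    also have "\<dots> = 2 * ?e S" using handshake[OF G(1,2) finS] by (simp flip: of_nat_sum)
    finally have "card H * p * (8 * d) \<le> m * (8 * d)" unfolding eS md by (simp add: mult_ac)
    then show ?thesis using d0 by simp
  qed
  have "?e S \<le> ?e (S - H) + B * m powr (1 + \<alpha>) / 4"
  proof (cases "H = {}")
    case True
    then show ?thesis using B0 by simp
  next
    case False
    then have "1 \<le> real (card H)" using finH by (simp add: Suc_le_eq card_gt_0_iff)
    then have "1 * real p \<le> real (card H) * real p" by (intro mult_right_mono) auto
    \<comment> \<open>A nonempty \<open>H\<close> forces \<open>1 \<le> m / p\<close>, which absorbs
      the rounding: \<open>H\<close> with one part has at most \<open>3 * m / p\<close>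
      vertices.\<close>
    then have pm: "real p \<le> m" using cH by simp
    let ?b = "B * (3 * m / p) powr (1 + \<alpha>)"
    have "edge_count Es S \<le> edge_count Es (S - H) + p * nat \<lfloor>?b\<rfloor>"
    proof (rule edge_count_le_parts[OF G(1,2) finS finH(2) assms(3)])
      fix Q assume Q: "Q \<subseteq> S" "card Q \<le> card H + (card S div p + 1)"
      have "real (card H) \<le> m / p" using cH assms(3) by (simp add: pos_le_divide_eq)
      moreover have "real (card S div p) \<le> m / p" unfolding m_def by (rule of_nat_div_le_of_nat)
      moreover have "1 \<le> m / p" using pm assms(3) by simp
      moreover have "real (card Q) \<le> card H + (real (card S div p) + 1)" using Q(2) by linarith
      ultimately have "real (card Q) \<le> 3 * m / p" by simp
      then have "real (card Q) powr (1 + \<alpha>) \<le> (3 * m / p) powr (1 + \<alpha>)"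
        using assms(1) by (intro powr_mono2) auto
      then have "?e Q \<le> ?b" using sparse[of Q] Q(1) S(1) B0 mult_left_mono[of _ _ B] by fastforce
      then show "edge_count Es Q \<le> nat \<lfloor>?b\<rfloor>" by (simp add: le_nat_floor)
    qed
    then have "?e S \<le> ?e (S - H) + p * real (nat \<lfloor>?b\<rfloor>)" by (simp flip: of_nat_add of_nat_mult)
    also have "real (nat \<lfloor>?b\<rfloor>) \<le> ?b" using B0 by (intro of_nat_floor) auto
    finally have "?e S \<le> ?e (S - H) + p * ?b" using assms(3) by (simp add: mult_left_mono)
    \<comment> \<open>The hypothesis on \<open>p\<close> turns this into a quarter of the edges of
      \<open>S\<close>; a bound linear in \<open>m / p\<close> would gain nothing from the
      partition, while the power \<open>\<alpha>\<close> does.\<close>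
    also have "p * ?b = 3 * (B * m powr (1 + \<alpha>)) * (3 / p) powr \<alpha>"
    proof -
      have "(3 * m / p) powr (1 + \<alpha>) = (m * (3 / p)) powr (1 + \<alpha>)" by (simp add: mult.commute)
      also have "\<dots> = m powr (1 + \<alpha>) * (3 / p) powr (1 + \<alpha>)" by (rule powr_mult)
      also have "(3 / p) powr (1 + \<alpha>) = (3 / p) * (3 / p) powr \<alpha>" using assms(3) by (simp add: powr_add)
      finally show ?thesis using assms(3) by simp
    qed
    also have "\<dots> \<le> 3 * (B * m powr (1 + \<alpha>)) * (1 / 12)"
      using p B0 by (intro mult_left_mono) auto
    finally show ?thesis by simp
  qed
  then have eSH: "3 * d * m \<le> ?e (S - H)" unfolding eS md by simp
  let ?v = "\<lambda>T. ?e T - d * real (card T)"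
  have "finite (Pow (S - H))" "Pow (S - H) \<noteq> {}" using finS by auto
  then obtain T where T: "T \<in> Pow (S - H)" "\<And>T'. T' \<in> Pow (S - H) \<Longrightarrow> ?v T' \<le> ?v T"
    using ex_max_of_finite[of "Pow (S - H)" ?v] by blast
  have finT: "finite T" using T(1) finS finite_subset by blast
  have "real (card (S - H)) \<le> m" unfolding m_def using finS by (simp add: card_mono)
  \<comment> \<open>At least \<open>3 * d * m\<close> edges remain against a penalty of at most
    \<open>d * m\<close>, so the maximizer is not the empty set, whose value is 0.\<close>
  then have "0 < ?v (S - H)"
    using eSH d0 m1 mult_left_mono[of "real (card (S - H))" m d] mult_pos_pos[of d m] by linarith
  also have "\<dots> \<le> ?v T" by (rule T(2)) simp
  finally have "T \<noteq> {}" using e0 by auto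
  have TS: "T \<subseteq> S" using T(1) by auto
  have low: "d \<le> card {y. adjacent_in Es T x y}" if "x \<in> T" for x
  proof -
    have "?v (T - {x}) \<le> ?v T" by (rule T(2)) (use T(1) in auto)
    moreover have "real (card (T - {x})) = real (card T) - 1"
      using card.remove[OF finT that] by simp
    ultimately show ?thesis using edge_count_remove[OF G(1,2) that] by (simp add: algebra_simps)
  qed
  have high: "card {y. adjacent_in Es T x y} \<le> 8 * real p * d" if "x \<in> T" for x
  proof -
    have "finite {y. adjacent_in Es S x y}"
      by (rule finite_subset[OF _ finS]) (auto simp: adjacent_in_def)
    then have "card {y. adjacent_in Es T x y} \<le> ?deg x"
      by (rule card_mono) (use TS in \<open>auto simp: adjacent_in_def\<close>)
    moreover have "real (?deg x) \<le> 8 * real p * d" using that T(1) TS by (auto simp: H_def not_less)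
    ultimately show ?thesis by linarith
  qed
  have "C / 4 * real (card T) powr \<alpha> \<le> d"
  proof -
    have "real (card T) powr \<alpha> \<le> m powr \<alpha>"
      unfolding m_def using assms(1) card_mono[OF finS TS] by (intro powr_mono2) auto
    then have "C * real (card T) powr \<alpha> \<le> B * m powr \<alpha>" using CB assms(2) by (intro mult_mono) auto
    then show ?thesis by (simp add: d_def)
  qed
  then show ?thesis using T(1) S(1) \<open>T \<noteq> {}\<close> low high by (intro exI[of _ T] exI[of _ d]) auto
qed

section \<open>The bound on the extremal number\<close>

text \<open>Either some length \<open>l\<close> has a proportion \<open>\<epsilon>\<close> of walks
  with robust ends, or every length has few. The same \<open>M\<close> has to serve both
  alternatives.\<close>

lemma near_regular_contains_subdivided:
  assumes K: "1 \<le> (K :: real)" and "1 \<le> s" "1 \<le> t" "1 \<le> k"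
  shows "\<exists>d0 C0. \<forall>(V :: 'a set) E d. near_regular V E d K \<longrightarrow> V \<noteq> {} \<longrightarrow> d0 \<le> d \<longrightarrow>
    C0 * real (card V) ^ s < d ^ (s * k + 1) \<longrightarrow> contains_subdivided E s t k"
proof -
  \<comment> \<open>The reciprocal of the denominator in the hypothesis of the case of few robust
    ends, so that the two cases are complementary.\<close>
  define \<epsilon> where "\<epsilon> = 1 / (4 * real ((k + 1) * (k + 1)) * K ^ k)"
  define M' where "M' = s + t + s * t * (k + 1) + (k + 3) * (k + 1)"
  define N where "N = M' + 3 + s + t"
  define \<eta> where "\<eta> = \<epsilon> / (4 * K ^ (k + 1))"
  define c where "c = (\<eta> / (2 * K ^ k)) ^ (N * k) * (\<epsilon> / (2 * K ^ k))"
  have Kk: "1 \<le> K ^ k" using K by simp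
  have c0: "1 \<le> 4 * real ((k + 1) * (k + 1)) * K ^ k"
  proof -
    have "1 \<le> (k + 1) * (k + 1)" by simp
    then have "1 \<le> real ((k + 1) * (k + 1))" by (metis of_nat_1 of_nat_le_iff)
    then show ?thesis using Kk mult_mono[of 1 "4 * real ((k + 1) * (k + 1))" 1 "K ^ k"] by linarith
  qed
  have \<epsilon>: "0 < \<epsilon>" "\<epsilon> \<le> 1" unfolding \<epsilon>_def using c0 by (simp_all del: of_nat_mult)
  have \<eta>0: "0 < \<eta>" using \<epsilon> K by (simp add: \<eta>_def)
  have cpos: "0 < c" using \<epsilon> \<eta>0 Kk by (simp add: c_def)
  \<comment> \<open>The excess of \<open>M\<close> over \<open>s * k\<close> is chosen only now,
    when \<open>c\<close> is fixed.\<close>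
  obtain n where n: "K * real ((M' * k + 1) ^ k) / c < real n" using reals_Archimedean2 by blast
  define M where "M = M' + k + s * k + n"
  have M: "M' + k \<le> M" "s * k \<le> M" "K * real ((M' * k + 1) ^ k) < c * real (M - s * k)"
  proof -
    have "real n \<le> real (M - s * k)" by (simp add: M_def)
    then have "c * real n \<le> c * real (M - s * k)" using cpos by simp
    moreover have "K * real ((M' * k + 1) ^ k) < c * real n" using n cpos by (simp add: pos_divide_less_eq mult.commute)
    ultimately show "K * real ((M' * k + 1) ^ k) < c * real (M - s * k)" by linarith
  qed (simp_all add: M_def)
  define A where "A = real ((M * k + 1) ^ (2 * k - 1))"
  define U where "U = real (t * (s * (k + 1))) * (k * K ^ (k - 1))"
  define C0 where "C0 = 4 * A * (U * (8 * A) ^ s * (4 * K ^ k))"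
  define d0 where "d0 = max (8 * (real s + 1) * real k * real k * K ^ k)
    (max (real (k * k + (M' + 1) * k) * K ^ k / \<eta> + 1) (max (2 * real N * real k * K ^ k / \<eta>) (N / c)))"
  have "contains_subdivided E s t k"
    if nr: "near_regular (V :: 'a set) E d K" and V: "V \<noteq> {}" and d: "d0 \<le> d"
      and C0: "C0 * real (card V) ^ s < d ^ (s * k + 1)" for V E d
  proof -
    interpret near_regular V E d K by (rule nr)
    have d1: "8 * (real s + 1) * real k * real k * K ^ k \<le> d" "real (k * k + (M' + 1) * k) * K ^ k / \<eta> < d"
      "2 * real N * real k * K ^ k / \<eta> \<le> d" "N / c \<le> d"
      using d unfolding d0_def by linarith+
    show ?thesis
    proof (cases "\<exists>l. 2 \<le> l \<and> l \<le> k \<and>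
        \<epsilon> * card V * d ^ l \<le> card {p \<in> all_walks l. robust E M l (p ! 0) (p ! l)}")
      case True
      then obtain l where l: "2 \<le> l" "l \<le> k"
        "\<epsilon> * card V * d ^ l \<le> card {p \<in> all_walks l. robust E M l (p ! 0) (p ! l)}" by blast
      show ?thesis
      proof (rule contains_subdivided_if_many_robust[OF l(1,2) V M'_def N_def \<epsilon> \<eta>_def c_def M _ _ _ l(3)])
        show "real (k * k + (M' + 1) * k) * K ^ k < \<eta> * d"
          using d1(2) \<eta>0 by (simp only: pos_divide_less_eq mult.commute)
        show "2 * real N * real k * K ^ k \<le> \<eta> * d"
          using d1(3) \<eta>0 by (simp only: pos_divide_le_eq mult.commute[of d])
        show "N \<le> c * d" using d1(4) cpos by (simp only: pos_divide_le_eq mult.commute[of d])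
      qed
    next
      case False
      have few: "card {q \<in> all_walks l. robust E M l (q ! 0) (q ! l)}
          \<le> card V * d ^ l / (4 * real ((k + 1) * (k + 1)) * K ^ k)" if "2 \<le> l" "l \<le> k" for l
      proof -
        have "card {q \<in> all_walks l. robust E M l (q ! 0) (q ! l)} < \<epsilon> * card V * d ^ l"
          using False that not_le by blast
        then show ?thesis unfolding \<epsilon>_def by simp
      qed
      show ?thesis
        by (rule contains_subdivided_if_few_robust[OF assms(4,2,3) V few d1(1) A_def U_def])
          (use C0 in \<open>simp_all add: C0_def\<close>)
    qed
  qed
  then show ?thesis by blast
qed

lemma near_regular_adjacent_in:
  fixes d K :: real
  assumes "\<forall>e\<in>Es. card e = 2" "finite T" "1 \<le> d" "1 \<le> K"
    and "\<And>x. x \<in> T \<Longrightarrow> d \<le> card {y. adjacent_in Es T x y} \<and> card {y. adjacent_in Es T x y} \<le> K * d"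
  shows "near_regular T (adjacent_in Es T) d K"
proof
  show "symp (adjacent_in Es T)" by (auto simp: symp_def adjacent_in_def insert_commute)
  show "\<not> adjacent_in Es T x x" for x using assms(1) by (auto simp: adjacent_in_def)
  show "real (card {y. adjacent_in Es T x y}) \<le> K * d" for x
  proof (cases "x \<in> T")
    case False
    then have "{y. adjacent_in Es T x y} = {}" by (auto simp: adjacent_in_def)
    then show ?thesis using assms(3,4) by simp
  qed (use assms(5) in simp)
qed (use assms in \<open>auto simp: adjacent_in_def\<close>)

text \<open>Both orientations appear because the edges of \<open>subdivision\<close> are indexed by
  ordered pairs \<open>u\<close>, \<open>v\<close>.\<close>

lemma edges_complete_bipartite:
  "{u, v} \<in> edges (complete_bipartite s t) \<longleftrightarrow>
    (\<exists>i<s. \<exists>j<t. u = Inl i \<and> v = Inr j \<or> u = Inr j \<and> v = Inl i)"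
  by (auto simp: complete_bipartite_def doubleton_eq_iff)

lemma contains_copy_if_contains_subdivided:
  assumes sub: "contains_subdivided E s t k" and "1 \<le> s" "1 \<le> t" "1 \<le> k"
    and E: "\<And>x y. E x y \<Longrightarrow> x \<in> verts G \<and> y \<in> verts G \<and> {x, y} \<in> edges G"
  shows "contains_copy G (subdivision (k - 1) (complete_bipartite s t))"
proof -
  obtain a b P where ab: "inj_on a {..<s}" "inj_on b {..<t}" "a ` {..<s} \<inter> b ` {..<t} = {}"
    and P: "\<And>i j. i < s \<Longrightarrow> j < t \<Longrightarrow> path E k (a i) (b j) (P i j)"
      "\<And>i j. i < s \<Longrightarrow> j < t \<Longrightarrow> set (P i j) \<inter> (a ` {..<s} \<union> b ` {..<t}) = {a i, b j}"
    and disj: "\<And>i j i' j'. i < s \<Longrightarrow> j < t \<Longrightarrow> i' < s \<Longrightarrow> j' < t \<Longrightarrow> (i, j) \<noteq> (i', j') \<Longrightarrow>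
      set (P i j) \<inter> set (P i' j') \<subseteq> a ` {..<s} \<union> b ` {..<t}"
    using sub unfolding contains_subdivided_def by metis
  let ?m = "k - 1"
  let ?H = "complete_bipartite s t"
  let ?pv = "\<lambda>i j. path_vertex ?m (Inl i :: nat + nat) (Inr j)"
  have m: "?m + 1 = k" using assms(4) by simp
  \<comment> \<open>The name of an inner vertex contains one pair for each side; \<open>THE\<close>
    reads off \<open>i\<close>, \<open>j\<close> and the distance from \<open>Inl i\<close>, which
    is the position on \<open>P i j\<close>.\<close>
  define f where "f z = (case z of Branch (Inl i) \<Rightarrow> a i | Branch (Inr j) \<Rightarrow> b j
    | Inner S \<Rightarrow> P (THE i. \<exists>n. (Inl i, n) \<in> S) (THE j. \<exists>n. (Inr j, n) \<in> S) ! (THE n. \<exists>i. (Inl i, n) \<in> S))"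
    for z :: "(nat + nat) subdiv_vertex"
  have P0: "P i j ! 0 = a i" "P i j ! k = b j" "length (P i j) = Suc k" "distinct (P i j)"
    "\<And>n. n < k \<Longrightarrow> E (P i j ! n) (P i j ! Suc n)" if "i < s" "j < t" for i j
    using P(1)[OF that] by (auto simp: path_def walk_def)
  have f: "f (?pv i j n) = P i j ! n" if "i < s" "j < t" "n \<le> k" for i j n
    using that P0(1,2)[OF that(1,2)] m by (auto simp: f_def path_vertex_def)
  have verts: "verts (subdivision ?m ?H) \<subseteq> {?pv i j n | i j n. i < s \<and> j < t \<and> n \<le> k}"
  proof
    fix z assume "z \<in> verts (subdivision ?m ?H)"
    then have "z \<in> Branch ` verts ?H \<or> (\<exists>u v n. {u, v} \<in> edges ?H \<and> 1 \<le> n \<and> n \<le> ?m \<and> z = path_vertex ?m u v n)"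
      by (auto simp: subdivision_def)
    moreover have "verts ?H = Inl ` {..<s} \<union> Inr ` {..<t}" by (simp add: complete_bipartite_def)
    ultimately consider i where "i < s" "z = Branch (Inl i)" | j where "j < t" "z = Branch (Inr j)"
      | u v n where "{u, v} \<in> edges ?H" "1 \<le> n" "n \<le> ?m" "z = path_vertex ?m u v n"
      by blast
    then show "z \<in> {?pv i j n | i j n. i < s \<and> j < t \<and> n \<le> k}"
    proof cases
      case 1
      then have "z = ?pv i 0 0" by (simp add: path_vertex_def)
      then show ?thesis using 1 assms(3) by (intro CollectI exI[of _ i] exI[of _ 0]) auto
    next
      case 2
      then have "z = ?pv 0 j k" using m by (simp add: path_vertex_def)
      then show ?thesis using 2 assms(2) by (intro CollectI exI[of _ 0] exI[of _ j] exI[of _ k]) auto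
    next
      case 3
      then obtain i j where ij: "i < s" "j < t" "u = Inl i \<and> v = Inr j \<or> u = Inr j \<and> v = Inl i"
        unfolding edges_complete_bipartite by blast
      from ij(3) show ?thesis
      proof
        assume "u = Inl i \<and> v = Inr j"
        then show ?thesis using ij 3 by (intro CollectI exI[of _ i] exI[of _ j] exI[of _ n]) auto
      next
        assume "u = Inr j \<and> v = Inl i"
        then have "z = ?pv i j (k - n)" using path_vertex_rev[of n ?m "Inl i" "Inr j"] 3 m by simp
        then show ?thesis using ij by (intro CollectI exI[of _ i] exI[of _ j] exI[of _ "k - n"]) auto
      qed
    qed
  qed
  \<comment> \<open>Distinct paths share only branch vertices, and each of them meets the branch
    vertices only in its own ends. As the two sides are disjoint, a common vertex is a common end on
    the same side, so both positions are 0 or both are \<open>k\<close>.\<close>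
  have key: "?pv i j n = ?pv i' j' n'"
    if h: "i < s" "j < t" "n \<le> k" "i' < s" "j' < t" "n' \<le> k" "P i j ! n = P i' j' ! n'" for i j n i' j' n'
  proof (cases "(i, j) = (i', j')")
    case True
    then have "n = n'" using h P0(3,4)[OF h(1,2)] by (auto simp: nth_eq_iff_index_eq)
    then show ?thesis using True by simp
  next
    case False
    let ?x = "P i j ! n"
    have "?x \<in> set (P i j)" "P i' j' ! n' \<in> set (P i' j')"
      using h(3,6) P0(3)[OF h(1,2)] P0(3)[OF h(4,5)] by (simp_all add: nth_mem)
    then have x: "?x \<in> set (P i j)" "?x \<in> set (P i' j')" using h(7) by simp_all
    then have "?x \<in> a ` {..<s} \<union> b ` {..<t}" using disj[OF h(1,2,4,5) False] by blast
    then have "?x \<in> {a i, b j}" "?x \<in> {a i', b j'}"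
      using x P(2)[OF h(1,2)] P(2)[OF h(4,5)] by blast+
    moreover have "a i \<noteq> b j'" "a i' \<noteq> b j" using ab(3) h by auto
    ultimately consider "?x = a i" "a i = a i'" | "?x = b j" "b j = b j'" by auto
    then show ?thesis
    proof cases
      case 1
      then have "i = i'" using ab(1) h by (auto dest: inj_onD)
      have "n = 0" using 1 h P0[OF h(1,2)] by (metis le_imp_less_Suc nth_eq_iff_index_eq zero_less_Suc)
      moreover have "n' = 0" using 1 h P0[OF h(4,5)] by (metis le_imp_less_Suc nth_eq_iff_index_eq zero_less_Suc)
      ultimately show ?thesis using \<open>i = i'\<close> by (simp add: path_vertex_def)
    next
      case 2
      then have "j = j'" using ab(2) h by (auto dest: inj_onD)
      have "n = k" using 2 h P0[OF h(1,2)] by (metis le_imp_less_Suc lessI nth_eq_iff_index_eq)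
      moreover have "n' = k" using 2 h P0[OF h(4,5)] by (metis le_imp_less_Suc lessI nth_eq_iff_index_eq)
      ultimately show ?thesis using \<open>j = j'\<close> m by (simp add: path_vertex_def)
    qed
  qed
  have "inj_on f (verts (subdivision ?m ?H))"
  proof (rule inj_onI)
    fix y z assume yz: "y \<in> verts (subdivision ?m ?H)" "z \<in> verts (subdivision ?m ?H)" "f y = f z"
    obtain i j n where y: "y = ?pv i j n" "i < s" "j < t" "n \<le> k" using yz(1) verts by blast
    obtain i' j' n' where z: "z = ?pv i' j' n'" "i' < s" "j' < t" "n' \<le> k" using yz(2) verts by blast
    show "y = z" using key[of i j n i' j' n'] f[of i j n] f[of i' j' n'] y z yz(3) by simp
  qed
  moreover have "f ` verts (subdivision ?m ?H) \<subseteq> verts G"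
  proof
    fix x assume "x \<in> f ` verts (subdivision ?m ?H)"
    then obtain z where z: "z \<in> verts (subdivision ?m ?H)" "x = f z" by blast
    then obtain i j n where "z = ?pv i j n" and h: "i < s" "j < t" "n \<le> k" using verts by blast
    then have x: "x = P i j ! n" using f z by simp
    show "x \<in> verts G"
    proof (cases "n = k")
      case True
      then have "E (P i j ! ?m) x" using P0(5)[OF h(1,2), of ?m] x m by simp
      then show ?thesis using E by blast
    next
      case False
      then have "E x (P i j ! Suc n)" using P0(5)[OF h(1,2), of n] x h by simp
      then show ?thesis using E by blast
    qed
  qed
  moreover have "\<forall>e\<in>edges (subdivision ?m ?H). f ` e \<in> edges G"
  proof
    fix e assume "e \<in> edges (subdivision ?m ?H)"
    then obtain u v n where e: "e = {path_vertex ?m u v n, path_vertex ?m u v (n + 1)}" "{u, v} \<in> edges ?H" "n \<le> ?m"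
      by (auto simp: subdivision_def)
    then obtain i j where ij: "i < s" "j < t" "u = Inl i \<and> v = Inr j \<or> u = Inr j \<and> v = Inl i"
      unfolding edges_complete_bipartite by blast
    have "\<exists>n<k. e = {?pv i j n, ?pv i j (Suc n)}"
      using ij(3)
    proof
      assume "u = Inl i \<and> v = Inr j"
      then show ?thesis using e m by (intro exI[of _ n]) auto
    next
      assume uv: "u = Inr j \<and> v = Inl i"
      have "path_vertex ?m u v n = ?pv i j (k - n)" "path_vertex ?m u v (n + 1) = ?pv i j (k - (n + 1))"
        using path_vertex_rev[of n ?m "Inl i" "Inr j"] path_vertex_rev[of "n + 1" ?m "Inl i" "Inr j"] e(3) m uv
        by simp_all
      moreover have "Suc (k - (n + 1)) = k - n" "k - (n + 1) < k" using e(3) m by auto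
      ultimately show ?thesis using e(1) by (intro exI[of _ "k - (n + 1)"]) auto
    qed
    then obtain n where n: "n < k" "e = {?pv i j n, ?pv i j (Suc n)}" by blast
    then have "f ` e = {P i j ! n, P i j ! Suc n}" using f[OF ij(1,2)] by simp
    then show "f ` e \<in> edges G" using E[OF P0(5)[OF ij(1,2) n(1)]] by simp
  qed
  ultimately show ?thesis unfolding contains_copy_def by blast
qed

lemma subdivided_complete_bipartite_bigo:
  assumes "1 \<le> s" "1 \<le> t" "1 \<le> k"
  shows "(\<lambda>n. real (extremal_number n (subdivision (k - 1) (complete_bipartite s t))))
    \<in> O(\<lambda>n. real n powr (1 + real s / (real s * real k + 1)))"
proof -
  define \<alpha> where "\<alpha> = real s / (real s * real k + 1)"
  have pos: "0 < real s * real k + 1" by (simp add: add_nonneg_pos)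
  have \<alpha>: "0 < \<alpha>" using assms(1) pos by (simp add: \<alpha>_def)
  \<comment> \<open>Solved from \<open>(3 / p) powr \<alpha> \<le> 1 / 12\<close>; the bound
    \<open>8 * p\<close> on the ratio of degrees thus depends on \<open>s\<close> and
    \<open>k\<close> only.\<close>
  obtain p :: nat where p: "3 * 12 powr (1 / \<alpha>) < p" using reals_Archimedean2 by blast
  have p0: "0 < real p" using p by (smt (verit) powr_ge_zero)
  have p12: "(3 / real p) powr \<alpha> \<le> 1 / 12"
  proof -
    have "3 / real p \<le> 12 powr (- (1 / \<alpha>))"
      using p p0 by (simp add: powr_minus field_simps)
    then have "(3 / real p) powr \<alpha> \<le> (12 powr (- (1 / \<alpha>))) powr \<alpha>"
      using \<alpha> p0 by (intro powr_mono2) auto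
    also have "\<dots> = 12 powr (- (1 / \<alpha>) * \<alpha>)" by (rule powr_powr)
    also have "- (1 / \<alpha>) * \<alpha> = - 1" using \<alpha> by simp
    also have "12 powr (- 1 :: real) = 1 / 12" by (simp add: powr_minus_divide)
    finally show ?thesis .
  qed
  define K where "K = 8 * real p"
  have p1: "1 \<le> p" using p0 by simp
  have K: "1 \<le> K" using p1 by (simp add: K_def)
  obtain d0 C0 where main: "\<And>(V :: nat set) E d. near_regular V E d K \<Longrightarrow> V \<noteq> {} \<Longrightarrow> d0 \<le> d \<Longrightarrow>
      C0 * real (card V) ^ s < d ^ (s * k + 1) \<Longrightarrow> contains_subdivided E s t k"
    using near_regular_contains_subdivided[OF K assms] by metis
  \<comment> \<open>The subgraph has \<open>C / 4 * card T powr \<alpha> \<le> d\<close>. So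
    \<open>C / 4\<close> has to dominate \<open>d0\<close> and exceed \<open>C0\<close>, and being
    at least 1 it does not exceed its power with exponent \<open>s * k + 1\<close>.\<close>
  define C where "C = 4 * max 1 (max d0 (C0 + 1))"
  have C: "1 \<le> C / 4" "d0 \<le> C / 4" "C0 < C / 4" by (auto simp: C_def)
  show ?thesis unfolding \<alpha>_def[symmetric]
  proof (rule extremal_number_bigo[where C = C])
    show "0 < C" using C(1) by simp
    fix G :: "nat ugraph" and n assume G: "1 \<le> n" "finite_simple_graph G" "card (verts G) = n"
      "C * real n powr (1 + \<alpha>) \<le> card (edges G)"
    have sub: "edges G \<subseteq> Pow (verts G)" "finite (verts G)" and card2: "\<forall>e\<in>edges G. card e = 2"
      using G(2) by (auto simp: finite_simple_graph_def)
    have fin: "finite (edges G)" using sub by (meson finite_Pow_iff finite_subset)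
    have ne: "verts G \<noteq> {}" using G(1,3) by auto
    have "edge_count (edges G) (verts G) = card (edges G)"
      unfolding edge_count_def using sub(1) by (intro arg_cong[where f = card]) auto
    then have "C * real (card (verts G)) powr (1 + \<alpha>) \<le> edge_count (edges G) (verts G)" using G by simp
    note near_regular_subgraph[OF \<alpha> \<open>0 < C\<close> p1 p12 fin card2 sub(2) ne this, folded K_def]
    then obtain T and d :: real where "T \<subseteq> verts G \<and> T \<noteq> {} \<and> C / 4 * real (card T) powr \<alpha> \<le> d \<and>
        (\<forall>x\<in>T. d \<le> card {y. adjacent_in (edges G) T x y} \<and> card {y. adjacent_in (edges G) T x y} \<le> K * d)"
      by (elim exE)
    then have T: "T \<subseteq> verts G" "T \<noteq> {}" "C / 4 * real (card T) powr \<alpha> \<le> d"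
      "\<And>x. x \<in> T \<Longrightarrow> d \<le> card {y. adjacent_in (edges G) T x y} \<and> card {y. adjacent_in (edges G) T x y} \<le> K * d"
      by simp_all
    have finT: "finite T" using T(1) sub(2) finite_subset by blast
    have m1: "1 \<le> real (card T)" using T(2) finT by (simp add: Suc_le_eq card_gt_0_iff)
    then have "1 \<le> real (card T) powr \<alpha>" using \<alpha> by (intro ge_one_powr_ge_zero) auto
    then have Cd: "C / 4 \<le> d" using T(3) C(1) mult_left_mono[of 1 "real (card T) powr \<alpha>" "C / 4"] by linarith
    have "contains_subdivided (adjacent_in (edges G) T) s t k"
    proof (rule main[OF near_regular_adjacent_in T(2)])
      show "d0 \<le> d" "1 \<le> d" using Cd C by auto
      \<comment> \<open>This is where the value of \<open>\<alpha>\<close> enters: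
        \<open>\<alpha> * (s * k + 1) = s\<close>.\<close>
      have mT: "real (card T) ^ s = (real (card T) powr \<alpha>) ^ (s * k + 1)"
      proof -
        have "\<alpha> * real (s * k + 1) = s"
          unfolding \<alpha>_def of_nat_add of_nat_mult of_nat_1 using pos by simp
        moreover have "(real (card T) powr \<alpha>) ^ (s * k + 1) = real (card T) powr (\<alpha> * real (s * k + 1))"
          using powr_realpow[of "real (card T) powr \<alpha>" "s * k + 1"] m1 by (simp add: powr_powr)
        ultimately show ?thesis using m1 by (simp add: powr_realpow)
      qed
      have "C0 * real (card T) ^ s < C / 4 * real (card T) ^ s"
        using C(3) m1 by (intro mult_strict_right_mono) auto
      also have "\<dots> \<le> (C / 4) ^ (s * k + 1) * real (card T) ^ s"
        using C(1) power_increasing[of 1 "s * k + 1" "C / 4"] m1 by (intro mult_right_mono) auto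
      also have "\<dots> = (C / 4 * real (card T) powr \<alpha>) ^ (s * k + 1)"
        by (simp only: mT power_mult_distrib)
      also have "\<dots> \<le> d ^ (s * k + 1)" using T(3) C(1) by (intro power_mono) auto
      finally show "C0 * real (card T) ^ s < d ^ (s * k + 1)" .
    qed (use card2 finT K T(4) in auto)
    then show "contains_copy G (subdivision (k - 1) (complete_bipartite s t))"
      by (rule contains_copy_if_contains_subdivided) (use assms T(1) in \<open>auto simp: adjacent_in_def\<close>)
  qed
qed

theorem theorem1p16:
  shows "(\<forall>s t k :: nat. s \<ge> 1 \<and> t \<ge> 1 \<and> k \<ge> 1 \<longrightarrow>
            (\<lambda>n. real (extremal_number n (subdivision (k - 1) (complete_bipartite s t))))
              \<in> O(\<lambda>n. real n powr (1 + real s / (real s * real k + 1))))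
       \<and> (\<forall>(H :: 'a ugraph) (k :: nat). finite_simple_graph H \<and> bipartite H \<and> k \<ge> 1 \<longrightarrow>
            (\<exists>\<delta> :: real. \<delta> > 0 \<and>
              (\<lambda>n. real (extremal_number n (subdivision (k - 1) H)))
                \<in> O(\<lambda>n. real n powr (1 + 1 / real k - \<delta>))))"
proof (intro conjI allI impI)
  fix s t k :: nat assume "s \<ge> 1 \<and> t \<ge> 1 \<and> k \<ge> 1"
  then show "(\<lambda>n. real (extremal_number n (subdivision (k - 1) (complete_bipartite s t))))
      \<in> O(\<lambda>n. real n powr (1 + real s / (real s * real k + 1)))"
    using subdivided_complete_bipartite_bigo by blast
next
  fix H :: "'a ugraph" and k :: nat
  assume H: "finite_simple_graph H \<and> bipartite H \<and> k \<ge> 1"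
  then have "finite_simple_graph H" "bipartite H" by auto
  then obtain \<phi> s t where \<phi>: "1 \<le> s" "1 \<le> t" "inj_on \<phi> (verts H)"
    "\<phi> ` verts H \<subseteq> verts (complete_bipartite s t)"
    "\<And>e. e \<in> edges H \<Longrightarrow> \<phi> ` e \<in> edges (complete_bipartite s t)"
    by (rule bipartite_into_complete_bipartite) (rule that)
  let ?K = "complete_bipartite s t"
  have "contains_copy (subdivision (k - 1) ?K) (subdivision (k - 1) H)"
    by (rule contains_copy_subdivision[OF \<phi>(3-5)]) (use H in \<open>auto simp: finite_simple_graph_def\<close>)
  then have le: "extremal_number n (subdivision (k - 1) H) \<le> extremal_number n (subdivision (k - 1) ?K)" for n
    by (rule extremal_number_mono)
  define q where "q = real s * real k + 1"
  \<comment> \<open>The difference between \<open>1 / k\<close> and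
    \<open>s / (s * k + 1)\<close>.\<close>
  define \<delta> where "\<delta> = 1 / (real k * q)"
  have pos: "0 < real k" "0 < q" using H by (auto simp: q_def add_nonneg_pos)
  have "1 / real k - \<delta> = (q - 1) / (real k * q)" using pos by (simp add: \<delta>_def diff_divide_distrib)
  also have "\<dots> = real s / q" using pos(1) by (simp add: q_def)
  finally have exponent: "1 + 1 / real k - \<delta> = 1 + real s / (real s * real k + 1)" by (simp add: q_def)
  have "(\<lambda>n. real (extremal_number n (subdivision (k - 1) H)))
      \<in> O(\<lambda>n. real (extremal_number n (subdivision (k - 1) ?K)))"
    using le by (intro landau_o.bigI[of 1]) auto
  moreover have "(\<lambda>n. real (extremal_number n (subdivision (k - 1) ?K)))
      \<in> O(\<lambda>n. real n powr (1 + real s / (real s * real k + 1)))"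
    using subdivided_complete_bipartite_bigo[OF \<phi>(1,2), of k] H by blast
  ultimately have "(\<lambda>n. real (extremal_number n (subdivision (k - 1) H)))
      \<in> O(\<lambda>n. real n powr (1 + 1 / real k - \<delta>))"
    unfolding exponent by (rule landau_o.big.trans)
  moreover have "0 < \<delta>" using pos by (simp add: \<delta>_def)
  ultimately show "\<exists>\<delta>>0. (\<lambda>n. real (extremal_number n (subdivision (k - 1) H)))
      \<in> O(\<lambda>n. real n powr (1 + 1 / real k - \<delta>))" by blast
qed

end
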